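(* Let $b\ge 1$, let $p_1,p_2\in\mathbb{S}^2$ be the points with $\phi(p_1)=ib$ and $\phi(p_2)=-ib$, and let $$Q(x)=a\log\frac{1}{\|x-p_1\|}+a\log\frac{1}{\|x-p_2\|},\qquad x\in\mathbb{S}^2,$$ with $a>0$. Suppose $a>a_{cr}=(b^2-1)^{-1}$. Let $D$ be the support of the equilibrium measure $\mu_Q$ on $\mathbb{S}^2$ in the external field $Q$, and let $\Omega=\phi(D)$. Then $\Omega$ is the compact region in the complex plane enclosed by the ellipse with equation (where $z=x+iy$) $$\frac{2(b^2a-a-1)}{b^2+1}x^2+\frac{2(b^2a+a+1)}{b^2-1}y^2=1.$$
   Context: $\mathbb{S}^2=\{x\in\mathbb{R}^3:\|x\|=1\}$ with the Euclidean norm $\|\cdot\|$. The stereographic projection $\phi:\mathbb{S}^2\to\mathbb{C}\cup\{\infty\}$ is $\phi(x_1,x_2,x_3)=\frac{x_1+ix_2}{1-x_3}$ for $x_3\ne1$, and $\phi(0,0,1)=\infty$. For an external field $Q:\mathbb{S}^2\to\mathbb{R}\cup\{+\infty\}$ (lower semicontinuous and finite on a set of positive logarithmic capacity), the weighted logarithmic energy of a probability measure $\mu$ on $\mathbb{S}^2$ is $$I_Q[\mu]=\iint\log\frac{1}{\|x-y\|}\,d\mu(x)d\mu(y)+2\int Q\,d\mu ,$$ and the equilibrium measure $\mu_Q$ is the unique probability measure on $\mathbb{S}^2$ minimizing $I_Q$. Convention: $a_{cr}=+\infty$ if $b=1$ (so the hypothesis $a>a_{cr}$ forces $b>1$). 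*)

theory Defs
  imports "HOL-Probability.Probability"
begin

abbreviation S2 :: "(real ^ 3) set" where
  "S2 \<equiv> sphere 0 1"

text \<open>The extended plane is \<^typ>\<open>complex option\<close>, with \<^const>\<open>None\<close> as the point at infinity.
  On the sphere the third coordinate is \<open>1\<close> only at the north pole.\<close>

definition stereographic :: "real ^ 3 \<Rightarrow> complex option" where
  "stereographic x =
     (if x $ 3 = 1 then None
      else Some ((complex_of_real (x $ 1) + \<i> * complex_of_real (x $ 2)) / complex_of_real (1 - x $ 3)))"

text \<open>The value on the diagonal is set by hand, since \<open>ln (1 / 0) = 0\<close> over the reals.\<close>

definition log_kernel :: "real ^ 3 \<Rightarrow> real ^ 3 \<Rightarrow> ereal" where
  "log_kernel x y = (if x = y then \<infinity> else ereal (ln (1 / norm (x - y))))"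

text \<open>Integral of an extended real function, as the integral of its positive part minus that of
  its negative part (\<^const>\<open>e2ennreal\<close> sends negative values to \<open>0\<close>). The functions integrated
  below are bounded below and the measures finite, so \<open>\<infinity> - \<infinity>\<close> does not arise.\<close>

definition ereal_integral :: "'a measure \<Rightarrow> ('a \<Rightarrow> ereal) \<Rightarrow> ereal" where
  "ereal_integral M f =
     enn2ereal (\<integral>\<^sup>+ x. e2ennreal (f x) \<partial>M) - enn2ereal (\<integral>\<^sup>+ x. e2ennreal (- f x) \<partial>M)"

definition sphere_prob_measures :: "(real ^ 3) measure set" where
  "sphere_prob_measures = {\<mu>. prob_space \<mu> \<and> sets \<mu> = sets (restrict_space borel S2)}"

definition weighted_energy :: "(real ^ 3 \<Rightarrow> ereal) \<Rightarrow> (real ^ 3) measure \<Rightarrow> ereal" where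
  "weighted_energy Q \<mu> =
     ereal_integral \<mu> (\<lambda>y. ereal_integral \<mu> (\<lambda>x. log_kernel x y)) + 2 * ereal_integral \<mu> Q"

definition equilibrium_measure :: "(real ^ 3 \<Rightarrow> ereal) \<Rightarrow> (real ^ 3) measure" where
  "equilibrium_measure Q =
     (THE \<mu>. \<mu> \<in> sphere_prob_measures \<and>
        (\<forall>\<nu> \<in> sphere_prob_measures. weighted_energy Q \<mu> \<le> weighted_energy Q \<nu>))"

definition measure_support :: "'a::topological_space measure \<Rightarrow> 'a set" where
  "measure_support \<mu> =
     {x \<in> space \<mu>. \<forall>U. open U \<longrightarrow> x \<in> U \<longrightarrow> emeasure \<mu> (U \<inter> space \<mu>) > 0}"

definition a_cr :: "real \<Rightarrow> ereal" where
  "a_cr b = (if b = 1 then \<infinity> else ereal (inverse (b\<^sup>2 - 1)))"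

end

theory Submission
  imports Defs "HOL-Complex_Analysis.Complex_Analysis" "HOL-Real_Asymp.Real_Asymp"
begin

text \<open>On the sphere \<open>log (1 / |x - y|) = - log 2 + \<Sum>n\<ge>1. u\<^sup>n / (2 n)\<close> with \<open>u = (1 + x \<bullet> y) / 2 \<in> [0, 1]\<close>.
  The powers of \<open>u\<close> are sums of products of monomials in \<open>x\<close> and in \<open>y\<close>, so the energy is a sum of
  squares of moments and is strictly convex. Hence a measure \<open>\<mu>\<close> satisfying Frostman's conditions
  (the weighted potential is constant on the support and not smaller elsewhere) is the unique minimiser.

  The candidate is the uniform measure on the region which in the Lambert equal-area coordinate is bounded by the
  ellipse with half-axes proportional to \<open>b + 1 / b\<close> and \<open>b - 1 / b\<close>. It is a superposition over
  \<open>0 < s < s\<^sub>0\<close> of measures carried by the homothetic ellipses \<open>sqrt s * (b * \<zeta> + 1 / (b * \<zeta>))\<close>,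
  \<open>|\<zeta>| = 1\<close>. Averaging the kernel over the ellipse with parameter \<open>s\<close> leads, by Jensen's formula, to
  \<open>max 0 (log |r|)\<close>, where \<open>r\<close> is the larger root of a quadratic polynomial with coefficients in
  \<open>w\<^sup>2\<close> and \<open>1 / s\<close>; it lies outside the unit disc exactly while the ellipse has not reached \<open>w\<close>. With
  \<open>d = b\<^sup>2 - 1 / b\<^sup>2\<close> and \<open>A\<close>, \<open>B\<close> the solutions of
  \<open>A - B = d * s\<close>, \<open>(w\<^sup>2 b\<^sup>2 + 1) / A - (w\<^sup>2 / b\<^sup>2 + 1) / B = d * w\<^sup>2\<close>, the function
  \<open>d * s * log |r| + log |A / B|\<close> is a primitive of \<open>d * log |r|\<close>. It gives the potential on the
  region, and it gives Frostman's inequality outside because \<open>max 0 (log |r|)\<close> is nonnegative.\<close>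

subsection \<open>The logarithmic kernel as a power series\<close>

text \<open>Away from the charges the spherical Laplacian of a logarithmic potential is constant, so
  a measure whose total potential is constant on an open set has constant density there. Relative to
  normalised area this density is \<open>1 + 2 * a\<close>, the unit mass plus the two charges, and
  the droplet must cover the fraction \<open>1 / (1 + 2 * a)\<close> of the sphere. In the Lambert
  coordinate the sphere is the unit disc of area \<open>pi\<close> and the ellipse with parameter
  \<open>s\<close> has area \<open>pi * s * d\<close>; this fixes the size by
  \<open>s0 * d * (1 + 2 * a) = 1\<close>. The long half-axis reaches the unit circle, which stands
  for the north pole, at \<open>s_crit = 1 / (b + 1 / b)\<^sup>2\<close>, and
  \<open>a > a_cr b\<close> is the condition \<open>s0 < s_crit\<close>. The obstacle is Frostman's
  inequality at points that no ellipse reaches before \<open>s_crit\<close>: the primitive cannot be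
  followed up to the parameter of such a point, where its value would be explicit. It is followed up
  to \<open>s_crit\<close> only, where the square root becomes rational in \<open>w\<close> and a
  separate inequality closes the gap.\<close>

definition pos_kernel :: "real ^ 3 \<Rightarrow> real ^ 3 \<Rightarrow> ennreal" where
  "pos_kernel x y = (\<Sum>n. ennreal (((1 + x \<bullet> y) / 2) ^ Suc n / (2 * Suc n)))"

lemma half_one_plus_inner_sphere:
  assumes "x \<in> S2" "y \<in> S2"
  shows "0 \<le> (1 + x \<bullet> y) / 2" "(1 + x \<bullet> y) / 2 \<le> 1"
    and "1 - (1 + x \<bullet> y) / 2 = (norm (x - y))\<^sup>2 / 4"
proof -
  have n: "norm x = 1" "norm y = 1" using assms by auto
  show "1 - (1 + x \<bullet> y) / 2 = (norm (x - y))\<^sup>2 / 4"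
    using n by (simp add: power2_norm_eq_inner norm_eq_1 inner_diff inner_commute field_simps)
  show "0 \<le> (1 + x \<bullet> y) / 2" "(1 + x \<bullet> y) / 2 \<le> 1"
    using Cauchy_Schwarz_ineq2[of x y] n by auto
qed

lemma pos_kernel_commute: "pos_kernel x y = pos_kernel y x"
  by (simp add: pos_kernel_def inner_commute)

text \<open>At coinciding points \<open>u = 1\<close> and the series is half the harmonic
  series.\<close>

lemma pos_kernel_refl:
  assumes "x \<in> S2" shows "pos_kernel x x = \<infinity>"
proof -
  have "x \<bullet> x = 1" using assms by (simp add: norm_eq_1)
  have *: "\<not> summable (\<lambda>n. 1 / (2 * real (Suc n)))"
  proof
    assume "summable (\<lambda>n. 1 / (2 * real (Suc n)))"
    then have "summable (\<lambda>n. 2 * (1 / (2 * real (Suc n))))" by (rule summable_mult)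
    moreover have "2 * (1 / (2 * real (Suc n))) = inverse (real (Suc n))" for n by (simp add: divide_simps)
    ultimately have "summable (\<lambda>n. inverse (real (Suc n)))" by simp
    then show False using not_summable_harmonic[where 'a=real] summable_Suc_iff[of "\<lambda>n. inverse (real n)"] by simp
  qed
  show ?thesis
  proof (rule ccontr)
    assume "pos_kernel x x \<noteq> \<infinity>"
    then have "(\<Sum>n. ennreal (1 / (2 * real (Suc n)))) \<noteq> top"
      using \<open>x \<bullet> x = 1\<close> by (simp add: pos_kernel_def)
    then have "summable (\<lambda>n. 1 / (2 * real (Suc n)))"
      by (rule summable_suminf_not_top[rotated]) simp
    with * show False by contradiction
  qed
qed

text \<open>Since \<open>1 - u\<close> is a quarter of the squared chord, this is the series of
  \<open>- ln (1 - u) / 2\<close>; distinct points have \<open>u < 1\<close>.\<close>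

lemma pos_kernel_eq_ln:
  assumes "x \<in> S2" "y \<in> S2" "x \<noteq> y"
  shows "pos_kernel x y = ennreal (- ln ((norm (x - y))\<^sup>2 / 4) / 2)"
    and "0 \<le> - ln ((norm (x - y))\<^sup>2 / 4) / 2"
proof -
  define u where "u = (1 + x \<bullet> y) / 2"
  note u = half_one_plus_inner_sphere[OF assms(1,2), folded u_def]
  have "(norm (x - y))\<^sup>2 / 4 > 0" using assms by simp
  then have u1: "u < 1" using u by linarith
  have "(\<lambda>n. - ((-(-u))^n) / of_nat n) sums ln (1 + (- u))"
    by (rule ln_series') (use u u1 in auto)
  then have "(\<lambda>n. - (u^n / of_nat n)) sums ln (1 - u)" by simp
  then have "(\<lambda>n. - (- (u^n / of_nat n))) sums - ln (1 - u)" by (rule sums_minus)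
  then have "(\<lambda>n. u^n / of_nat n) sums - ln (1 - u)" by simp
  then have "(\<lambda>n. u^Suc n / of_nat (Suc n)) sums - ln (1 - u)"
    by (subst sums_Suc_iff) simp
  then have "(\<lambda>n. (u^Suc n / of_nat (Suc n)) / 2) sums (- ln (1 - u) / 2)" by (rule sums_divide)
  then have s: "(\<lambda>n. u^Suc n / (2 * Suc n)) sums (- ln (1 - u) / 2)" by (simp add: field_simps)
  have "pos_kernel x y = ennreal (\<Sum>n. u^Suc n / (2 * Suc n))"
    unfolding pos_kernel_def u_def[symmetric]
    by (rule suminf_ennreal2) (use u sums_summable[OF s] in auto)
  with sums_unique[OF s] u(3) show "pos_kernel x y = ennreal (- ln ((norm (x - y))\<^sup>2 / 4) / 2)" by simp
  have "0 \<le> - ln (1 - u) / 2" using u u1 by simp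
  then show "0 \<le> - ln ((norm (x - y))\<^sup>2 / 4) / 2" unfolding u(3) .
qed

text \<open>Chords have length at most \<open>2\<close>, so adding \<open>ln 2\<close> makes the
  kernel nonnegative. Energies and potentials can then be handled in \<open>ennreal\<close>, where
  Tonelli needs no integrability and the infinite diagonal needs no care.\<close>

lemma log_kernel_eq_pos_kernel:
  assumes "x \<in> S2" "y \<in> S2"
  shows "log_kernel x y = enn2ereal (pos_kernel x y) - ereal (ln 2)"
proof (cases "x = y")
  case True
  then show ?thesis using assms by (simp add: log_kernel_def pos_kernel_refl)
next
  case False
  have "norm (x - y) / 2 > 0" using False by simp
  have "ln ((norm (x - y))\<^sup>2 / 4) = ln ((norm (x - y) / 2)\<^sup>2)" by (simp add: power_divide)
  also have "\<dots> = 2 * ln (norm (x - y) / 2)"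
    using \<open>norm (x - y) / 2 > 0\<close> by (simp add: ln_realpow)
  also have "\<dots> = 2 * ln (norm (x - y)) - 2 * ln 2" using False by (simp add: ln_div)
  finally have "ln ((norm (x - y))\<^sup>2 / 4) = 2 * ln (norm (x - y)) - 2 * ln 2" .
  then have h: "- ln ((norm (x - y))\<^sup>2 / 4) / 2 = ln 2 - ln (norm (x - y))" by simp
  note k = pos_kernel_eq_ln[OF assms False, unfolded h]
  show ?thesis using False
    by (simp add: log_kernel_def k(1) enn2ereal_ennreal[OF k(2)] ln_div)
qed

lemma borel_measurable_pos_kernel [measurable]:
  "(\<lambda>(x, y). pos_kernel x y) \<in> borel_measurable (borel \<Otimes>\<^sub>M borel)"
  unfolding pos_kernel_def by measurable

lemma space_sphere_borel [simp]: "space (restrict_space borel S2) = S2"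
  by (simp add: space_restrict_space)

lemma sphere_prob_measuresD:
  assumes "\<nu> \<in> sphere_prob_measures"
  shows "prob_space \<nu>" "sets \<nu> = sets (restrict_space borel S2)" "space \<nu> = S2"
    "\<And>f. f \<in> borel_measurable borel \<Longrightarrow> f \<in> borel_measurable \<nu>"
proof -
  show *: "prob_space \<nu>" "sets \<nu> = sets (restrict_space borel S2)"
    using assms by (auto simp: sphere_prob_measures_def)
  show "space \<nu> = S2" using sets_eq_imp_space_eq[OF *(2)] by simp
  show "f \<in> borel_measurable borel \<Longrightarrow> f \<in> borel_measurable \<nu>" for f
    by (subst measurable_cong_sets[OF *(2) refl]) (rule measurable_restrict_space1)
qed

subsection \<open>Positive definiteness of the kernel\<close>

text \<open>The letter \<^term>\<open>None\<close> stands for the constant function \<open>1\<close>, so that words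
  of length \<open>n\<close> index the monomials in the expansion of \<open>(1 + x \<bullet> y) ^ n\<close>.\<close>

definition letter :: "3 option \<Rightarrow> real ^ 3 \<Rightarrow> real" where
  "letter i x = (case i of None \<Rightarrow> 1 | Some j \<Rightarrow> x $ j)"

definition word_monomial :: "3 option list \<Rightarrow> real ^ 3 \<Rightarrow> real" where
  "word_monomial l x = prod_list (map (\<lambda>i. letter i x) l)"

definition moment :: "(real ^ 3) measure \<Rightarrow> 3 option list \<Rightarrow> real" where
  "moment \<nu> l = (\<integral>x. word_monomial l x \<partial>\<nu>)"

definition mutual_energy :: "(real ^ 3) measure \<Rightarrow> (real ^ 3) measure \<Rightarrow> ennreal" where
  "mutual_energy \<nu> \<mu> = (\<integral>\<^sup>+y. (\<integral>\<^sup>+x. pos_kernel x y \<partial>\<nu>) \<partial>\<mu>)"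

lemma word_monomial_simps [simp]:
  "word_monomial [] x = 1" "word_monomial (i # l) x = letter i x * word_monomial l x"
  by (simp_all add: word_monomial_def)

lemma continuous_on_word_monomial [continuous_intros]: "continuous_on A (word_monomial l)"
proof (induction l)
  case (Cons i l)
  then show ?case by (cases i) (auto simp: letter_def intro!: continuous_intros)
qed (auto intro: continuous_intros)

lemma one_plus_inner_eq_sum_letter: "1 + x \<bullet> y = (\<Sum>i\<in>UNIV. letter i x * letter i y)"
  by (simp add: UNIV_option_conv sum.reindex letter_def inner_vec_def)

text \<open>Words are ordered lists, so no multinomial coefficients arise: each word contributes the
  same function of \<open>x\<close> and of \<open>y\<close>, which makes positive definiteness
  visible.\<close>

lemma power_one_plus_inner:
  "(1 + x \<bullet> y) ^ n = (\<Sum>l | length l = n. word_monomial l x * word_monomial l y)"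
proof (induction n)
  case (Suc n)
  have e: "{l :: 3 option list. length l = m} = {l. set l \<subseteq> UNIV \<and> length l = m}" for m by simp
  have "(1 + x \<bullet> y) ^ Suc n = (\<Sum>l | length l = n. word_monomial l x * word_monomial l y)
      * (\<Sum>i\<in>UNIV. letter i x * letter i y)"
    using Suc by (simp add: one_plus_inner_eq_sum_letter mult.commute)
  also have "\<dots> = (\<Sum>(l, i)\<in>{l. length l = n} \<times> UNIV.
      word_monomial (i # l) x * word_monomial (i # l) y)"
    unfolding sum_product sum.cartesian_product by (intro sum.cong refl) (auto simp: mult_ac)
  also have "\<dots> = (\<Sum>l | length l = Suc n. word_monomial l x * word_monomial l y)"
    unfolding e lists_length_Suc_eq
    by (subst sum.reindex) (auto simp: inj_on_def case_prod_unfold intro!: sum.cong)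
  finally show ?case .
qed simp

lemma finite_words: "finite {l :: 3 option list. length l = n}"
  using finite_lists_length_eq[of "UNIV :: 3 option set" n] by simp

lemma integrable_continuous_sphere:
  assumes "\<nu> \<in> sphere_prob_measures" "continuous_on UNIV f"
  shows "integrable \<nu> (f :: real ^ 3 \<Rightarrow> real)"
proof -
  note \<nu> = sphere_prob_measuresD[OF assms(1)]
  interpret prob_space \<nu> by (rule \<nu>)
  have "compact (f ` S2)"
    by (intro compact_continuous_image continuous_on_subset[OF assms(2)]) auto
  then obtain B where "\<forall>x\<in>S2. norm (f x) \<le> B"
    using compact_imp_bounded[of "f ` S2"] unfolding bounded_iff by auto
  then show ?thesis
    by (intro integrable_const_bound[where B = B] AE_I2 \<nu>(4) borel_measurable_continuous_onI assms)
      (auto simp: \<nu>)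
qed

lemma integrable_word_monomial:
  "\<nu> \<in> sphere_prob_measures \<Longrightarrow> integrable \<nu> (word_monomial l)"
  by (intro integrable_continuous_sphere continuous_intros)

text \<open>Words of length \<open>Suc n\<close> belong to term \<open>n\<close>, because the series
  of \<open>pos_kernel\<close> starts with the first power of \<open>u\<close>.\<close>

definition energy_coeff :: "nat \<Rightarrow> (real ^ 3) measure \<Rightarrow> (real ^ 3) measure \<Rightarrow> real" where
  "energy_coeff n \<nu> \<mu> =
     (\<Sum>l | length l = Suc n. moment \<nu> l * moment \<mu> l) / (2 ^ Suc n * (2 * real (Suc n)))"

text \<open>Powers of \<open>(1 + x \<bullet> y) / 2\<close> are nonnegative on the sphere, so sums
  and integrals commute by Tonelli. For two different measures the sign of a coefficient comes from
  this pointwise positivity, not from a sum of squares.\<close>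

lemma mutual_energy_eq_suminf:
  assumes "\<nu> \<in> sphere_prob_measures" "\<mu> \<in> sphere_prob_measures"
  shows "mutual_energy \<nu> \<mu> = (\<Sum>n. ennreal (energy_coeff n \<nu> \<mu>))"
    and "0 \<le> energy_coeff n \<nu> \<mu>"
proof -
  note \<nu> = sphere_prob_measuresD[OF assms(1)] and \<mu> = sphere_prob_measuresD[OF assms(2)]
  define k where "k n = 1 / (2 ^ Suc n * (2 * real (Suc n)))" for n
  define K where "K n x y = ((1 + x \<bullet> y) / 2) ^ Suc n / real (2 * Suc n)" for n and x y :: "real ^ 3"
  define G where "G n y = (\<Sum>l | length l = Suc n. moment \<nu> l * word_monomial l y) * k n" for n y
  have Keq: "K n x y = (\<Sum>l | length l = Suc n. word_monomial l x * (word_monomial l y * k n))" for n x y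
    unfolding K_def power_divide power_one_plus_inner k_def
    by (simp add: sum_divide_distrib sum_distrib_right mult_ac)
  have K0: "0 \<le> K n x y" if "x \<in> S2" "y \<in> S2" for n x y
    unfolding K_def using half_one_plus_inner_sphere(1)[OF that] by simp
  have KI: "integrable \<nu> (\<lambda>x. K n x y)" for n y
    unfolding Keq by (intro Bochner_Integration.integrable_sum integrable_mult_left integrable_word_monomial assms)
  have int_K: "(\<integral>x. K n x y \<partial>\<nu>) = G n y" for n y
    unfolding Keq G_def
    by (subst Bochner_Integration.integral_sum)
      (auto simp: moment_def sum_distrib_left sum_distrib_right mult_ac intro!: integrable_mult_left integrable_word_monomial assms)
  have inner: "(\<integral>\<^sup>+x. ennreal (K n x y) \<partial>\<nu>) = ennreal (G n y)" if "y \<in> S2" for n y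
    by (subst nn_integral_eq_integral[OF KI]) (use K0 that \<nu>(3) in \<open>auto simp: int_K\<close>)
  have G0: "0 \<le> G n y" if "y \<in> S2" for n y
    unfolding int_K[symmetric] by (rule integral_nonneg_AE) (use K0 that \<nu>(3) in auto)
  have GI: "integrable \<mu> (G n)" for n
    unfolding G_def
    by (intro integrable_mult_left integrable_mult_right Bochner_Integration.integrable_sum integrable_word_monomial assms)
  have int_G: "(\<integral>y. G n y \<partial>\<mu>) = energy_coeff n \<nu> \<mu>" for n
    unfolding G_def energy_coeff_def
    by (subst Bochner_Integration.integral_mult_left_zero, subst Bochner_Integration.integral_sum)
      (auto simp: moment_def k_def integrable_word_monomial assms
        intro!: integrable_mult_right)
  show "0 \<le> energy_coeff n \<nu> \<mu>"
    unfolding int_G[symmetric] by (rule integral_nonneg_AE) (use G0 \<mu>(3) in auto)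
  have mK: "(\<lambda>x. ennreal (K n x y)) \<in> borel_measurable \<nu>" for n y
    using KI by auto
  have mG: "(\<lambda>y. ennreal (G n y)) \<in> borel_measurable \<mu>" for n
    using GI by auto
  have "mutual_energy \<nu> \<mu> = (\<integral>\<^sup>+y. (\<Sum>n. \<integral>\<^sup>+x. ennreal (K n x y) \<partial>\<nu>) \<partial>\<mu>)"
    unfolding mutual_energy_def pos_kernel_def K_def[symmetric]
    by (subst nn_integral_suminf[OF mK]) simp
  also have "\<dots> = (\<integral>\<^sup>+y. (\<Sum>n. ennreal (G n y)) \<partial>\<mu>)"
    by (rule nn_integral_cong) (simp add: \<mu> inner)
  also have "\<dots> = (\<Sum>n. \<integral>\<^sup>+y. ennreal (G n y) \<partial>\<mu>)"
    by (rule nn_integral_suminf[OF mG])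
  also have "\<dots> = (\<Sum>n. ennreal (energy_coeff n \<nu> \<mu>))"
    by (subst nn_integral_eq_integral[OF GI]) (use G0 \<mu>(3) in \<open>auto simp: int_G\<close>)
  finally show "mutual_energy \<nu> \<mu> = (\<Sum>n. ennreal (energy_coeff n \<nu> \<mu>))" .
qed

lemma energy_coeff_square:
  "energy_coeff n \<nu> \<nu> + energy_coeff n \<mu> \<mu> - 2 * energy_coeff n \<nu> \<mu> =
     (\<Sum>l | length l = Suc n. (moment \<nu> l - moment \<mu> l)\<^sup>2) / (2 ^ Suc n * (2 * real (Suc n)))"
proof -
  have "(\<Sum>l | length l = Suc n. (moment \<nu> l - moment \<mu> l)\<^sup>2) =
    (\<Sum>l | length l = Suc n. moment \<nu> l * moment \<nu> l) + (\<Sum>l | length l = Suc n. moment \<mu> l * moment \<mu> l)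
     - 2 * (\<Sum>l | length l = Suc n. moment \<nu> l * moment \<mu> l)"
    by (simp add: power2_eq_square sum.distrib sum_subtractf sum_distrib_left algebra_simps)
  then show ?thesis
    unfolding energy_coeff_def by (simp only: add_divide_distrib diff_divide_distrib times_divide_eq_right)
qed

text \<open>Termwise this is the sum of squares in \<open>energy_coeff_square\<close>. The cross
  term stands alone on the left so that infinite energies need no subtraction.\<close>

lemma mutual_energy_le:
  assumes "\<nu> \<in> sphere_prob_measures" "\<mu> \<in> sphere_prob_measures"
  shows "2 * mutual_energy \<nu> \<mu> \<le> mutual_energy \<nu> \<nu> + mutual_energy \<mu> \<mu>"
proof -
  have "2 * mutual_energy \<nu> \<mu> = (\<Sum>n. ennreal (2 * energy_coeff n \<nu> \<mu>))"
    by (simp add: mutual_energy_eq_suminf assms ennreal_mult ennreal_suminf_cmult)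
  also have "\<dots> \<le> (\<Sum>n. ennreal (energy_coeff n \<nu> \<nu> + energy_coeff n \<mu> \<mu>))"
  proof (intro suminf_le ennreal_leI)
    fix n
    have "0 \<le> energy_coeff n \<nu> \<nu> + energy_coeff n \<mu> \<mu> - 2 * energy_coeff n \<nu> \<mu>"
      unfolding energy_coeff_square by (intro divide_nonneg_nonneg sum_nonneg) auto
    then show "2 * energy_coeff n \<nu> \<mu> \<le> energy_coeff n \<nu> \<nu> + energy_coeff n \<mu> \<mu>" by simp
  qed auto
  also have "\<dots> = mutual_energy \<nu> \<nu> + mutual_energy \<mu> \<mu>"
    using suminf_add[OF summableI summableI, of "\<lambda>n. ennreal (energy_coeff n \<nu> \<nu>)" "\<lambda>n. ennreal (energy_coeff n \<mu> \<mu>)"]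
    by (simp add: mutual_energy_eq_suminf assms)
  finally show ?thesis .
qed

text \<open>Finite energies make all three series summable, so equality becomes a vanishing series
  of nonnegative defects, each a weighted sum of squared moment differences.\<close>

lemma moment_eq_if_mutual_energy_eq:
  assumes "\<nu> \<in> sphere_prob_measures" "\<mu> \<in> sphere_prob_measures"
    and fin: "mutual_energy \<nu> \<nu> < \<infinity>" "mutual_energy \<mu> \<mu> < \<infinity>"
    and eq: "2 * mutual_energy \<nu> \<mu> = mutual_energy \<nu> \<nu> + mutual_energy \<mu> \<mu>"
  shows "moment \<nu> l = moment \<mu> l"
proof (cases l)
  \<comment> \<open>The series contains no word of length \<open>0\<close>; the moment of the empty
    word is the total mass.\<close>
  case Nil
  interpret \<nu>: prob_space \<nu> using sphere_prob_measuresD[OF assms(1)] by simp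
  interpret \<mu>: prob_space \<mu> using sphere_prob_measuresD[OF assms(2)] by simp
  show ?thesis by (simp add: Nil moment_def \<nu>.prob_space \<mu>.prob_space)
next
  case (Cons i l')
  define D where "D n = energy_coeff n \<nu> \<nu> + energy_coeff n \<mu> \<mu> - 2 * energy_coeff n \<nu> \<mu>" for n
  note e = mutual_energy_eq_suminf
  have "mutual_energy \<nu> \<mu> < \<infinity>"
  proof -
    have "2 * mutual_energy \<nu> \<mu> < \<infinity>" using eq fin by simp
    then show ?thesis by (auto simp: ennreal_mult_less_top)
  qed
  moreover have "summable (\<lambda>n. energy_coeff n \<alpha> \<beta>)"
    if "mutual_energy \<alpha> \<beta> < \<infinity>" "\<alpha> \<in> sphere_prob_measures" "\<beta> \<in> sphere_prob_measures" for \<alpha> \<beta>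
    by (rule summable_suminf_not_top[OF e(2)[OF that(2,3)]]) (use that(1) e(1)[OF that(2,3)] in simp)
  ultimately have s: "summable (\<lambda>n. energy_coeff n \<nu> \<nu>)" "summable (\<lambda>n. energy_coeff n \<mu> \<mu>)"
     "summable (\<lambda>n. energy_coeff n \<nu> \<mu>)"
    using fin assms(1,2) by blast+
  have r: "mutual_energy \<alpha> \<beta> = ennreal (\<Sum>n. energy_coeff n \<alpha> \<beta>)" "0 \<le> (\<Sum>n. energy_coeff n \<alpha> \<beta>)"
    if "summable (\<lambda>n. energy_coeff n \<alpha> \<beta>)" "\<alpha> \<in> sphere_prob_measures" "\<beta> \<in> sphere_prob_measures" for \<alpha> \<beta>
    using suminf_ennreal2[OF e(2)[OF that(2,3)] that(1)] suminf_nonneg[OF that(1) e(2)[OF that(2,3)]]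
    by (simp_all add: e(1)[OF that(2,3)])
  note r\<nu>\<nu> = r[OF s(1) assms(1,1)] and r\<mu>\<mu> = r[OF s(2) assms(2,2)] and r\<nu>\<mu> = r[OF s(3) assms(1,2)]
  have "ennreal (2 * (\<Sum>n. energy_coeff n \<nu> \<mu>)) = ennreal ((\<Sum>n. energy_coeff n \<nu> \<nu>) + (\<Sum>n. energy_coeff n \<mu> \<mu>))"
    using eq unfolding r\<nu>\<nu>(1) r\<mu>\<mu>(1) r\<nu>\<mu>(1)
    by (simp add: ennreal_mult r\<nu>\<nu>(2) r\<mu>\<mu>(2) r\<nu>\<mu>(2))
  then have "2 * (\<Sum>n. energy_coeff n \<nu> \<mu>) = (\<Sum>n. energy_coeff n \<nu> \<nu>) + (\<Sum>n. energy_coeff n \<mu> \<mu>)"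
    using r\<nu>\<nu>(2) r\<mu>\<mu>(2) r\<nu>\<mu>(2) by (subst (asm) ennreal_inj) auto
  moreover have "(\<Sum>n. D n) = (\<Sum>n. energy_coeff n \<nu> \<nu>) + (\<Sum>n. energy_coeff n \<mu> \<mu>) - 2 * (\<Sum>n. energy_coeff n \<nu> \<mu>)"
    unfolding D_def using suminf_diff[OF summable_add[OF s(1,2)] summable_mult[OF s(3), of 2]]
      suminf_add[OF s(1,2)] suminf_mult[OF s(3), of 2] by simp
  ultimately have "(\<Sum>n. D n) = 0" by simp
  moreover have "summable D" unfolding D_def by (intro summable_diff summable_add summable_mult s)
  moreover have "0 \<le> D n" for n
    unfolding D_def energy_coeff_square by (intro divide_nonneg_nonneg sum_nonneg) auto
  ultimately have "D (length l') = 0" using suminf_eq_zero_iff[of D] by simp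
  then have "(\<Sum>l | length l = Suc (length l'). (moment \<nu> l - moment \<mu> l)\<^sup>2) = 0"
    unfolding D_def energy_coeff_square by simp
  then have "\<forall>l\<in>{l. length l = Suc (length l')}. (moment \<nu> l - moment \<mu> l)\<^sup>2 = 0"
    by (subst (asm) sum_nonneg_eq_0_iff) (auto simp: finite_words)
  then show ?thesis using Cons by simp
qed

section \<open>Measures on the sphere are determined by their moments\<close>

lemma moment_determines_polynomial_integral:
  assumes "\<nu> \<in> sphere_prob_measures" "\<mu> \<in> sphere_prob_measures"
    and eq: "\<And>l. moment \<nu> l = moment \<mu> l"
    and "real_polynomial_function p"
  shows "(\<integral>x. p x \<partial>\<nu>) = (\<integral>x. p x \<partial>\<mu>)"
proof -
  \<comment> \<open>Equality is required against every word monomial: multiplication by a coordinate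
    then only lengthens the word, multiplication by a polynomial preserves \<open>E\<close>, and the
    product case is a composition.\<close>
  define E where "E h \<longleftrightarrow> continuous_on UNIV h \<and>
    (\<forall>l. (\<integral>x. h x * word_monomial l x \<partial>\<nu>) = (\<integral>x. h x * word_monomial l x \<partial>\<mu>))" for h
  note I = integrable_continuous_sphere[OF assms(1)] integrable_continuous_sphere[OF assms(2)]
  have "E (\<lambda>x. p x * h x)" if "E h" for h
    using assms(4) that
  proof (induction arbitrary: h)
    case (linear f)
    interpret f: bounded_linear f by (rule linear)
    have ch: "continuous_on UNIV h" using linear by (simp add: E_def)
    have exp: "f x * h x * word_monomial l x
        = (\<Sum>i\<in>UNIV. f (axis i 1) * (h x * word_monomial (Some i # l) x))" for x l
    proof -
      have "f x = f (\<Sum>i\<in>UNIV. x $ i *\<^sub>R axis i 1)"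
        by (rule arg_cong[of _ _ f]) (simp add: vec_eq_iff axis_def if_distrib cong: if_cong)
      then have "f x = (\<Sum>i\<in>UNIV. x $ i * f (axis i 1))"
        by (simp add: f.sum f.scaleR)
      then show ?thesis by (simp add: letter_def sum_distrib_left sum_distrib_right mult_ac)
    qed
    have ci: "continuous_on UNIV (\<lambda>x. h x * word_monomial l x)" for l
      by (intro continuous_intros ch)
    have "(\<integral>x. f x * h x * word_monomial l x \<partial>\<nu>) = (\<integral>x. f x * h x * word_monomial l x \<partial>\<mu>)" for l
    proof -
      have *: "(\<integral>x. f x * h x * word_monomial l x \<partial>\<kappa>)
        = (\<Sum>i\<in>UNIV. f (axis i 1) * (\<integral>x. h x * word_monomial (Some i # l) x \<partial>\<kappa>))"
        if "\<kappa> \<in> sphere_prob_measures" for \<kappa>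
        unfolding exp
        by (subst Bochner_Integration.integral_sum)
          (intro integrable_mult_right integrable_continuous_sphere[OF that] ci,
            simp del: word_monomial_simps)
      show ?thesis
        using linear(2) unfolding *[OF assms(1)] *[OF assms(2)] E_def by (simp del: word_monomial_simps)
    qed
    moreover have "continuous_on UNIV (\<lambda>x. f x * h x)"
      by (intro continuous_intros ch f.continuous_on)
    ultimately show ?case by (simp add: E_def)
  next
    case (const c)
    then show ?case by (auto simp: E_def mult.assoc intro!: continuous_intros)
  next
    case (add f g)
    then have fg: "E (\<lambda>x. f x * h x)" "E (\<lambda>x. g x * h x)" by blast+
    then have c: "continuous_on UNIV (\<lambda>x. f x * h x)" "continuous_on UNIV (\<lambda>x. g x * h x)"
      by (simp_all add: E_def)
    have "integrable \<kappa> (\<lambda>x. f x * h x * word_monomial l x)" "integrable \<kappa> (\<lambda>x. g x * h x * word_monomial l x)"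
      if "\<kappa> \<in> sphere_prob_measures" for \<kappa> l
      by (intro integrable_continuous_sphere[OF that] continuous_intros c)+
    then show ?case using fg c continuous_on_add[OF c] by (simp add: E_def distrib_right assms)
  next
    case (mult f g)
    then show ?case by (simp add: mult.assoc)
  qed
  moreover have "E (\<lambda>x. 1)" using eq by (simp add: E_def moment_def)
  ultimately have "E p" by fastforce
  then show ?thesis unfolding E_def by (metis (no_types, lifting) Bochner_Integration.integral_cong mult.right_neutral word_monomial_simps(1))
qed

lemma moment_determines_continuous_integral:
  fixes f :: "real ^ 3 \<Rightarrow> real"
  assumes "\<nu> \<in> sphere_prob_measures" "\<mu> \<in> sphere_prob_measures"
    and eq: "\<And>l. moment \<nu> l = moment \<mu> l"
    and f: "continuous_on UNIV f"
  shows "(\<integral>x. f x \<partial>\<nu>) = (\<integral>x. f x \<partial>\<mu>)"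
proof (rule ccontr)
  \<comment> \<open>A third of the gap: the approximation costs at most \<open>e\<close> per
    measure, hence \<open>2 * e\<close> in total, while the gap is \<open>3 * e\<close>.\<close>
  define e where "e = \<bar>(\<integral>x. f x \<partial>\<nu>) - (\<integral>x. f x \<partial>\<mu>)\<bar> / 3"
  assume "(\<integral>x. f x \<partial>\<nu>) \<noteq> (\<integral>x. f x \<partial>\<mu>)"
  then have "0 < e" by (simp add: e_def)
  then obtain p where p: "real_polynomial_function p" "\<And>x. x \<in> S2 \<Longrightarrow> \<bar>f x - p x\<bar> < e"
    using Stone_Weierstrass_real_polynomial_function[OF _ continuous_on_subset[OF f subset_UNIV], of S2 e] by auto
  have cp: "continuous_on UNIV p"
    using p(1) continuous_on_polymonial_function real_polynomial_function_eq by blast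
  have "\<bar>(\<integral>x. f x \<partial>\<kappa>) - (\<integral>x. p x \<partial>\<kappa>)\<bar> \<le> e" if \<kappa>: "\<kappa> \<in> sphere_prob_measures" for \<kappa>
  proof -
    note K = sphere_prob_measuresD[OF \<kappa>]
    interpret prob_space \<kappa> by (rule K)
    have i: "integrable \<kappa> f" "integrable \<kappa> p"
      using integrable_continuous_sphere[OF \<kappa>] f cp by auto
    have "\<bar>(\<integral>x. f x \<partial>\<kappa>) - (\<integral>x. p x \<partial>\<kappa>)\<bar> = \<bar>\<integral>x. f x - p x \<partial>\<kappa>\<bar>" using i by simp
    also have "\<dots> \<le> (\<integral>x. \<bar>f x - p x\<bar> \<partial>\<kappa>)" by (rule integral_abs_bound)
    also have "\<dots> \<le> (\<integral>x. e \<partial>\<kappa>)"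
      by (rule integral_mono) (use i p(2) K(3) less_imp_le in \<open>auto\<close>)
    finally show ?thesis by (simp add: prob_space)
  qed
  from this[OF assms(1)] this[OF assms(2)] moment_determines_polynomial_integral[OF assms(1,2) eq p(1)]
  show False using \<open>0 < e\<close> by (simp add: e_def) argo
qed

lemma moment_determines_measure:
  assumes "\<nu> \<in> sphere_prob_measures" "\<mu> \<in> sphere_prob_measures"
    and eq: "\<And>l. moment \<nu> l = moment \<mu> l"
  shows "\<nu> = \<mu>"
proof -
  \<comment> \<open>These continuous functions tend pointwise to the indicator of the closed set
    \<open>C\<close>, because \<open>infdist x C\<close> is positive off \<open>C\<close>.\<close>
  have lim: "(\<lambda>n. \<integral>x. max 0 (1 - real n * infdist x C) \<partial>\<kappa>) \<longlonglongrightarrow> measure \<kappa> (C \<inter> S2)"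
    if \<kappa>: "\<kappa> \<in> sphere_prob_measures" and C: "closed C" "C \<noteq> {}" for \<kappa> C
  proof -
    note K = sphere_prob_measuresD[OF \<kappa>]
    interpret prob_space \<kappa> by (rule K)
    have "(\<lambda>n. \<integral>x. max 0 (1 - real n * infdist x C) \<partial>\<kappa>) \<longlonglongrightarrow> (\<integral>x. indicator C x \<partial>\<kappa>)"
    proof (rule integral_dominated_convergence[where w = "\<lambda>_. 1"])
      show "AE x in \<kappa>. (\<lambda>n. max 0 (1 - real n * infdist x C)) \<longlonglongrightarrow> indicator C x"
      proof (intro AE_I2)
        fix x
        show "(\<lambda>n. max 0 (1 - real n * infdist x C)) \<longlonglongrightarrow> indicator C x"
        proof (cases "x \<in> C")
          case True
          then show ?thesis by simp
        next
          case False
          then have d: "infdist x C > 0"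
            using C in_closed_iff_infdist_zero[OF C] infdist_nonneg[of x C] by force
          have "eventually (\<lambda>n. 1 / infdist x C < real n) sequentially"
            using filterlim_real_sequentially unfolding filterlim_at_top_dense by blast
          then have "eventually (\<lambda>n. max 0 (1 - real n * infdist x C) = 0) sequentially"
            by eventually_elim (use d in \<open>simp add: field_simps\<close>)
          then show ?thesis using False by (simp add: tendsto_eventually)
        qed
      qed
      show "indicator C \<in> borel_measurable \<kappa>" using C by (intro K) simp
      show "(\<lambda>x. max 0 (1 - real n * infdist x C)) \<in> borel_measurable \<kappa>" for n
        by (intro K borel_measurable_continuous_onI continuous_intros)
      show "AE x in \<kappa>. norm (max 0 (1 - real n * infdist x C)) \<le> 1" for n
        by (intro AE_I2) (auto intro: mult_nonneg_nonneg infdist_nonneg)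
    qed auto
    moreover have "(\<integral>x. indicator C x \<partial>\<kappa>) = measure \<kappa> (C \<inter> S2)"
      using K by simp
    ultimately show ?thesis by simp
  qed
  \<comment> \<open>Both measures are pushed to the whole space, where the closed sets are an
    intersection-stable generator of \<open>borel\<close>.\<close>
  have ind: "distr \<nu> borel (\<lambda>x. x) = distr \<mu> borel (\<lambda>x. x)"
  proof (rule measure_eqI_generator_eq[where E = "Collect closed" and \<Omega> = UNIV and A = "\<lambda>_. UNIV"])
    fix C :: "(real ^ 3) set"
    assume "C \<in> Collect closed"
    then have C: "closed C" by simp
    have "(\<lambda>x. x) \<in> borel_measurable \<nu>" "(\<lambda>x. x) \<in> borel_measurable \<mu>"
      by (auto intro: sphere_prob_measuresD(4) assms)
    then have e: "emeasure (distr \<nu> borel (\<lambda>x. x)) C = emeasure \<nu> (C \<inter> S2)"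
       "emeasure (distr \<mu> borel (\<lambda>x. x)) C = emeasure \<mu> (C \<inter> S2)"
      using C assms by (simp_all add: emeasure_distr sphere_prob_measuresD(3))
    interpret \<nu>: prob_space \<nu> using sphere_prob_measuresD[OF assms(1)] by simp
    interpret \<mu>: prob_space \<mu> using sphere_prob_measuresD[OF assms(2)] by simp
    show "emeasure (distr \<nu> borel (\<lambda>x. x)) C = emeasure (distr \<mu> borel (\<lambda>x. x)) C"
    proof (cases "C = {}")
      case False
      have "(\<integral>x. max 0 (1 - real n * infdist x C) \<partial>\<nu>) = (\<integral>x. max 0 (1 - real n * infdist x C) \<partial>\<mu>)" for n
        by (intro moment_determines_continuous_integral assms continuous_intros)
      then have "measure \<nu> (C \<inter> S2) = measure \<mu> (C \<inter> S2)"
        using LIMSEQ_unique[OF lim[OF assms(1) C False]] lim[OF assms(2) C False] by simp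
      then show ?thesis unfolding e by (simp add: \<nu>.emeasure_eq_measure \<mu>.emeasure_eq_measure)
    qed simp
  next
    interpret \<nu>: prob_space \<nu> using sphere_prob_measuresD[OF assms(1)] by simp
    have "(\<lambda>x. x) \<in> borel_measurable \<nu>"
      by (auto intro: sphere_prob_measuresD(4) assms)
    then show "emeasure (distr \<nu> borel (\<lambda>x. x)) UNIV \<noteq> \<infinity>"
      by (simp add: emeasure_distr)
  qed (auto simp: Int_stable_def borel_eq_closed)
  show ?thesis
  proof (rule measure_eqI)
    show "sets \<nu> = sets \<mu>" using assms(1,2)[THEN sphere_prob_measuresD(2)] by simp
    fix A assume "A \<in> sets \<nu>"
    then obtain B where B: "B \<in> sets borel" "A = S2 \<inter> B"
      using sphere_prob_measuresD(2)[OF assms(1)] by (auto simp: sets_restrict_space)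
    have "(\<lambda>x. x) \<in> borel_measurable \<nu>" "(\<lambda>x. x) \<in> borel_measurable \<mu>"
      by (auto intro: sphere_prob_measuresD(4) assms)
    then have "emeasure (distr \<nu> borel (\<lambda>x. x)) B = emeasure \<nu> A"
       "emeasure (distr \<mu> borel (\<lambda>x. x)) B = emeasure \<mu> A"
      using B assms by (simp_all add: emeasure_distr sphere_prob_measuresD(3) Int_commute)
    then show "emeasure \<nu> A = emeasure \<mu> A" using ind by simp
  qed
qed

subsection \<open>Frostman's conditions characterise the equilibrium measure\<close>

text \<open>Positive part minus negative part is \<open>g - c\<close>; each term is moved to the
  side where it is added, so that the identity survives \<open>g = \<infinity>\<close>.\<close>

lemma e2ennreal_minus_const:
  assumes "0 \<le> c"
  shows "e2ennreal (enn2ereal g - ereal c) + ennreal c = e2ennreal (- (enn2ereal g - ereal c)) + g"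
    and "e2ennreal (- (enn2ereal g - ereal c)) \<le> ennreal c"
proof -
  have "e2ennreal (enn2ereal g - ereal c) + ennreal c = e2ennreal (- (enn2ereal g - ereal c)) + g
    \<and> e2ennreal (- (enn2ereal g - ereal c)) \<le> ennreal c"
  proof (cases g)
    case (real r)
    have e: "e2ennreal (enn2ereal g - ereal c) = ennreal (r - c)"
      "e2ennreal (- (enn2ereal g - ereal c)) = ennreal (c - r)"
      using real by (simp_all add: ennreal.rep_eq e2ennreal_ereal)
    show ?thesis
    proof (cases "c \<le> r")
      case True
      then show ?thesis unfolding e using real assms
        by (simp add: ennreal_plus[symmetric] ennreal_neg del: ennreal_plus)
    next
      case False
      then show ?thesis unfolding e using real assms
        by (simp add: ennreal_plus[symmetric] ennreal_neg ennreal_leI del: ennreal_plus)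
    qed
  next
    case top
    then show ?thesis by (simp add: e2ennreal_neg)
  qed
  then show "e2ennreal (enn2ereal g - ereal c) + ennreal c = e2ennreal (- (enn2ereal g - ereal c)) + g"
    "e2ennreal (- (enn2ereal g - ereal c)) \<le> ennreal c" by simp_all
qed

text \<open>The negative part is at most \<open>c\<close>, so its integral is finite and the
  difference defining \<open>ereal_integral\<close> never meets
  \<open>\<infinity> - \<infinity>\<close>.\<close>

lemma ereal_integral_minus_const:
  fixes g :: "'a \<Rightarrow> ennreal"
  assumes "prob_space M" "g \<in> borel_measurable M" "0 \<le> c"
    and f: "\<And>x. x \<in> space M \<Longrightarrow> f x = enn2ereal (g x) - ereal c"
  shows "ereal_integral M f = enn2ereal (\<integral>\<^sup>+x. g x \<partial>M) - ereal c"
proof -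
  interpret prob_space M by fact
  define p n where "p x = e2ennreal (enn2ereal (g x) - ereal c)"
    and "n x = e2ennreal (- (enn2ereal (g x) - ereal c))" for x
  have [measurable]: "p \<in> borel_measurable M" "n \<in> borel_measurable M"
    unfolding p_def[abs_def] n_def[abs_def] using assms(2) by measurable
  have "(\<integral>\<^sup>+x. p x + ennreal c \<partial>M) = (\<integral>\<^sup>+x. n x + g x \<partial>M)"
    unfolding p_def n_def e2ennreal_minus_const(1)[OF assms(3)] ..
  then have eq: "(\<integral>\<^sup>+x. p x \<partial>M) + ennreal c = (\<integral>\<^sup>+x. n x \<partial>M) + (\<integral>\<^sup>+x. g x \<partial>M)"
    using assms(2) by (simp add: nn_integral_add emeasure_space_1)
  have "(\<integral>\<^sup>+x. n x \<partial>M) \<le> (\<integral>\<^sup>+x. ennreal c \<partial>M)"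
    unfolding n_def by (intro nn_integral_mono e2ennreal_minus_const assms)
  also have "\<dots> = ennreal c" by (simp add: emeasure_space_1)
  finally have "(\<integral>\<^sup>+x. n x \<partial>M) < top" by (simp add: order_le_less_trans)
  then obtain r where r: "(\<integral>\<^sup>+x. n x \<partial>M) = ennreal r" "0 \<le> r" by (cases "\<integral>\<^sup>+x. n x \<partial>M") auto
  have "ereal_integral M f = enn2ereal (\<integral>\<^sup>+x. p x \<partial>M) - enn2ereal (\<integral>\<^sup>+x. n x \<partial>M)"
    unfolding ereal_integral_def p_def n_def by (simp add: f cong: nn_integral_cong)
  also have "\<dots> = enn2ereal (\<integral>\<^sup>+x. g x \<partial>M) - ereal c"
  proof (cases "\<integral>\<^sup>+x. g x \<partial>M")
    case (real G)
    then have "(\<integral>\<^sup>+x. p x \<partial>M) + ennreal c = ennreal (r + G)" using eq r by simp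
    then obtain P where P: "(\<integral>\<^sup>+x. p x \<partial>M) = ennreal P" "0 \<le> P" by (cases "\<integral>\<^sup>+x. p x \<partial>M") auto
    have "ennreal (P + c) = ennreal (r + G)" using eq r real P assms(3) by simp
    then have "P + c = r + G" using P r real assms(3) by (subst (asm) ennreal_inj) auto
    then show ?thesis using P r real by (simp add: ennreal.rep_eq)
  next
    case top
    then have "(\<integral>\<^sup>+x. p x \<partial>M) = top" using eq by (cases "\<integral>\<^sup>+x. p x \<partial>M") auto
    then show ?thesis using r top by (simp add: ennreal.rep_eq)
  qed
  finally show ?thesis .
qed

lemma borel_measurable_potential:
  assumes "\<nu> \<in> sphere_prob_measures"
  shows "(\<lambda>y. \<integral>\<^sup>+x. pos_kernel x y \<partial>\<nu>) \<in> borel_measurable borel"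
    and "(\<lambda>x. pos_kernel x y) \<in> borel_measurable borel"
proof -
  note K = sphere_prob_measuresD[OF assms]
  interpret prob_space \<nu> by (rule K)
  have m: "(\<lambda>x. x) \<in> borel_measurable \<nu>" by (rule K(4)) simp
  have "(\<lambda>p. (fst p, snd p)) \<in> borel \<Otimes>\<^sub>M \<nu> \<rightarrow>\<^sub>M borel \<Otimes>\<^sub>M borel"
    by (intro measurable_Pair measurable_fst measurable_compose[OF measurable_snd m])
  from measurable_compose[OF this borel_measurable_pos_kernel]
  have "(\<lambda>(y, x). pos_kernel x y) \<in> borel_measurable (borel \<Otimes>\<^sub>M \<nu>)"
    by (simp add: case_prod_beta pos_kernel_commute)
  then show "(\<lambda>y. \<integral>\<^sup>+x. pos_kernel x y \<partial>\<nu>) \<in> borel_measurable borel"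
    by (rule borel_measurable_nn_integral)
  have "(\<lambda>x. (x, y)) \<in> borel \<rightarrow>\<^sub>M borel \<Otimes>\<^sub>M borel" by simp
  from measurable_compose[OF this borel_measurable_pos_kernel]
  show "(\<lambda>x. pos_kernel x y) \<in> borel_measurable borel" by simp
qed

text \<open>The subtracted constant is the same for all measures, so minimising the weighted energy
  means minimising the nonnegative quantity in front of it.\<close>

lemma weighted_energy_eq:
  fixes q :: "real ^ 3 \<Rightarrow> ennreal"
  assumes \<nu>: "\<nu> \<in> sphere_prob_measures"
    and q: "q \<in> borel_measurable borel" "0 \<le> c" "\<And>x. x \<in> S2 \<Longrightarrow> Q x = enn2ereal (q x) - ereal c"
  shows "weighted_energy Q \<nu> =
    enn2ereal (mutual_energy \<nu> \<nu> + 2 * (\<integral>\<^sup>+x. q x \<partial>\<nu>)) - ereal (ln 2 + 2 * c)"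
proof -
  note K = sphere_prob_measuresD[OF \<nu>]
  have inner: "ereal_integral \<nu> (\<lambda>x. log_kernel x y) = enn2ereal (\<integral>\<^sup>+x. pos_kernel x y \<partial>\<nu>) - ereal (ln 2)"
    if "y \<in> S2" for y
    by (rule ereal_integral_minus_const[OF K(1)])
      (use that K in \<open>auto intro: K(4)[OF borel_measurable_potential(2)[OF \<nu>]] log_kernel_eq_pos_kernel\<close>)
  have mp: "(\<lambda>y. \<integral>\<^sup>+x. pos_kernel x y \<partial>\<nu>) \<in> borel_measurable \<nu>"
    by (rule K(4)[OF borel_measurable_potential(1)[OF \<nu>]])
  have "ereal_integral \<nu> (\<lambda>y. ereal_integral \<nu> (\<lambda>x. log_kernel x y)) =
      enn2ereal (mutual_energy \<nu> \<nu>) - ereal (ln 2)"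
    unfolding mutual_energy_def
    by (rule ereal_integral_minus_const[OF K(1)])
      (use K mp in \<open>auto simp: inner\<close>)
  moreover have "ereal_integral \<nu> Q = enn2ereal (\<integral>\<^sup>+x. q x \<partial>\<nu>) - ereal c"
    by (rule ereal_integral_minus_const[OF K(1)]) (use K q in auto)
  moreover have "enn2ereal A - ereal l + 2 * (enn2ereal B - ereal c) = enn2ereal (A + 2 * B) - ereal (l + 2 * c)" for A B l
  proof (cases A)
    case A: (real x)
    show ?thesis
    proof (cases B)
      case (real y)
      then have "A + 2 * B = ennreal (x + 2 * y)" using A by (simp add: ennreal_mult)
      then have "enn2ereal (A + 2 * B) = ereal (x + 2 * y)" using A real by (simp del: ennreal_plus)
      then show ?thesis using A real by simp
    qed (use A in \<open>simp add: ennreal.rep_eq ennreal_mult_top\<close>)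
  next
    case top
    then show ?thesis by (cases B) (auto simp: ennreal.rep_eq ennreal_mult_top)
  qed
  ultimately show ?thesis unfolding weighted_energy_def by simp
qed

text \<open>The kernel is infinite on the diagonal, so an atom of mass \<open>m\<close> contributes
  \<open>top * m * m\<close> to the energy.\<close>

lemma mutual_energy_atom:
  assumes "\<nu> \<in> sphere_prob_measures" "z \<in> S2" "mutual_energy \<nu> \<nu> < \<infinity>"
  shows "AE x in \<nu>. x \<noteq> z"
proof -
  note K = sphere_prob_measuresD[OF assms(1)]
  have z: "{z} \<in> sets \<nu>"
    unfolding K(2) using assms(2) by (auto simp: sets_restrict_space intro!: image_eqI[of _ _ "{z}"])
  have "emeasure \<nu> {z} = 0"
  proof (rule ccontr)
    assume n: "emeasure \<nu> {z} \<noteq> 0"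
    have "top * emeasure \<nu> {z} * emeasure \<nu> {z} = (\<integral>\<^sup>+y. (\<integral>\<^sup>+x. top * indicator {z} x \<partial>\<nu>) * indicator {z} y \<partial>\<nu>)"
      using z by (simp add: nn_integral_cmult_indicator)
    also have "\<dots> \<le> mutual_energy \<nu> \<nu>"
      unfolding mutual_energy_def
    proof (intro nn_integral_mono)
      fix y
      show "(\<integral>\<^sup>+x. top * indicator {z} x \<partial>\<nu>) * indicator {z} y \<le> (\<integral>\<^sup>+x. pos_kernel x y \<partial>\<nu>)"
      proof (cases "y = z")
        case True
        then show ?thesis using pos_kernel_refl[OF assms(2)]
          by (auto intro!: nn_integral_mono simp: indicator_def)
      qed simp
    qed
    finally show False using assms(3) n by (simp add: ennreal_top_mult)
  qed
  then show ?thesis using AE_iff_measurable[OF z, of "\<lambda>x. x \<noteq> z"] K(3) assms(2) by auto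
qed

text \<open>The exceptional points \<open>Z\<close> are harmless because a measure with an atom has infinite energy.\<close>

lemma equilibrium_measure_eqI:
  fixes q :: "real ^ 3 \<Rightarrow> ennreal" and F :: ennreal
  assumes \<mu>: "\<mu> \<in> sphere_prob_measures"
    and q: "q \<in> borel_measurable borel" "0 \<le> c" "\<And>x. x \<in> S2 \<Longrightarrow> Q x = enn2ereal (q x) - ereal c"
    and F: "F < \<infinity>" and Z: "finite Z" "Z \<subseteq> S2"
    and ge: "\<And>y. y \<in> S2 \<Longrightarrow> y \<notin> Z \<Longrightarrow> F \<le> (\<integral>\<^sup>+x. pos_kernel x y \<partial>\<mu>) + q y"
    and eq: "AE y in \<mu>. (\<integral>\<^sup>+x. pos_kernel x y \<partial>\<mu>) + q y = F"
  shows "equilibrium_measure Q = \<mu>"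
proof -
  define J where "J \<nu> = mutual_energy \<nu> \<nu> + 2 * (\<integral>\<^sup>+x. q x \<partial>\<nu>)" for \<nu>
  have E: "weighted_energy Q \<nu> = enn2ereal (J \<nu>) - ereal (ln 2 + 2 * c)"
    if "\<nu> \<in> sphere_prob_measures" for \<nu>
    unfolding J_def by (rule weighted_energy_eq[OF that q])
  have m: "(\<lambda>y. \<integral>\<^sup>+x. pos_kernel x y \<partial>\<mu>) \<in> borel_measurable \<nu>" "q \<in> borel_measurable \<nu>"
    if "\<nu> \<in> sphere_prob_measures" for \<nu>
    using sphere_prob_measuresD(4)[OF that] borel_measurable_potential[OF \<mu>] q(1) by auto
  have split: "(\<integral>\<^sup>+y. (\<integral>\<^sup>+x. pos_kernel x y \<partial>\<mu>) + q y \<partial>\<nu>) = mutual_energy \<mu> \<nu> + (\<integral>\<^sup>+y. q y \<partial>\<nu>)"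
    if "\<nu> \<in> sphere_prob_measures" for \<nu>
    unfolding mutual_energy_def using m[OF that] by (rule nn_integral_add)
  interpret \<mu>: prob_space \<mu> using sphere_prob_measuresD[OF \<mu>] by simp
  have \<mu>F: "mutual_energy \<mu> \<mu> + (\<integral>\<^sup>+y. q y \<partial>\<mu>) = F"
    unfolding split[OF \<mu>, symmetric] by (subst nn_integral_cong_AE[OF eq]) (simp add: \<mu>.emeasure_space_1)
  have fin: "mutual_energy \<mu> \<mu> < \<infinity>" "(\<integral>\<^sup>+y. q y \<partial>\<mu>) < \<infinity>"
    using \<mu>F F by (auto simp: less_top[symmetric])
  \<comment> \<open>Adding \<open>mutual_energy \<mu> \<mu>\<close> to both sides of the comparison
    replaces the usual expansion around the minimiser, which would subtract energies.\<close>
  have J\<mu>: "J \<mu> + mutual_energy \<mu> \<mu> = 2 * F"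
    unfolding J_def \<mu>F[symmetric] by (simp add: distrib_left mult_2[of "mutual_energy \<mu> \<mu>"] add_ac)
  \<comment> \<open>Frostman's inequality integrated against a competitor of finite energy, which
    gives no mass to \<open>Z\<close>.\<close>
  have key: "2 * F \<le> 2 * mutual_energy \<mu> \<nu> + 2 * (\<integral>\<^sup>+y. q y \<partial>\<nu>)"
    if \<nu>: "\<nu> \<in> sphere_prob_measures" and "mutual_energy \<nu> \<nu> < \<infinity>" for \<nu>
  proof -
    note K = sphere_prob_measuresD[OF \<nu>]
    interpret \<nu>: prob_space \<nu> by (rule K)
    have "F = (\<integral>\<^sup>+y. F \<partial>\<nu>)" by (simp add: \<nu>.emeasure_space_1)
    also have "\<dots> \<le> (\<integral>\<^sup>+y. (\<integral>\<^sup>+x. pos_kernel x y \<partial>\<mu>) + q y \<partial>\<nu>)"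
    proof (rule nn_integral_mono_AE)
      show "AE y in \<nu>. F \<le> (\<integral>\<^sup>+x. pos_kernel x y \<partial>\<mu>) + q y"
      proof -
        have "AE y in \<nu>. \<forall>z\<in>Z. y \<noteq> z"
          using mutual_energy_atom[OF \<nu> _ that(2)] Z by (intro AE_finite_allI) auto
        then show ?thesis
          using AE_space[of \<nu>] by eventually_elim (use ge K(3) in auto)
      qed
    qed
    finally have "2 * F \<le> 2 * (mutual_energy \<mu> \<nu> + (\<integral>\<^sup>+y. q y \<partial>\<nu>))"
      unfolding split[OF \<nu>] by (rule mult_left_mono) simp
    then show ?thesis by (simp only: distrib_left)
  qed
  have cancel: "A \<le> B" if "A + C \<le> B + C" "C < \<infinity>" for A B C :: ennreal
    using that ennreal_add_left_cancel_le[of C A B] by (auto simp: add.commute)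
  have le: "J \<mu> \<le> J \<nu>" if \<nu>: "\<nu> \<in> sphere_prob_measures" for \<nu>
  proof (cases "mutual_energy \<nu> \<nu> < \<infinity>")
    case True
    have "J \<mu> + mutual_energy \<mu> \<mu> \<le> 2 * mutual_energy \<mu> \<nu> + 2 * (\<integral>\<^sup>+y. q y \<partial>\<nu>)"
      unfolding J\<mu> by (rule key[OF \<nu> True])
    also have "\<dots> \<le> mutual_energy \<mu> \<mu> + mutual_energy \<nu> \<nu> + 2 * (\<integral>\<^sup>+y. q y \<partial>\<nu>)"
      by (intro add_right_mono mutual_energy_le \<mu> \<nu>)
    also have "\<dots> = J \<nu> + mutual_energy \<mu> \<mu>" by (simp add: J_def add_ac)
    finally show ?thesis using fin(1) by (rule cancel)
  next
    case False
    then show ?thesis by (simp add: J_def less_top[symmetric])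
  qed
  \<comment> \<open>A second minimiser attains equality in \<open>mutual_energy_le\<close> and
    therefore has the same moments.\<close>
  have unique: "\<nu> = \<mu>" if \<nu>: "\<nu> \<in> sphere_prob_measures" and "J \<nu> \<le> J \<mu>" for \<nu>
  proof -
    have JJ: "J \<nu> = J \<mu>" using le[OF \<nu>] that by simp
    have "J \<mu> < \<infinity>" using fin unfolding J_def by (simp add: ennreal_mult_less_top)
    then have finq: "mutual_energy \<nu> \<nu> < \<infinity>" "(\<integral>\<^sup>+y. q y \<partial>\<nu>) < \<infinity>"
unfolding JJ[symmetric] unfolding J_def by (auto simp: ennreal_mult_less_top)
    have "mutual_energy \<mu> \<mu> + mutual_energy \<nu> \<nu> + 2 * (\<integral>\<^sup>+y. q y \<partial>\<nu>) = J \<nu> + mutual_energy \<mu> \<mu>"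
      by (simp add: J_def add_ac)
    also have "\<dots> \<le> 2 * mutual_energy \<mu> \<nu> + 2 * (\<integral>\<^sup>+y. q y \<partial>\<nu>)"
      unfolding JJ J\<mu> by (rule key[OF \<nu> finq(1)])
    finally have "mutual_energy \<mu> \<mu> + mutual_energy \<nu> \<nu> \<le> 2 * mutual_energy \<mu> \<nu>"
      by (rule cancel) (use finq(2) in \<open>simp add: ennreal_mult_less_top\<close>)
    then have "2 * mutual_energy \<mu> \<nu> = mutual_energy \<mu> \<mu> + mutual_energy \<nu> \<nu>"
      using mutual_energy_le[OF \<mu> \<nu>] by simp
    then have "\<mu> = \<nu>"
      by (intro moment_determines_measure \<mu> \<nu> moment_eq_if_mutual_energy_eq fin finq)
    then show ?thesis by simp
  qed
  have cmp: "enn2ereal A - ereal r \<le> enn2ereal B - ereal r \<longleftrightarrow> A \<le> B" for A B r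
    by (cases A; cases B) (auto simp: ennreal.rep_eq top_unique)
  have wle: "weighted_energy Q \<alpha> \<le> weighted_energy Q \<beta> \<longleftrightarrow> J \<alpha> \<le> J \<beta>"
    if "\<alpha> \<in> sphere_prob_measures" "\<beta> \<in> sphere_prob_measures" for \<alpha> \<beta>
    unfolding E[OF that(1)] E[OF that(2)] by (rule cmp)
  show ?thesis
    unfolding equilibrium_measure_def
  proof (rule the_equality)
    show "\<mu> \<in> sphere_prob_measures \<and> (\<forall>\<nu>\<in>sphere_prob_measures. weighted_energy Q \<mu> \<le> weighted_energy Q \<nu>)"
      using \<mu> le wle by simp
    fix \<nu>
    assume "\<nu> \<in> sphere_prob_measures \<and> (\<forall>\<kappa>\<in>sphere_prob_measures. weighted_energy Q \<nu> \<le> weighted_energy Q \<kappa>)"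
    then show "\<nu> = \<mu>" using unique[of \<nu>] \<mu> wle by blast
  qed
qed

subsection \<open>Jensen's formula for quadratic polynomials\<close>

text \<open>The integrand is the real part of \<open>Ln (1 - s * z)\<close>, and Cauchy's formula at
  the centre returns \<open>Ln 1 = 0\<close>. For \<open>norm z < 1 / norm s\<close> the argument
  has positive real part, so the branch cut is avoided.\<close>

lemma has_integral_ln_norm_one_minus_circle:
  fixes s :: complex
  assumes "norm s < 1"
  shows "((\<lambda>\<theta>. ln (norm (1 - s * exp (2 * of_real pi * \<i> * of_real \<theta>)))) has_integral 0) {0..1}"
proof (cases "s = 0")
  case True
  then show ?thesis using has_integral_0[of "{0..1::real}"] by simp
next
  case False
  define g where "g z = Ln (1 - s * z)" for z
  have nn: "1 - s * z \<notin> \<real>\<^sub>\<le>\<^sub>0" if "norm z < 1 / norm s" for z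
  proof
    assume "1 - s * z \<in> \<real>\<^sub>\<le>\<^sub>0"
    then have "Re (1 - s * z) \<le> 0" by (simp add: complex_nonpos_Reals_iff)
    moreover have "norm (s * z) < 1" using that False by (simp add: norm_mult field_simps)
    ultimately show False using complex_Re_le_cmod[of "s * z"] by simp
  qed
  have hol: "g holomorphic_on ball 0 (1 / norm s)"
    unfolding g_def by (intro holomorphic_intros) (use nn in auto)
  have sub: "cball (0::complex) 1 \<subseteq> ball 0 (1 / norm s)"
  proof
    fix z :: complex
    assume "z \<in> cball 0 1"
    then have "norm z * norm s \<le> 1 * norm s" by (intro mult_right_mono) auto
    then have "norm z * norm s < 1" using assms by linarith
    then show "z \<in> ball 0 (1 / norm s)" using False by (simp add: field_simps)
  qed
  have "((\<lambda>u. g u / (u - 0)) has_contour_integral (2 * of_real pi * \<i>) * g 0) (circlepath 0 1)"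
  proof (rule Cauchy_integral_circlepath)
    show "continuous_on (cball 0 1) g"
      by (rule continuous_on_subset[OF holomorphic_on_imp_continuous_on[OF hol] sub])
    show "g holomorphic_on ball 0 1"
      by (rule holomorphic_on_subset[OF hol]) (use sub in auto)
  qed auto
  then have "((\<lambda>\<theta>. g (circlepath 0 1 \<theta>) / circlepath 0 1 \<theta> * vector_derivative (circlepath 0 1) (at \<theta>)) has_integral 0) {0..1}"
    by (simp add: has_contour_integral g_def)
  then have "((\<lambda>\<theta>. (2 * of_real pi * \<i>) * g (exp (2 * of_real pi * \<i> * of_real \<theta>))) has_integral 0) {0..1}"
    by (rule has_integral_eq[rotated])
      (simp only: vector_derivative_circlepath, simp add: circlepath mult_ac)
  then have "((\<lambda>\<theta>. inverse (2 * of_real pi * \<i>) * ((2 * of_real pi * \<i>) * g (exp (2 * of_real pi * \<i> * of_real \<theta>))))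
      has_integral inverse (2 * of_real pi * \<i>) * 0) {0..1}"
    by (rule has_integral_mult_right)
  then have "((\<lambda>\<theta>. g (exp (2 * of_real pi * \<i> * of_real \<theta>))) has_integral 0) {0..1}"
    by (simp add: field_simps)
  then have "((\<lambda>\<theta>. Re (g (exp (2 * of_real pi * \<i> * of_real \<theta>)))) has_integral Re 0) {0..1}"
    by (rule has_integral_Re)
  then have *: "((\<lambda>\<theta>. Re (g (exp (2 * of_real pi * \<i> * of_real \<theta>)))) has_integral 0) {0..1}"
    by simp
  show ?thesis
  proof (rule has_integral_eq[OF _ *])
    fix \<theta> :: real
    have "norm (exp (2 * of_real pi * \<i> * of_real \<theta>)) = 1" by (simp add: norm_exp_eq_Re)
    then have "norm (exp (2 * of_real pi * \<i> * of_real \<theta>)) < 1 / norm s"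
      using assms False by (simp add: field_simps)
    from nn[OF this] have "1 - s * exp (2 * of_real pi * \<i> * of_real \<theta>) \<noteq> 0" by auto
    then show "Re (g (exp (2 * of_real pi * \<i> * of_real \<theta>))) = ln (norm (1 - s * exp (2 * of_real pi * \<i> * of_real \<theta>)))"
      by (simp add: g_def)
  qed
qed

text \<open>The formula also holds for \<open>r = 0\<close> since \<open>ln 0 = 0\<close>.\<close>

lemma has_integral_ln_norm_circle_minus:
  fixes r :: complex
  assumes "norm r \<noteq> 1"
  shows "((\<lambda>\<theta>. ln (norm (exp (2 * of_real pi * \<i> * of_real \<theta>) - r))) has_integral max 0 (ln (norm r))) {0..1}"
proof (cases "norm r < 1")
  case True
  \<comment> \<open>On the unit circle \<open>z - r\<close> and \<open>1 - cnj r * z\<close> have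
    equal modulus, and the second has its zero outside the disc.\<close>
  have "ln (norm (1 - cnj r * z)) = ln (norm (z - r))" if "norm z = 1" for z
  proof -
    have "norm (1 - cnj r * z) = norm (cnj z * (z - r))"
      using that complex_norm_square[of z] by (metis (no_types, lifting) complex_cnj_mult complex_cnj_cnj
        complex_cnj_diff complex_cnj_one complex_mod_cnj mult.commute of_real_1 power_one right_diff_distrib')
    then show ?thesis using that by (simp add: norm_mult)
  qed
  moreover have "norm (exp (2 * of_real pi * \<i> * of_real \<theta>)) = 1" for \<theta> :: real by (simp add: norm_exp_eq_Re)
  ultimately have "((\<lambda>\<theta>. ln (norm (exp (2 * of_real pi * \<i> * of_real \<theta>) - r))) has_integral 0) {0..1}"
    using has_integral_ln_norm_one_minus_circle[of "cnj r"] True by simp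
  moreover have "max 0 (ln (norm r)) = 0"
    using True by (cases "r = 0") auto
  ultimately show ?thesis by simp
next
  case False
  then have r: "norm r > 1" using assms by simp
  then have r0: "r \<noteq> 0" by auto
  have "ln (norm r) + ln (norm (1 - inverse r * z)) = ln (norm (z - r))" if "norm z = 1" for z
  proof -
    have "z \<noteq> r" using that r by auto
    have "norm (z - r) = norm r * norm (1 - inverse r * z)"
      using r0 by (simp add: norm_mult[symmetric] right_diff_distrib mult.assoc[symmetric] norm_minus_commute)
    moreover have "norm (1 - inverse r * z) \<noteq> 0" using \<open>z \<noteq> r\<close> r0 by (auto simp: field_simps)
    ultimately show ?thesis using r0 by (simp add: ln_mult)
  qed
  moreover have "norm (exp (2 * of_real pi * \<i> * of_real \<theta>)) = 1" for \<theta> :: real by (simp add: norm_exp_eq_Re)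
  moreover have "((\<lambda>\<theta>. ln (norm r) + ln (norm (1 - inverse r * exp (2 * of_real pi * \<i> * of_real \<theta>))))
     has_integral (ln (norm r) + 0)) {0..1}"
  proof (intro has_integral_add has_integral_ln_norm_one_minus_circle)
    show "((\<lambda>\<theta>. ln (norm r)) has_integral ln (norm r)) {0..1::real}"
      using has_integral_const_real[of "ln (norm r)" 0 1] by simp
    show "norm (inverse r) < 1" using r by (simp add: norm_inverse inverse_less_1_iff)
  qed
  ultimately show ?thesis using r by simp
qed

lemma has_integral_ln_norm_quadratic_circle:
  fixes A r1 r2 :: complex
  assumes "A \<noteq> 0" "norm r1 \<noteq> 1" "norm r2 \<noteq> 1"
  shows "((\<lambda>\<theta>. ln (norm (A * (exp (2 * of_real pi * \<i> * of_real \<theta>) - r1) * (exp (2 * of_real pi * \<i> * of_real \<theta>) - r2))))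
    has_integral ln (norm A) + max 0 (ln (norm r1)) + max 0 (ln (norm r2))) {0..1}"
proof -
  have "ln (norm A) + ln (norm (z - r1)) + ln (norm (z - r2)) = ln (norm (A * (z - r1) * (z - r2)))" if "norm z = 1" for z
    using assms that by (auto simp: norm_mult ln_mult)
  moreover have "norm (exp (2 * of_real pi * \<i> * of_real \<theta>)) = 1" for \<theta> :: real by (simp add: norm_exp_eq_Re)
  moreover have "((\<lambda>\<theta>. ln (norm A) + ln (norm (exp (2 * of_real pi * \<i> * of_real \<theta>) - r1)) + ln (norm (exp (2 * of_real pi * \<i> * of_real \<theta>) - r2)))
      has_integral ln (norm A) + max 0 (ln (norm r1)) + max 0 (ln (norm r2))) {0..1}"
    using has_integral_const_real[of "ln (norm A)" 0 1]
    by (intro has_integral_add has_integral_ln_norm_circle_minus assms) simp_all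
  ultimately show ?thesis by simp
qed

subsection \<open>The quadratic attached to a point of the plane\<close>

locale two_charges =
  fixes b :: real
  assumes b_gt_1: "1 < b"
begin

text \<open>The charges are the points with \<open>w\<^sup>2 = - p\<close>, and their antipodes
  satisfy \<open>w\<^sup>2 = - q\<close>. The half-axes \<open>b + 1 / b\<close> and
  \<open>b - 1 / b\<close> have squares \<open>c + 2\<close> and \<open>c - 2\<close> and product
  \<open>d\<close>.\<close>

definition p :: real where "p = b\<^sup>2"
definition q :: real where "q = 1 / b\<^sup>2"
definition c :: real where "c = p + q"
definition d :: real where "d = p - q"

lemma pq: "p * q = 1" "1 < p" "0 < q" "q < 1" "2 < c" "0 < d" "d\<^sup>2 = (c - 2) * (c + 2)"
proof -
  show p1: "1 < p" using b_gt_1 by (simp add: p_def)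
  show "p * q = 1" using b_gt_1 by (simp add: p_def q_def)
  moreover show "0 < q" using b_gt_1 by (simp add: q_def)
  show "q < 1" using p1 b_gt_1 by (simp add: p_def q_def divide_less_eq)
  ultimately show "d\<^sup>2 = (c - 2) * (c + 2)" unfolding c_def d_def by algebra
  show "0 < d" using \<open>1 < p\<close> \<open>q < 1\<close> by (simp add: d_def)
  have "0 < (p - 1)\<^sup>2" using p1 by simp
  then have "2 * p < p * p + 1" by (simp add: power2_eq_square algebra_simps)
  then have "2 * p * q < (p * p + 1) * q" using \<open>0 < q\<close> by simp
  also have "\<dots> = p * (p * q) + q" by (simp add: algebra_simps)
  finally show "2 < c" using \<open>p * q = 1\<close> by (simp add: c_def mult.assoc)
qed

definition s_crit :: real where "s_crit = 1 / (c + 2)"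

text \<open>By \<open>quadratic_factor\<close> below, \<open>big_root\<close> and \<open>small_root\<close> are the roots of
  \<open>(w\<^sup>2 + p) \<xi>\<^sup>2 - ((1 / s - c) w\<^sup>2 - 2) \<xi> + (w\<^sup>2 + q)\<close>; the square root of the discriminant is scaled by
  \<open>s\<close> so that \<open>T\<close> stays regular at \<open>s = 0\<close>.\<close>

definition disc :: "complex \<Rightarrow> real \<Rightarrow> complex" where
  "disc w s = of_real ((1 - c * s)\<^sup>2 - 4 * s\<^sup>2) - 4 * of_real s / w\<^sup>2"

definition T :: "complex \<Rightarrow> real \<Rightarrow> complex" where
  "T w s = (of_real (1 - c * s) + csqrt (disc w s)) / 2"

definition big_root :: "complex \<Rightarrow> real \<Rightarrow> complex" where
  "big_root w s = (w\<^sup>2 * T w s - of_real s) / (of_real s * (w\<^sup>2 + of_real p))"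

definition small_root :: "complex \<Rightarrow> real \<Rightarrow> complex" where
  "small_root w s = (w\<^sup>2 * (of_real (1 - c * s) - T w s) - of_real s) / (of_real s * (w\<^sup>2 + of_real p))"

text \<open>The parameter of the ellipse through \<open>w\<close>: with
  \<open>v = w / sqrt (1 + (norm w)\<^sup>2)\<close> it is
  \<open>(Re v)\<^sup>2 / (c + 2) + (Im v)\<^sup>2 / (c - 2)\<close>, brought to the common
  denominator \<open>d\<^sup>2 = (c - 2) * (c + 2)\<close>.\<close>

definition threshold :: "complex \<Rightarrow> real" where
  "threshold w = ((c - 2) * (Re w)\<^sup>2 + (c + 2) * (Im w)\<^sup>2) / (d\<^sup>2 * (1 + (norm w)\<^sup>2))"

lemma threshold_eq: "d\<^sup>2 * (1 + (norm w)\<^sup>2) * threshold w = (c - 2) * (Re w)\<^sup>2 + (c + 2) * (Im w)\<^sup>2"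
proof -
  have "1 + (norm w)\<^sup>2 \<noteq> 0" using zero_le_power2[of "norm w"] by linarith
  then show ?thesis unfolding threshold_def using pq(6) by simp
qed

lemma s_critD: "s \<le> s_crit \<Longrightarrow> 2 * s \<le> 1 - c * s"
  using pq(5) by (simp add: s_crit_def field_simps)

text \<open>\<open>T w s\<close> and \<open>1 - c * s - T w s\<close> are conjugate under the sign
  of the square root; this is their product, multiplied by \<open>w\<^sup>2\<close>.\<close>

lemma T_quadratic:
  assumes "w \<noteq> 0"
  shows "w\<^sup>2 * T w s * (of_real (1 - c * s) - T w s) = of_real (s\<^sup>2) * w\<^sup>2 + of_real s"
proof -
  define \<sigma> k S where "\<sigma> = csqrt (disc w s)" and "k = complex_of_real (1 - c * s)" and "S = complex_of_real s"
  have "\<sigma>\<^sup>2 = disc w s" by (simp add: \<sigma>_def)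
  also have "disc w s = k\<^sup>2 - 4 * S\<^sup>2 - 4 * S / w\<^sup>2" by (simp add: disc_def k_def S_def)
  finally have "w\<^sup>2 * \<sigma>\<^sup>2 = w\<^sup>2 * (k\<^sup>2 - 4 * S\<^sup>2) - 4 * S"
    using assms by (simp add: right_diff_distrib)
  moreover have "2 * T w s = k + \<sigma>" by (simp add: T_def \<sigma>_def k_def)
  ultimately have "4 * (w\<^sup>2 * T w s * (k - T w s)) = 4 * (S\<^sup>2 * w\<^sup>2 + S)" by algebra
  then have "w\<^sup>2 * T w s * (k - T w s) = S\<^sup>2 * w\<^sup>2 + S" by (subst (asm) mult_left_cancel) simp_all
  then show ?thesis by (simp add: k_def S_def)
qed

lemma of_real_pq: "complex_of_real p * complex_of_real q = 1"
  using pq(1) by (metis of_real_1 of_real_mult)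

lemma quadratic_factor:
  assumes "w \<noteq> 0" "s \<noteq> 0" "w\<^sup>2 + of_real p \<noteq> 0"
  shows "(w\<^sup>2 + of_real p) * (\<xi> - big_root w s) * (\<xi> - small_root w s) =
    (w\<^sup>2 + of_real p) * \<xi>\<^sup>2 - (of_real (1 / s - c) * w\<^sup>2 - 2) * \<xi> + (w\<^sup>2 + of_real q)"
proof -
  define a where "a = w\<^sup>2 + of_real p"
  define e where "e = complex_of_real (1 / s - c)"
  have es: "e * of_real s = of_real (1 - c * s)" using assms(2) by (simp add: e_def field_simps)
  define r1 r2 where "r1 = big_root w s" and "r2 = small_root w s"
  have s0: "complex_of_real s \<noteq> 0" using assms by simp
  have r1: "a * of_real s * r1 = w\<^sup>2 * T w s - of_real s"
    and r2: "a * of_real s * r2 = w\<^sup>2 * (of_real (1 - c * s) - T w s) - of_real s"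
    using assms(3) s0 by (simp_all add: a_def r1_def r2_def big_root_def small_root_def)
  have "of_real s * (a * (r1 + r2)) = of_real s * (e * w\<^sup>2 - 2)"
    using r1 r2 es by algebra
  then have sum: "a * (r1 + r2) = e * w\<^sup>2 - 2" using s0 by simp
  have "(a * of_real s * r1) * (a * of_real s * r2) = w\<^sup>2 * (w\<^sup>2 * T w s * (of_real (1 - c * s) - T w s))
      - of_real s * w\<^sup>2 * of_real (1 - c * s) + (of_real s)\<^sup>2"
    unfolding r1 r2 by (simp add: algebra_simps power2_eq_square)
  also have "\<dots> = w\<^sup>2 * (of_real (s\<^sup>2) * w\<^sup>2 + of_real s) - of_real s * w\<^sup>2 * of_real (1 - c * s) + (of_real s)\<^sup>2"
    unfolding T_quadratic[OF assms(1)] ..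
  also have "\<dots> = (of_real s)\<^sup>2 * (a * (w\<^sup>2 + of_real q))"
    using of_real_pq unfolding a_def c_def by (simp add: algebra_simps power2_eq_square) 
  finally have "(of_real s)\<^sup>2 * a * (a * (r1 * r2)) = (of_real s)\<^sup>2 * a * (w\<^sup>2 + of_real q)"
    by (simp add: power2_eq_square mult_ac)
  then have prod: "a * (r1 * r2) = w\<^sup>2 + of_real q" using s0 assms(3) by (simp add: a_def)
  have "a * (\<xi> - r1) * (\<xi> - r2) = a * \<xi>\<^sup>2 - (a * (r1 + r2)) * \<xi> + a * (r1 * r2)"
    by (simp add: algebra_simps power2_eq_square)
  then show ?thesis unfolding sum prod by (simp add: a_def e_def r1_def r2_def)
qed

text \<open>Up to a common factor the roots are \<open>P + \<sigma>\<close> and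
  \<open>P - \<sigma>\<close>, so the claim is \<open>0 \<le> Re (P * cnj \<sigma>)\<close>. It
  holds because \<open>P\<close> is a nonnegative real plus \<open>\<sigma>\<^sup>2 / 2\<close> and
  the principal root \<open>\<sigma>\<close> has nonnegative real part.\<close>

lemma norm_small_root_le:
  assumes "0 < s" "s \<le> s_crit" "w \<noteq> 0"
  shows "norm (small_root w s) \<le> norm (big_root w s)"
proof -
  define \<sigma> where "\<sigma> = csqrt (disc w s)"
  define k where "k = 1 - c * s"
  have k: "0 < k" "k < 1" using s_critD[OF assms(2)] assms(1) pq(5) by (auto simp: k_def)
  define P where "P = of_real k - 2 * of_real s / w\<^sup>2"
  have \<sigma>2: "\<sigma>\<^sup>2 = of_real (k\<^sup>2 - 4 * s\<^sup>2) - 4 * of_real s / w\<^sup>2" by (simp add: \<sigma>_def disc_def k_def)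
  have P: "P = of_real (k - (k\<^sup>2 - 4 * s\<^sup>2) / 2) + \<sigma>\<^sup>2 / 2"
    unfolding \<sigma>2 P_def by (simp add: field_simps)
  have "0 \<le> Re \<sigma>" using csqrt_principal[of "disc w s"] by (auto simp: \<sigma>_def)
  moreover have "0 \<le> k - (k\<^sup>2 - 4 * s\<^sup>2) / 2"
  proof -
    have "k\<^sup>2 \<le> k" using k by (simp add: power2_eq_square mult_left_le)
    then have "k\<^sup>2 - 4 * s\<^sup>2 \<le> 2 * k" using k zero_le_power2[of s] by linarith
    then show ?thesis by simp
  qed
  moreover have "Re (P * cnj \<sigma>) = (k - (k\<^sup>2 - 4 * s\<^sup>2) / 2) * Re \<sigma> + ((Re \<sigma>)\<^sup>2 + (Im \<sigma>)\<^sup>2) * Re \<sigma> / 2"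
    unfolding P by (simp add: power2_eq_square field_simps)
  ultimately have R: "0 \<le> Re (P * cnj \<sigma>)" by simp
  have "(norm (P - \<sigma>))\<^sup>2 \<le> (norm (P + \<sigma>))\<^sup>2"
    using R unfolding cmod_power2 by (simp add: power2_eq_square algebra_simps)
  then have le: "norm (P - \<sigma>) \<le> norm (P + \<sigma>)" by (rule power2_le_imp_le) simp
  have num: "w\<^sup>2 * T w s - of_real s = w\<^sup>2 / 2 * (P + \<sigma>)"
    "w\<^sup>2 * (of_real (1 - c * s) - T w s) - of_real s = w\<^sup>2 / 2 * (P - \<sigma>)"
    using assms(3) unfolding T_def P_def \<sigma>_def k_def by (simp_all add: field_simps)
  then show ?thesis
    unfolding big_root_def small_root_def num using le
    by (simp add: norm_divide norm_mult divide_right_mono mult_left_mono)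
qed

section \<open>Position of the two roots relative to the unit circle\<close>

lemma schur_cohn_identity:
  fixes r1 r2 :: complex
  shows "(1 - (norm (r1 * r2))\<^sup>2)\<^sup>2 - (norm (r1 + r2 - r1 * r2 * cnj (r1 + r2)))\<^sup>2 =
    (1 - (norm r1)\<^sup>2) * (1 - (norm r2)\<^sup>2) * (norm (1 - r1 * cnj r2))\<^sup>2"
  unfolding cmod_power2 times_complex.sel minus_complex.sel plus_complex.sel cnj.sel one_complex.sel
  by algebra

text \<open>The Schur-Cohn determinant tells from the coefficients whether the roots lie on the same
  side of the circle. Here it splits into a factor that changes sign when the ellipse passes through
  \<open>w\<close> and a factor that is positive for \<open>s \<le> s_crit\<close>.\<close>

lemma schur_cohn_quadratic:
  assumes "0 < s" "w \<noteq> 0" "w\<^sup>2 + of_real p \<noteq> 0"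
  defines "r1 \<equiv> big_root w s" and "r2 \<equiv> small_root w s" and "e \<equiv> 1 / s - c"
  shows "(norm (w\<^sup>2 + of_real p)) ^ 4 * ((1 - (norm r1)\<^sup>2) * (1 - (norm r2)\<^sup>2) * (norm (1 - r1 * cnj r2))\<^sup>2) =
     d\<^sup>2 * (1 + (norm w)\<^sup>2) * (s - threshold w) / s
     * ((c + 2) * (e + 2) * (Re w)\<^sup>2 + (c - 2) * (e - 2) * (Im w)\<^sup>2 + d\<^sup>2)" (is "?L = ?R")
    and "(norm (w\<^sup>2 + of_real p))\<^sup>2 * (1 - (norm (r1 * r2))\<^sup>2) = d * (2 * ((Re w)\<^sup>2 - (Im w)\<^sup>2) + c)"
proof -
  define a2 a1 a0 where "a2 = w\<^sup>2 + of_real p" and "a1 = - (of_real e * w\<^sup>2 - 2)" and "a0 = w\<^sup>2 + of_real q"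
  define x y X Y where "x = Re w" and "y = Im w" and "X = x\<^sup>2 - y\<^sup>2" and "Y = 2 * x * y"
  have W: "w\<^sup>2 = Complex X Y" by (simp add: complex_eq_iff X_def Y_def x_def y_def power2_eq_square)
  note F = quadratic_factor[of w s, folded r1_def r2_def e_def a2_def a0_def]
  have F: "a2 * (\<xi> - r1) * (\<xi> - r2) = a2 * \<xi>\<^sup>2 + a1 * \<xi> + a0" for \<xi>
    using F[of \<xi>] assms(1-3) by (simp add: a1_def a2_def) (simp add: algebra_simps)
  have a0: "a0 = a2 * (r1 * r2)" using F[of 0] by (simp add: mult.assoc)
  have a1: "a1 = - a2 * (r1 + r2)" 
  proof -
    have "a2 * (1 - r1) * (1 - r2) = a2 + a1 + a0" using F[of 1] by simp
    with a0 show ?thesis by algebra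
  qed
  have n0: "(norm a2)\<^sup>2 - (norm a0)\<^sup>2 = d * (2 * X + c)"
  proof -
    have "(norm a2)\<^sup>2 - (norm a0)\<^sup>2 = (X + p)\<^sup>2 - (X + q)\<^sup>2"
      by (simp add: a2_def a0_def W cmod_power2)
    also have "\<dots> = d * (2 * X + c)" unfolding d_def c_def by algebra
    finally show ?thesis .
  qed
  have "(norm a2)\<^sup>2 * (1 - (norm (r1 * r2))\<^sup>2) = (norm a2)\<^sup>2 - (norm a0)\<^sup>2"
    unfolding a0 by (simp add: norm_mult power_mult_distrib algebra_simps)
  then show "(norm (w\<^sup>2 + of_real p))\<^sup>2 * (1 - (norm (r1 * r2))\<^sup>2) = d * (2 * ((Re w)\<^sup>2 - (Im w)\<^sup>2) + c)"
    using n0 by (simp add: a2_def X_def x_def y_def)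
  have C: "cnj a2 * a1 - a0 * cnj a1 = - Complex (d * (e * X - 2)) ((4 + e * c) * Y)"
    unfolding a2_def a1_def a0_def W c_def d_def complex_eq_iff
    by (simp add: algebra_simps)
  have "?L = ((norm a2)\<^sup>2 * (1 - (norm (r1 * r2))\<^sup>2))\<^sup>2 - ((norm a2)\<^sup>2 * norm (r1 + r2 - r1 * r2 * cnj (r1 + r2)))\<^sup>2"
    unfolding schur_cohn_identity[symmetric] a2_def[symmetric] by algebra
  also have "(norm a2)\<^sup>2 * norm (r1 + r2 - r1 * r2 * cnj (r1 + r2)) = norm (cnj a2 * a1 - a0 * cnj a1)"
  proof -
    have "cnj a2 * a1 - a0 * cnj a1 = - (a2 * cnj a2) * (r1 + r2 - r1 * r2 * cnj (r1 + r2))"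
      unfolding a0 a1 by (simp add: algebra_simps)
    then show ?thesis by (simp add: norm_mult power2_eq_square)
  qed
  also have "((norm a2)\<^sup>2 * (1 - (norm (r1 * r2))\<^sup>2)) = d * (2 * X + c)"
    using \<open>(norm a2)\<^sup>2 * (1 - (norm (r1 * r2))\<^sup>2) = (norm a2)\<^sup>2 - (norm a0)\<^sup>2\<close> n0 by simp
  also have "(d * (2 * X + c))\<^sup>2 - (norm (cnj a2 * a1 - a0 * cnj a1))\<^sup>2 =
      - (d\<^sup>2 * ((e - 2) * X - 2 - c) * ((e + 2) * X - 2 + c) + (4 + e * c)\<^sup>2 * Y\<^sup>2)"
    unfolding C norm_minus_cancel cmod_power2 complex.sel by algebra
  also have "\<dots> = (d\<^sup>2 - (e - 2) * (c - 2) * x\<^sup>2 - (e + 2) * (c + 2) * y\<^sup>2)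
     * ((c + 2) * (e + 2) * x\<^sup>2 + (c - 2) * (e - 2) * y\<^sup>2 + d\<^sup>2)"
    unfolding X_def Y_def pq(7) by algebra
  also have "d\<^sup>2 - (e - 2) * (c - 2) * x\<^sup>2 - (e + 2) * (c + 2) * y\<^sup>2
     = d\<^sup>2 * (1 + (norm w)\<^sup>2) * (s - threshold w) / s"
  proof -
    have "d\<^sup>2 * (1 + (norm w)\<^sup>2) * threshold w = (c - 2) * x\<^sup>2 + (c + 2) * y\<^sup>2"
      unfolding threshold_eq x_def y_def ..
    moreover have es: "e * s = 1 - c * s" using assms(1) by (simp add: e_def field_simps)
    have "s * (d\<^sup>2 - (e - 2) * (c - 2) * x\<^sup>2 - (e + 2) * (c + 2) * y\<^sup>2) =
        d\<^sup>2 * (1 + (x\<^sup>2 + y\<^sup>2)) * s - ((c - 2) * x\<^sup>2 + (c + 2) * y\<^sup>2)"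
      unfolding pq(7) using es by algebra
    ultimately have "s * (d\<^sup>2 - (e - 2) * (c - 2) * x\<^sup>2 - (e + 2) * (c + 2) * y\<^sup>2) =
        d\<^sup>2 * (1 + (norm w)\<^sup>2) * (s - threshold w)"
      by (simp add: cmod_power2 x_def y_def algebra_simps)
    then show ?thesis using assms(1) by (simp add: field_simps)
  qed
  finally show "?L = ?R" unfolding x_def y_def .
qed


lemma threshold_nonneg: "0 \<le> threshold w"
  unfolding threshold_def using pq(5) by (intro divide_nonneg_nonneg) auto

lemma threshold_pos:
  assumes "w \<noteq> 0" shows "0 < threshold w"
proof -
  have "(Re w)\<^sup>2 + (Im w)\<^sup>2 > 0" using assms by (simp add: complex_eq_iff sum_power2_gt_zero_iff)
  moreover have "(c - 2) * ((Re w)\<^sup>2 + (Im w)\<^sup>2) \<le> (c - 2) * (Re w)\<^sup>2 + (c + 2) * (Im w)\<^sup>2"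
    by (simp add: distrib_left mult_right_mono)
  ultimately have "d\<^sup>2 * (1 + (norm w)\<^sup>2) * threshold w > 0"
    unfolding threshold_eq using pq(5) by (smt (verit) mult_pos_pos)
  then show ?thesis using threshold_nonneg[of w] by (cases "threshold w = 0") auto
qed

text \<open>The Schur-Cohn sign does not distinguish two inner roots from two outer ones; the
  product of the roots, a quotient of the outer coefficients, does. On the closed elliptic region
  \<open>4 * (Im w)\<^sup>2 \<le> c - 2\<close>, which makes \<open>2 * Re (w\<^sup>2) + c\<close>
  positive.\<close>

lemma inner_product_roots:
  assumes "0 < s" "s \<le> s_crit" "threshold w \<le> s" "w \<noteq> 0" "w\<^sup>2 + of_real p \<noteq> 0"
  shows "norm (big_root w s * small_root w s) < 1"
proof -
  have cs: "2 * s \<le> 1 - c * s" by (rule s_critD[OF assms(2)])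
  have "d\<^sup>2 * (1 + (norm w)\<^sup>2) * threshold w \<le> d\<^sup>2 * (1 + (norm w)\<^sup>2) * s"
    using assms(3) by (intro mult_left_mono) auto
  then have "(c - 2) * (Re w)\<^sup>2 + (c + 2) * (Im w)\<^sup>2 \<le> d\<^sup>2 * (1 + (norm w)\<^sup>2) * s"
    unfolding threshold_eq .
  then have "(c - 2) * (Re w)\<^sup>2 + (c + 2) * (Im w)\<^sup>2 \<le> (c - 2) * (c + 2) * (1 + (Re w)\<^sup>2 + (Im w)\<^sup>2) * s"
    unfolding pq(7) by (simp add: cmod_power2 add.assoc)
  moreover have "(c - 2) * (Re w)\<^sup>2 * ((c + 2) * s) \<le> (c - 2) * (Re w)\<^sup>2 * 1"
    by (intro mult_left_mono mult_nonneg_nonneg) (use cs pq(5) in \<open>auto simp: algebra_simps\<close>)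
  ultimately have "(c + 2) * (Im w)\<^sup>2 \<le> (c - 2) * (c + 2) * (1 + (Im w)\<^sup>2) * s"
    by (simp add: algebra_simps)
  then have "(c + 2) * (Im w)\<^sup>2 \<le> (c + 2) * ((c - 2) * (1 + (Im w)\<^sup>2) * s)" by (simp add: mult_ac)
  then have 1: "(Im w)\<^sup>2 \<le> (c - 2) * (1 + (Im w)\<^sup>2) * s" using pq(5) by (subst (asm) mult_le_cancel_left_pos) auto
  have "0 < 2 * ((Re w)\<^sup>2 - (Im w)\<^sup>2) + c"
  proof -
    have "(c + 2) * s \<le> 1" using cs by (simp add: algebra_simps)
    have "(Im w)\<^sup>2 * (c + 2) \<le> (c - 2) * (1 + (Im w)\<^sup>2) * s * (c + 2)"
      using 1 pq(5) by (intro mult_right_mono) auto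
    also have "\<dots> = ((c - 2) * (1 + (Im w)\<^sup>2)) * ((c + 2) * s)" by (simp add: mult_ac)
    also have "\<dots> \<le> ((c - 2) * (1 + (Im w)\<^sup>2)) * 1"
      using \<open>(c + 2) * s \<le> 1\<close> pq(5) by (intro mult_left_mono) auto
    finally have "4 * (Im w)\<^sup>2 \<le> c - 2" by (simp add: algebra_simps)
    moreover have "0 < 2 * (X - Y) + c" if "4 * Y \<le> c - 2" "0 \<le> X" for X Y
      using that pq(5) by argo
    ultimately show ?thesis by simp
  qed
  then have "0 < d * (2 * ((Re w)\<^sup>2 - (Im w)\<^sup>2) + c)" using pq(6) by simp
  then have "0 < (norm (w\<^sup>2 + of_real p))\<^sup>2 * (1 - (norm (big_root w s * small_root w s))\<^sup>2)"
    using schur_cohn_quadratic(2)[OF assms(1,4,5)] by simp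
  then have "(norm (big_root w s * small_root w s))\<^sup>2 < 1\<^sup>2"
    by (simp add: zero_less_mult_iff not_less)
  then show ?thesis by (rule power2_less_imp_less) simp
qed

text \<open>The determinant has the sign of \<open>s - threshold w\<close>. A negative sign puts the
  roots on opposite sides, and \<open>norm_small_root_le\<close> tells which one is outside;
  otherwise \<open>inner_product_roots\<close> excludes that both are outside.\<close>

lemma root_location:
  assumes "0 < s" "s \<le> s_crit" "w \<noteq> 0" "w\<^sup>2 + of_real p \<noteq> 0"
  shows "s < threshold w \<Longrightarrow> 1 < norm (big_root w s) \<and> norm (small_root w s) < 1"
    and "threshold w < s \<Longrightarrow> norm (big_root w s) < 1 \<and> norm (small_root w s) < 1"
    and "threshold w = s \<Longrightarrow> norm (big_root w s) = 1"
proof -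
  define u v where "u = norm (big_root w s)" and "v = norm (small_root w s)"
  define e where "e = 1 / s - c"
  have vu: "0 \<le> v" "v \<le> u" using norm_small_root_le[OF assms(1-3)] by (auto simp: u_def v_def)
  define N where "N = norm (1 - big_root w s * cnj (small_root w s))"
  define M where "M = (c + 2) * (e + 2) * (Re w)\<^sup>2 + (c - 2) * (e - 2) * (Im w)\<^sup>2 + d\<^sup>2"
  have "e \<ge> 2" using s_critD[OF assms(2)] assms(1) by (simp add: e_def field_simps)
  then have "M > 0" unfolding M_def using pq(5,6) by (intro add_nonneg_pos add_nonneg_nonneg mult_nonneg_nonneg) auto
  have k: "d\<^sup>2 * (1 + (norm w)\<^sup>2) > 0" using pq(6) by (intro mult_pos_pos add_pos_nonneg) auto
  have a: "norm (w\<^sup>2 + of_real p) ^ 4 > 0" using assms(4) by simp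
  have id: "norm (w\<^sup>2 + of_real p) ^ 4 * ((1 - u\<^sup>2) * (1 - v\<^sup>2) * N\<^sup>2) =
      d\<^sup>2 * (1 + (norm w)\<^sup>2) * (s - threshold w) / s * M"
    unfolding u_def v_def N_def M_def e_def by (rule schur_cohn_quadratic(1)[OF assms(1,3,4)])
  have uv: "u * v < 1" if "threshold w \<le> s"
    using inner_product_roots[OF assms(1,2) that assms(3,4)] by (simp add: u_def v_def norm_mult)
  have sq: "x\<^sup>2 < 1 \<longleftrightarrow> x < 1" "1 < x\<^sup>2 \<longleftrightarrow> 1 < x" "x\<^sup>2 = 1 \<longleftrightarrow> x = 1" if "0 \<le> x" for x :: real
    using that abs_square_less_1[of x] power_one_over power2_eq_1_iff[of x] abs_square_le_1[of x] by (auto simp: not_le[symmetric])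
  show "1 < norm (big_root w s) \<and> norm (small_root w s) < 1" if "s < threshold w"
  proof -
    have "d\<^sup>2 * (1 + (norm w)\<^sup>2) * (s - threshold w) / s * M < 0"
      using that assms(1) \<open>M > 0\<close> k by (intro mult_neg_pos divide_neg_pos mult_pos_neg) auto
    then have "(1 - u\<^sup>2) * (1 - v\<^sup>2) * N\<^sup>2 < 0" using a id by (metis mult_less_0_iff not_less_iff_gr_or_eq)
    then have "(1 - u\<^sup>2) * (1 - v\<^sup>2) < 0" by (metis mult_less_0_iff not_less zero_le_power2)
    then have "(1 < u \<and> v < 1) \<or> (u < 1 \<and> 1 < v)"
      using sq[of u] sq[of v] vu by (auto simp: mult_less_0_iff)
    then show ?thesis using vu by (auto simp: u_def v_def)
  qed
  show "norm (big_root w s) < 1 \<and> norm (small_root w s) < 1" if "threshold w < s"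
  proof -
    have "d\<^sup>2 * (1 + (norm w)\<^sup>2) * (s - threshold w) / s * M > 0"
      using that assms(1) \<open>M > 0\<close> by (intro mult_pos_pos[of _ M] divide_pos_pos mult_pos_pos[OF k]) auto
    then have "(1 - u\<^sup>2) * (1 - v\<^sup>2) * N\<^sup>2 > 0" using a id by (metis zero_less_mult_iff order_less_asym)
    then have "(1 - u\<^sup>2) * (1 - v\<^sup>2) > 0" by (metis zero_less_mult_iff not_less zero_le_power2)
    then have "(u < 1 \<and> v < 1) \<or> (1 < u \<and> 1 < v)"
      using sq[of u] sq[of v] vu by (auto simp: zero_less_mult_iff)
    moreover have "\<not> (1 < u \<and> 1 < v)" using uv that by (auto dest: less_1_mult)
    ultimately show ?thesis using vu by (auto simp: u_def v_def)
  qed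
  show "norm (big_root w s) = 1" if "threshold w = s"
  proof -
    have "(1 - u\<^sup>2) * (1 - v\<^sup>2) * N\<^sup>2 = 0" using a id that by simp
    \<comment> \<open>\<open>N = 0\<close> would make the roots reflections of each other in the
      circle, with moduli of product \<open>1\<close>.\<close>
    moreover have "N \<noteq> 0"
    proof
      assume "N = 0"
      then have "big_root w s * cnj (small_root w s) = 1" by (simp add: N_def)
      then have "u * v = 1" unfolding u_def v_def by (metis complex_mod_cnj norm_mult norm_one)
      then show False using uv that by simp
    qed
    ultimately have "u = 1 \<or> v = 1" using sq[of u] sq[of v] vu by auto
    moreover have "u = 1" if "v = 1" using vu uv \<open>threshold w = s\<close> that by simp
    ultimately show ?thesis by (auto simp: u_def)
  qed
qed

text \<open>Keeps \<open>csqrt\<close> off its branch cut, so that \<open>T w\<close> is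
  differentiable in \<open>s\<close>. A nonpositive discriminant forces \<open>w\<^sup>2\<close> to
  be a positive real; for a real \<open>w\<close> not yet passed by the ellipse this leads to
  \<open>(c - 2) * (1 - (c + 2) * s) \<le> 0\<close>, impossible below
  \<open>s_crit\<close>.\<close>

lemma disc_not_nonpos:
  assumes "0 < s" "s \<le> s_crit" "w \<noteq> 0" "s \<le> threshold w" "s < s_crit \<or> Im w \<noteq> 0"
  shows "disc w s \<notin> \<real>\<^sub>\<le>\<^sub>0"
proof
  assume "disc w s \<in> \<real>\<^sub>\<le>\<^sub>0"
  then obtain r where r: "r \<le> 0" "disc w s = of_real r" by (elim nonpos_Reals_cases) auto
  define k where "k = 1 - c * s"
  have k: "2 * s \<le> k" using s_critD[OF assms(2)] by (simp add: k_def)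
  then have k2: "0 \<le> k\<^sup>2 - 4 * s\<^sup>2" using power_mono[OF k, of 2] assms(1) by (simp add: power_mult_distrib)
  define m where "m = k\<^sup>2 - 4 * s\<^sup>2 - r"
  have m: "of_real m * w\<^sup>2 = of_real (4 * s)"
    using r(2) assms(3) unfolding disc_def m_def k_def by (simp add: field_simps)
  have "m \<noteq> 0" using m assms(1) by auto
  then have m0: "m > 0" using k2 r(1) by (simp add: m_def)
  have "m * ((Re w)\<^sup>2 - (Im w)\<^sup>2) = 4 * s" "m * (2 * Re w * Im w) = 0"
    using arg_cong[OF m, of Re] arg_cong[OF m, of Im] by (simp_all add: power2_eq_square algebra_simps)
  then have "Im w = 0 \<or> Re w = 0" using \<open>m \<noteq> 0\<close> by auto
  moreover have "(Re w)\<^sup>2 - (Im w)\<^sup>2 > 0"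
  proof (rule ccontr)
    assume "\<not> (Re w)\<^sup>2 - (Im w)\<^sup>2 > 0"
    then have "m * ((Re w)\<^sup>2 - (Im w)\<^sup>2) \<le> 0" using m0 by (intro mult_nonneg_nonpos) auto
    then show False using \<open>m * ((Re w)\<^sup>2 - (Im w)\<^sup>2) = 4 * s\<close> assms(1) by simp
  qed
  ultimately have im: "Im w = 0" using zero_le_power2[of "Im w"] by auto
  then have s: "s < s_crit" using assms(5) by simp
  have x: "m * (Re w)\<^sup>2 = 4 * s" using \<open>m * ((Re w)\<^sup>2 - (Im w)\<^sup>2) = 4 * s\<close> im by simp
  have mm: "(k\<^sup>2 - 4 * s\<^sup>2) * (Re w)\<^sup>2 \<le> 4 * s"
    unfolding x[symmetric] m_def using r(1) by (intro mult_right_mono) auto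
  have "d\<^sup>2 * (1 + (norm w)\<^sup>2) * s \<le> d\<^sup>2 * (1 + (norm w)\<^sup>2) * threshold w"
    using assms(4) by (intro mult_left_mono) auto
  then have "d\<^sup>2 * (1 + (Re w)\<^sup>2) * s \<le> (c - 2) * (Re w)\<^sup>2"
    unfolding threshold_eq by (simp add: cmod_power2 im)
  then have "(c - 2) * ((c + 2) * (1 + (Re w)\<^sup>2) * s) \<le> (c - 2) * (Re w)\<^sup>2"
    unfolding pq(7) by (simp add: mult.assoc)
  then have "(c + 2) * (1 + (Re w)\<^sup>2) * s \<le> (Re w)\<^sup>2" using pq(5) by (subst (asm) mult_le_cancel_left_pos) auto
  then have le: "(c + 2) * s \<le> (Re w)\<^sup>2 * (k - 2 * s)" by (simp add: k_def algebra_simps)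
  have pos: "0 < k + 2 * s" using k assms(1) by simp
  have "(c + 2) * s * (k + 2 * s) \<le> (Re w)\<^sup>2 * (k - 2 * s) * (k + 2 * s)"
    using le pos by (intro mult_right_mono) auto
  also have "\<dots> \<le> 4 * s" using mm by (simp add: power2_eq_square algebra_simps)
  finally have "s * ((c + 2) * (k + 2 * s)) \<le> s * 4" by (simp add: mult_ac)
  then have "(c + 2) * (k + 2 * s) \<le> 4" using assms(1) by (subst (asm) mult_le_cancel_left_pos) auto
  then have "(c - 2) * (1 - (c + 2) * s) \<le> 0" by (simp add: k_def algebra_simps)
  moreover have "(c + 2) * s < 1" using s pq(5) by (simp add: s_crit_def field_simps)
  ultimately show False using pq(5) by (simp add: mult_le_0_iff)
qed

end

subsection \<open>Integrating the logarithm of the exterior root\<close>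

lemma DERIV_ln_norm:
  fixes f :: "real \<Rightarrow> complex"
  assumes f: "(f has_vector_derivative f') (at x)" and "f x \<noteq> 0"
  shows "((\<lambda>s. ln (norm (f s))) has_real_derivative Re (f' / f x)) (at x)"
proof -
  have R: "((\<lambda>s. Re (f s)) has_real_derivative Re f') (at x)"
    using bounded_linear.has_vector_derivative[OF bounded_linear_Re f]
    by (simp add: has_real_derivative_iff_has_vector_derivative)
  have I: "((\<lambda>s. Im (f s)) has_real_derivative Im f') (at x)"
    using bounded_linear.has_vector_derivative[OF bounded_linear_Im f]
    by (simp add: has_real_derivative_iff_has_vector_derivative)
  have pos: "0 < (Re (f x))\<^sup>2 + (Im (f x))\<^sup>2"
    using assms(2) by (simp add: complex_eq_iff sum_power2_gt_zero_iff)
  define S N where "S = (Re (f x))\<^sup>2 + (Im (f x))\<^sup>2" and "N = 2 * Re (f x) * Re f' + 2 * Im (f x) * Im f'"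
  have "((\<lambda>s. (Re (f s))\<^sup>2 + (Im (f s))\<^sup>2) has_real_derivative N) (at x)"
    unfolding N_def by (rule DERIV_cong[OF DERIV_add[OF DERIV_power[OF R, of 2] DERIV_power[OF I, of 2]]]) simp
  from DERIV_cdivide[OF DERIV_chain2[OF DERIV_ln[OF pos] this], of 2]
  have "((\<lambda>s. ln ((Re (f s))\<^sup>2 + (Im (f s))\<^sup>2) / 2) has_real_derivative inverse S * N / 2) (at x)"
    unfolding S_def .
  moreover have "ln ((Re z)\<^sup>2 + (Im z)\<^sup>2) / 2 = ln (norm z)" for z
    by (cases "z = 0") (simp_all add: cmod_def ln_sqrt complex_eq_iff sum_power2_gt_zero_iff)
  moreover have "inverse S * N / 2 = Re (f' / f x)"
  proof -
    have "Re (f' / f x) = (Re f' * Re (f x) + Im f' * Im (f x)) / S" by (simp only: Re_divide S_def)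
    moreover have "N = 2 * (Re f' * Re (f x) + Im f' * Im (f x))" by (simp add: N_def algebra_simps)
    moreover have "inverse S * (2 * M) / 2 = M / S" for M by (simp add: field_simps)
    ultimately show ?thesis by (simp only:)
  qed
  ultimately show ?thesis by (simp only:)
qed

context two_charges
begin

text \<open>\<open>shift p w s\<close> and \<open>shift q w s\<close> are the \<open>A\<close> and
  \<open>B\<close> of the overview; as translates of the same \<open>T w s\<close> they satisfy
  \<open>A - B = d * s\<close>.\<close>

definition shift :: "real \<Rightarrow> complex \<Rightarrow> real \<Rightarrow> complex" where
  "shift t w s = T w s + of_real (t * s)"

text \<open>At \<open>s = 0\<close> the value \<open>0\<close> coming from \<open>x / 0 = 0\<close> and \<open>ln 0 = 0\<close> is the correct limit.\<close>

definition primitive :: "complex \<Rightarrow> real \<Rightarrow> real" where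
  "primitive w s = d * s * ln (norm (big_root w s)) + ln (norm (shift p w s)) - ln (norm (shift q w s))"

lemma Re_shift_pos:
  assumes "0 \<le> s" "s \<le> s_crit" "0 \<le> t"
  shows "0 < Re (shift t w s)" "shift t w s \<noteq> 0"
proof -
  have "0 \<le> Re (csqrt (disc w s))" using csqrt_principal[of "disc w s"] by auto
  moreover have "0 < 1 - c * s"
    using s_critD[OF assms(2)] assms(1) by (cases "s = 0") auto
  moreover have "Re (shift t w s) = (1 - c * s) / 2 + Re (csqrt (disc w s)) / 2 + t * s"
    by (simp add: shift_def T_def field_simps)
  ultimately show "0 < Re (shift t w s)" using assms by (simp add: add_pos_nonneg)
  then show "shift t w s \<noteq> 0" by auto
qed

text \<open>This is the use of the pair \<open>A\<close>, \<open>B\<close>: it factors the numerator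
  of \<open>big_root\<close>, so that the logarithm of its norm becomes a sum of logarithms of
  nonvanishing functions.\<close>

lemma shift_product:
  assumes "w \<noteq> 0"
  shows "w\<^sup>2 * shift p w s * shift q w s = w\<^sup>2 * T w s - of_real s"
proof -
  define W X P Q S where "W = w\<^sup>2" and "X = T w s" and "P = complex_of_real p" and "Q = complex_of_real q"
    and "S = complex_of_real s"
  have "W * X * (1 - (P + Q) * S - X) = S\<^sup>2 * W + S"
    using T_quadratic[OF assms, of s] by (simp add: W_def X_def P_def Q_def S_def c_def)
  moreover have "P * Q = 1" using of_real_pq by (simp add: P_def Q_def)
  ultimately have "W * (X + P * S) * (X + Q * S) = W * X - S" by algebra
  then show ?thesis by (simp add: shift_def W_def X_def P_def Q_def S_def)
qed

lemma big_root_eq_shift: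
  assumes "w \<noteq> 0"
  shows "big_root w s = w\<^sup>2 * shift p w s * shift q w s / (of_real s * (w\<^sup>2 + of_real p))"
  unfolding big_root_def shift_product[OF assms] ..

lemma ln_norm_big_root:
  assumes "0 < s" "s \<le> s_crit" "w \<noteq> 0" "w\<^sup>2 + of_real p \<noteq> 0"
  shows "ln (norm (big_root w s)) = ln (norm (w\<^sup>2)) + ln (norm (shift p w s)) + ln (norm (shift q w s))
     - ln s - ln (norm (w\<^sup>2 + of_real p))"
proof -
  have "shift p w s \<noteq> 0" "shift q w s \<noteq> 0" using Re_shift_pos[of s _ w] assms pq by auto
  then show ?thesis using assms
    unfolding big_root_eq_shift[OF assms(3)] norm_divide norm_mult by (simp add: ln_div ln_mult)
qed

lemma T_differentiable:
  assumes "disc w s \<notin> \<real>\<^sub>\<le>\<^sub>0"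
  obtains T' where "(T w has_vector_derivative T') (at s)"
proof -
  have r: "((\<lambda>s. (1 - c * s)\<^sup>2 - 4 * s\<^sup>2) has_real_derivative (2 * (1 - c * s) * (- c) - 8 * s)) (at s)"
    by (rule derivative_eq_intros refl | simp)+
  have eq: "disc w = (\<lambda>s. of_real ((1 - c * s)\<^sup>2 - 4 * s\<^sup>2) - (4 / w\<^sup>2) * of_real s)"
    by (auto simp: disc_def)
  have 1: "(disc w has_vector_derivative (of_real (2 * (1 - c * s) * (- c) - 8 * s) - (4 / w\<^sup>2) * of_real 1)) (at s)"
    unfolding eq by (intro has_vector_derivative_diff has_vector_derivative_of_real[OF r] has_vector_derivative_mult_right
        has_vector_derivative_of_real[OF DERIV_ident])
  have "((csqrt \<circ> disc w) has_vector_derivative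
      ((of_real (2 * (1 - c * s) * (- c) - 8 * s) - (4 / w\<^sup>2) * of_real 1) * (inverse (2 * csqrt (disc w s))))) (at s)"
    by (rule field_vector_diff_chain_at[OF 1]) (rule has_field_derivative_csqrt[OF assms])
  moreover have "((\<lambda>s. complex_of_real (1 - c * s)) has_vector_derivative of_real (- c)) (at s)"
    by (rule has_vector_derivative_of_real) (rule derivative_eq_intros refl | simp)+
  ultimately have "((\<lambda>s. (complex_of_real (1 - c * s) + (csqrt \<circ> disc w) s) / 2) has_vector_derivative
     (of_real (- c) + ((of_real (2 * (1 - c * s) * (- c) - 8 * s) - (4 / w\<^sup>2) * of_real 1) * (inverse (2 * csqrt (disc w s))))) / 2) (at s)"
    by (intro has_vector_derivative_divide has_vector_derivative_add)
  moreover have "(\<lambda>s. (complex_of_real (1 - c * s) + (csqrt \<circ> disc w) s) / 2) = T w"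
    by (auto simp: T_def)
  ultimately show thesis using that by simp
qed

text \<open>The last claim is the cancellation behind \<open>primitive\<close>: differentiating it
  produces \<open>d * ln (norm (big_root w s))\<close> plus the real part of this expression in the
  logarithmic derivatives of \<open>A\<close> and \<open>B\<close>.\<close>

lemma shift_derivative_relation:
  assumes T': "(T w has_vector_derivative T') (at s)" and "w \<noteq> 0" "w\<^sup>2 + of_real p \<noteq> 0"
    and nz: "shift p w s \<noteq> 0" "shift q w s \<noteq> 0"
  defines "A \<equiv> shift p w s" and "B \<equiv> shift q w s"
    and "A' \<equiv> T' + of_real p" and "B' \<equiv> T' + of_real q"
  shows "(shift p w has_vector_derivative A') (at s)" "(shift q w has_vector_derivative B') (at s)"
    and "of_real (d * s) * (A' / A + B' / B) - of_real d + A' / A - B' / B = 0"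
proof -
  have sh: "(shift t w has_vector_derivative T' + of_real t) (at s)" for t
    unfolding shift_def[abs_def]
    by (intro has_vector_derivative_add T' has_vector_derivative_of_real)
      (rule derivative_eq_intros refl | simp)+
  show 1: "(shift p w has_vector_derivative A') (at s)" "(shift q w has_vector_derivative B') (at s)"
    unfolding A'_def B'_def by (rule sh)+
  define W P Q S where "W = w\<^sup>2" and "P = complex_of_real p" and "Q = complex_of_real q"
    and "S = complex_of_real s"
  have "((\<lambda>s. w\<^sup>2 * (shift p w s * shift q w s)) has_vector_derivative w\<^sup>2 * (A * B' + A' * B)) (at s)"
    unfolding A_def B_def by (intro has_vector_derivative_mult_right has_vector_derivative_mult 1)
  moreover have "((\<lambda>s. w\<^sup>2 * T w s - of_real s) has_vector_derivative w\<^sup>2 * T' - of_real 1) (at s)"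
    by (intro has_vector_derivative_diff has_vector_derivative_mult_right T' has_vector_derivative_of_real DERIV_ident)
  moreover have "(\<lambda>s. w\<^sup>2 * (shift p w s * shift q w s)) = (\<lambda>s. w\<^sup>2 * T w s - of_real s)"
    using shift_product[OF assms(2)] by (simp add: mult.assoc)
  ultimately have R2: "W * (A * B' + A' * B) = W * T' - 1"
    unfolding W_def by (metis vector_derivative_unique_at of_real_1)
  have R1: "W * A * B = W * T w s - S"
    using shift_product[OF assms(2), of s] by (simp add: W_def S_def A_def B_def)
  have AB: "A = T w s + P * S" "B = T w s + Q * S" "A' = T' + P" "B' = T' + Q" "P * Q = 1"
    using of_real_pq by (simp_all add: A_def B_def A'_def B'_def P_def Q_def S_def shift_def)
  \<comment> \<open>\<open>W * Q + 1 = Q * (W + P)\<close> because \<open>P * Q = 1\<close>, so it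
    vanishes only at the charges.\<close>
  have n: "W * Q + 1 \<noteq> 0"
  proof
    assume "W * Q + 1 = 0"
    then have "W + P = 0" using AB(5) by algebra
    then show False using assms(3) by (simp add: W_def P_def)
  qed
  have R1': "(P - Q) * W * A * B = (W * P + 1) * B - (W * Q + 1) * A" using R1 AB by algebra
  then have R1'': "(A - 1) * (W * P + 1) * B = (W * Q + 1) * A * (B - 1)" by algebra
  have R2': "(P - Q) * W * (A * B' + A' * B) = (W * P + 1) * B' - (W * Q + 1) * A'" using R2 AB by algebra
  \<comment> \<open>The derivative of \<open>(W * P + 1) / A - (W * Q + 1) / B = (P - Q) * W\<close>
    in \<open>s\<close>, cleared of denominators; \<open>R1'\<close> is this relation
    itself.\<close>
  have R3: "(W * P + 1) * B\<^sup>2 * A' = (W * Q + 1) * A\<^sup>2 * B'" using R1' R2' by algebra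
  have "(W * Q + 1) * A * (A' * B * (B - 1)) = (W * Q + 1) * A * (B' * A * (A - 1))" using R1'' R3 by algebra
  then have key: "A' * B * (B - 1) = B' * A * (A - 1)" using n nz(1) by (simp add: A_def)
  have "(of_real (d * s) * (A' / A + B' / B) - of_real d + A' / A - B' / B) * (A * B) =
     (A - B) * (A' * B + B' * A) - (A' - B') * A * B + A' * B - B' * A"
  proof -
    have e: "of_real (d * s) = A - B" "complex_of_real d = A' - B'"
      using AB by (simp_all add: d_def P_def Q_def S_def algebra_simps)
    have "A \<noteq> 0" "B \<noteq> 0" using nz by (simp_all add: A_def B_def)
    then show ?thesis unfolding e by (simp add: field_simps)
  qed
  also have "\<dots> = 0" using key by algebra
  finally show "of_real (d * s) * (A' / A + B' / B) - of_real d + A' / A - B' / B = 0"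
    using nz by (simp add: A_def B_def)
qed

lemma DERIV_primitive:
  assumes "0 < s" "s < s_crit" "w \<noteq> 0" "w\<^sup>2 + of_real p \<noteq> 0" "s \<le> threshold w"
  shows "(primitive w has_real_derivative d * ln (norm (big_root w s))) (at s)"
proof -
  obtain T' where T': "(T w has_vector_derivative T') (at s)"
    using T_differentiable disc_not_nonpos[of s w] assms by (metis less_imp_le)
  have nz: "shift p w s \<noteq> 0" "shift q w s \<noteq> 0" using Re_shift_pos[of s _ w] assms pq by auto
  note D = shift_derivative_relation[OF T' assms(3,4) nz]
  define fA fB where "fA s = ln (norm (shift p w s))" and "fB s = ln (norm (shift q w s))" for s
  define K where "K = ln (norm (w\<^sup>2)) - ln (norm (w\<^sup>2 + of_real p))"
  define L where "L s = K + fA s + fB s - ln s" for s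
  define A' B' where "A' = (T' + of_real p) / shift p w s" and "B' = (T' + of_real q) / shift q w s"
  have DA: "(fA has_real_derivative Re A') (at s)"
    and DB: "(fB has_real_derivative Re B') (at s)"
    unfolding A'_def B'_def fA_def[abs_def] fB_def[abs_def] by (intro DERIV_ln_norm D nz)+
  have DL: "(L has_real_derivative (Re A' + Re B' - 1 / s)) (at s)"
    unfolding L_def[abs_def] using assms(1)
    by (auto intro!: derivative_eq_intros DA DB simp: divide_inverse)
  have D1: "((\<lambda>s. d * s * L s + fA s - fB s) has_real_derivative
      (d * L s + d * s * (Re A' + Re B' - 1 / s) + Re A' - Re B')) (at s)"
    by (auto intro!: derivative_eq_intros DA DB DL)
  have "d * L s + d * s * (Re A' + Re B' - 1 / s) + Re A' - Re B' = d * L s"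
  proof -
    have "Re (of_real (d * s) * (A' + B') - of_real d + A' - B') = 0"
      using D(3) unfolding A'_def B'_def by simp
    then have "d * s * (Re A' + Re B') - d + Re A' - Re B' = 0" by simp
    moreover have "d * s * (Re A' + Re B' - 1 / s) = d * s * (Re A' + Re B') - d"
      using assms(1) by (simp add: right_diff_distrib)
    ultimately show ?thesis by linarith
  qed
  moreover have "d * L s = d * ln (norm (big_root w s))"
    using ln_norm_big_root[of s w] assms by (simp add: L_def K_def fA_def fB_def)
  ultimately have "((\<lambda>s. d * s * L s + fA s - fB s) has_real_derivative
      d * ln (norm (big_root w s))) (at s)" by (intro DERIV_cong[OF D1]) argo
  then show ?thesis
  \<comment> \<open>The expression \<open>L\<close> agrees with
    \<open>ln (norm (big_root w s))\<close> for positive parameters up to \<open>s_crit\<close>, so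
    the two primitives are compared on the open interval.\<close>
  proof (rule has_field_derivative_transform_within_open[where S = "{0<..<s_crit}"])
    fix x assume "x \<in> {0<..<s_crit}"
    then have "ln (norm (big_root w x)) = L x"
      using ln_norm_big_root[of x w] assms(3,4) by (simp add: L_def K_def fA_def fB_def)
    then show "d * x * L x + fA x - fB x = primitive w x"
      by (simp only: primitive_def fA_def fB_def)
  next
    show "s \<in> {0<..<s_crit}" using assms(1,2) by simp
  qed (rule open_greaterThanLessThan)
qed

end

lemma continuous_on_mult_ln:
  fixes S :: real
  assumes "0 \<le> S"
  shows "continuous_on {0..S} (\<lambda>s. s * ln s)"
  unfolding continuous_on_eq_continuous_within
proof
  fix s assume s: "s \<in> {0..S}"
  show "continuous (at s within {0..S}) (\<lambda>s. s * ln s)"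
  proof (cases "s = 0")
    case True
    have "((\<lambda>s::real. s * ln s) \<longlongrightarrow> 0) (at_right 0)" by real_asymp
    then have "((\<lambda>s::real. s * ln s) \<longlongrightarrow> 0) (at 0 within {0..S})"
      using assms at_within_eq_bot_iff[of "0::real" "{0}"]
      by (cases "S = 0") (simp_all add: at_within_Icc_at_right)
    then show ?thesis using True by (simp add: continuous_within)
  next
    case False
    then show ?thesis using s by (intro continuous_intros) auto
  qed
qed

context two_charges
begin

text \<open>In the Lambert coordinate real points lie strictly within the critical long half-axis,
  which has length \<open>1\<close>. This supplies the alternative
  \<open>s < s_crit \<or> Im w \<noteq> 0\<close> needed in \<open>disc_not_nonpos\<close>.\<close>

lemma threshold_real_less:
  assumes "Im w = 0" shows "threshold w < s_crit"
proof -
  have "(d\<^sup>2 * (1 + (norm w)\<^sup>2)) * threshold w = (c - 2) * (Re w)\<^sup>2" using threshold_eq[of w] assms by simp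
  also have "\<dots> < (c - 2) * (1 + (Re w)\<^sup>2)" using pq(5) by simp
  also have "\<dots> = (d\<^sup>2 * (1 + (norm w)\<^sup>2)) * s_crit"
    unfolding pq(7) s_crit_def using pq(5) assms by (simp add: cmod_power2)
  finally show ?thesis
    by (rule mult_left_less_imp_less) simp
qed

lemma disc_not_nonpos':
  assumes "0 \<le> s" "s \<le> s_crit" "w \<noteq> 0" "s \<le> threshold w"
  shows "disc w s \<notin> \<real>\<^sub>\<le>\<^sub>0"
proof (cases "s = 0")
  case True
  then show ?thesis by (simp add: disc_def complex_nonpos_Reals_iff)
next
  case False
  have "s < s_crit \<or> Im w \<noteq> 0" using assms threshold_real_less[of w] by fastforce
  then show ?thesis using disc_not_nonpos[of s w] assms False by simp
qed

text \<open>Once \<open>ln (norm (big_root w s))\<close> is split, the only term singular at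
  \<open>0\<close> is \<open>s * ln s\<close>, which is continuous with value
  \<open>0\<close>.\<close>

lemma continuous_on_primitive:
  assumes "0 \<le> S" "S \<le> s_crit" "S \<le> threshold w" "w \<noteq> 0" "w\<^sup>2 + of_real p \<noteq> 0"
  shows "continuous_on {0..S} (primitive w)"
proof -
  have cT: "continuous_on {0..S} (T w)"
  proof (intro continuous_at_imp_continuous_on ballI)
    fix s assume "s \<in> {0..S}"
    then have "disc w s \<notin> \<real>\<^sub>\<le>\<^sub>0" using assms by (intro disc_not_nonpos') auto
    then obtain T' where "(T w has_vector_derivative T') (at s)" by (rule T_differentiable)
    then show "isCont (T w) s" by (rule has_vector_derivative_continuous)
  qed
  then have csh: "continuous_on {0..S} (\<lambda>s. shift t w s)" for t
    unfolding shift_def by (intro continuous_intros)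
  have cln: "continuous_on {0..S} (\<lambda>s. ln (norm (shift t w s)))" if "0 \<le> t" for t
    by (intro continuous_intros csh) (use Re_shift_pos(2) that assms in auto)
  have csln: "continuous_on {0..S} (\<lambda>s. s * ln s)" by (rule continuous_on_mult_ln[OF assms(1)])
  define K where "K = ln (norm (w\<^sup>2)) - ln (norm (w\<^sup>2 + of_real p))"
  define gp gq h where "gp s = ln (norm (shift p w s))" and "gq s = ln (norm (shift q w s))"
    and "h s = s * ln s" for s :: real
  have "continuous_on {0..S} gp" "continuous_on {0..S} gq" "continuous_on {0..S} h"
    unfolding gp_def[abs_def] gq_def[abs_def] h_def[abs_def] using cln pq csln by simp_all
  then have "continuous_on {0..S} (\<lambda>s. d * s * (K + gp s + gq s) - d * h s + gp s - gq s)"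
    by (intro continuous_intros)
  then show ?thesis
  proof (rule continuous_on_eq)
    fix s assume s: "s \<in> {0..S}"
    show "d * s * (K + gp s + gq s) - d * h s + gp s - gq s = primitive w s"
    proof (cases "s = 0")
      case False
      then have lb: "ln (norm (big_root w s)) = K + gp s + gq s - ln s"
        using ln_norm_big_root[of s w] s assms by (simp add: K_def gp_def gq_def)
      show ?thesis
        unfolding primitive_def lb gp_def[symmetric] gq_def[symmetric] h_def by (simp add: algebra_simps)
    qed (simp add: primitive_def gp_def gq_def h_def)
  qed
qed

lemma primitive_0 [simp]: "primitive w 0 = 0"
  by (simp add: primitive_def shift_def)

lemma has_integral_ln_big_root:
  assumes "0 \<le> S'" "S' \<le> S" "S \<le> s_crit" "S \<le> threshold w" "w \<noteq> 0" "w\<^sup>2 + of_real p \<noteq> 0"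
  shows "((\<lambda>s. ln (norm (big_root w s))) has_integral (primitive w S - primitive w S') / d) {S'..S}"
proof -
  have "((\<lambda>s. d * ln (norm (big_root w s))) has_integral (primitive w S - primitive w S')) {S'..S}"
  proof (rule fundamental_theorem_of_calculus_interior[OF assms(2)])
    show "continuous_on {S'..S} (primitive w)"
      by (rule continuous_on_subset[OF continuous_on_primitive[of S w]]) (use assms in auto)
    show "(primitive w has_vector_derivative d * ln (norm (big_root w x))) (at x)" if "x \<in> {S'<..<S}" for x
      using DERIV_primitive[of x w] that assms by (simp add: has_real_derivative_iff_has_vector_derivative)
  qed
  from has_integral_divide[OF this, of d] show ?thesis using pq(6) by simp
qed

lemma primitive_mono:
  assumes "0 \<le> S'" "S' \<le> S" "S \<le> s_crit" "S \<le> threshold w" "w \<noteq> 0" "w\<^sup>2 + of_real p \<noteq> 0"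
  shows "primitive w S' \<le> primitive w S"
proof -
  have "0 \<le> (primitive w S - primitive w S') / d"
  proof (rule has_integral_nonneg[OF has_integral_ln_big_root[OF assms]])
    fix s assume s: "s \<in> {S'..S}"
    show "0 \<le> ln (norm (big_root w s))"
    proof (cases "s = 0")
      case False
      then have "1 \<le> norm (big_root w s)"
        using root_location[of s w] s assms by (cases "s < threshold w") auto
      then show ?thesis by simp
    qed (simp add: big_root_def)
  qed
  then show ?thesis using pq(6) by (simp add: zero_le_divide_iff)
qed

text \<open>On the ellipse through \<open>w\<close> the root \<open>r\<close> has modulus
  \<open>1\<close>, so only \<open>ln (norm A / norm B)\<close> is left. The quadratic equation
  together with \<open>cnj r = 1 / r\<close> ties \<open>w\<^sup>2\<close> to \<open>r\<close> up to
  a positive factor, and this evaluates both norms.\<close>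

lemma primitive_threshold:
  assumes "threshold w \<le> s_crit" "w \<noteq> 0" "w\<^sup>2 + of_real p \<noteq> 0"
  shows "primitive w (threshold w) = ln (p * (1 + (norm w)\<^sup>2) / norm (w\<^sup>2 + of_real p))"
proof -
  define s r W P Q S where "s = threshold w" and "r = big_root w s" and "W = w\<^sup>2"
    and "P = complex_of_real p" and "Q = complex_of_real q" and "S = complex_of_real s"
  define A B where "A = shift p w s" and "B = shift q w s"
  have s: "0 < s" "s \<le> s_crit" using threshold_pos[OF assms(2)] assms(1) by (simp_all add: s_def)
  have nz: "A \<noteq> 0" "B \<noteq> 0" using Re_shift_pos(2)[of s _ w] s pq by (auto simp: A_def B_def)
  have W0: "W \<noteq> 0" "W + P \<noteq> 0" "S \<noteq> 0" using assms s by (auto simp: W_def P_def S_def)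
  have PQ: "P * Q = 1" using of_real_pq by (simp add: P_def Q_def)
  have r1: "norm r = 1" unfolding r_def using root_location(3)[OF s assms(2,3)] by (simp add: s_def)
  have rr: "r * cnj r = 1" using r1 complex_norm_square[of r] by simp
  define e where "e = 1 / s - c"
  have e2: "2 \<le> e" using s_critD[OF s(2)] s(1) by (simp add: e_def field_simps)
  define \<kappa> where "\<kappa> = e - 2 * Re r"
  have \<kappa>0: "0 \<le> \<kappa>" using e2 complex_Re_le_cmod[of r] r1 by (simp add: \<kappa>_def)
  have \<kappa>r: "of_real \<kappa> * r = of_real e * r - r\<^sup>2 - 1"
  proof -
    have "complex_of_real \<kappa> = of_real e - r - cnj r"
      unfolding \<kappa>_def using complex_add_cnj[of r] by (simp add: algebra_simps)
    with rr show ?thesis by algebra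
  qed
  have "(W + P) * r\<^sup>2 - (of_real e * W - 2) * r + (W + Q) = 0"
    using quadratic_factor[of w s r] assms s unfolding r_def[symmetric] e_def[symmetric] W_def[symmetric] P_def[symmetric] Q_def[symmetric]
    by (simp add: r_def)
  \<comment> \<open>Multiplying the quadratic by \<open>P\<close> completes the square on the right;
    what multiplies \<open>P * W\<close> is \<open>r\<close> times the nonnegative real
    \<open>\<kappa>\<close>.\<close>
  then have sq: "P * W * (of_real \<kappa> * r) = (P * r + 1)\<^sup>2" unfolding \<kappa>r using PQ by algebra
  have pr: "P * r + 1 \<noteq> 0"
  proof
    assume "P * r + 1 = 0"
    then have "P * r = - 1" by (simp add: eq_neg_iff_add_eq_0)
    then have "norm (P * r) = 1" by simp
    then show False using pq(2) r1 by (simp add: norm_mult P_def)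
  qed
  have rP: "r + P = r * cnj (P * r + 1)" using rr by (simp add: P_def algebra_simps)
  have nrP: "norm (r + P) = norm (P * r + 1)" unfolding rP norm_mult complex_mod_cnj r1 by simp
  have "\<kappa> \<noteq> 0" using sq pr by auto
  \<comment> \<open>The positive factor in \<open>W * (r + P) = (P * r + 1) * \<rho>\<close>.
    Comparing norms identifies it as \<open>norm W\<close>, since \<open>r + P\<close> and
    \<open>P * r + 1\<close> have equal norm on the unit circle.\<close>
  define \<rho> where "\<rho> = (norm (P * r + 1))\<^sup>2 / (p * \<kappa>)"
  have \<rho>: "0 \<le> \<rho>" "of_real (p * \<kappa>) * of_real \<rho> = (P * r + 1) * cnj (P * r + 1)"
  proof -
    show "0 \<le> \<rho>" unfolding \<rho>_def using \<kappa>0 pq(2) by simp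
    have "p * \<kappa> * \<rho> = (norm (P * r + 1))\<^sup>2" unfolding \<rho>_def using \<open>\<kappa> \<noteq> 0\<close> pq(2) by simp
    then show "of_real (p * \<kappa>) * of_real \<rho> = (P * r + 1) * cnj (P * r + 1)"
      by (metis complex_norm_square of_real_mult)
  qed
  have "of_real (p * \<kappa>) * (W * (r + P)) = of_real (p * \<kappa>) * ((P * r + 1) * of_real \<rho>)"
  proof -
    have "of_real (p * \<kappa>) * (W * (r + P)) = (P * W * (of_real \<kappa> * r)) * cnj (P * r + 1)"
      unfolding rP by (simp add: P_def mult_ac)
    also have "\<dots> = (P * r + 1) * ((P * r + 1) * cnj (P * r + 1))" unfolding sq by (simp add: power2_eq_square mult_ac)
    also have "\<dots> = of_real (p * \<kappa>) * ((P * r + 1) * of_real \<rho>)" unfolding \<rho>(2)[symmetric] by (simp add: mult_ac)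
    finally show ?thesis .
  qed
  then have WrP: "W * (r + P) = (P * r + 1) * of_real \<rho>" using \<open>\<kappa> \<noteq> 0\<close> pq(2) by simp
  then have "norm W * norm (P * r + 1) = norm (P * r + 1) * \<rho>"
    using \<rho>(1) nrP by (metis norm_mult norm_of_real abs_of_nonneg)
  then have \<rho>W: "\<rho> = norm W" using pr by simp
  have "S * (W + P) * r = W * A * B"
    using W0 unfolding r_def big_root_eq_shift[OF assms(2)] A_def[symmetric] B_def[symmetric]
      W_def[symmetric] S_def[symmetric] P_def[symmetric] by simp
  moreover have "W * A * B = W * T w s - S"
    using shift_product[OF assms(2), of s] by (simp add: W_def S_def A_def B_def)
  moreover have "A = T w s + P * S" "B = T w s + Q * S" by (simp_all add: A_def B_def P_def Q_def S_def shift_def)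
  ultimately have WA: "W * A = S * (W * (r + P) + (P * r + 1))" and WB: "P * (W * B) = S * (W + P) * (P * r + 1)"
    using PQ by algebra+
  have "W * A = S * ((P * r + 1) * of_real (1 + \<rho>))" unfolding WA WrP by (simp add: algebra_simps)
  then have nA: "norm W * norm A = s * (norm (P * r + 1) * (1 + norm W))"
    using s(1) \<rho>(1) unfolding \<rho>W by (metis S_def norm_mult norm_of_real abs_of_pos abs_of_nonneg add_nonneg_nonneg zero_le_one)
  have nB: "p * (norm W * norm B) = s * norm (W + P) * norm (P * r + 1)"
    using arg_cong[OF WB, of norm] s(1) pq(2) by (simp add: norm_mult P_def S_def)
  have "norm W * norm A * norm (W + P) = norm W * norm B * (p * (1 + norm W))"
  proof -
    have "norm W * norm A * norm (W + P) = (s * norm (W + P) * norm (P * r + 1)) * (1 + norm W)"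
      unfolding nA by (simp add: mult_ac)
    then show ?thesis unfolding nB[symmetric] by (simp add: mult_ac)
  qed
  then have "norm A * norm (W + P) = norm B * (p * (1 + norm W))" using W0 by simp
  then have AB: "norm A / norm B = p * (1 + norm W) / norm (W + P)"
    using nz W0 by (simp add: field_simps)
  have "primitive w s = ln (norm A / norm B)"
    using nz r1 by (simp add: primitive_def A_def B_def ln_div r_def)
  then show ?thesis unfolding AB by (simp add: s_def W_def P_def norm_power)
qed

end

lemma weighted_ln_concave:
  fixes x y l :: real
  assumes "0 < x" "0 < y" "0 \<le> l" "l \<le> 1"
  shows "l * ln x + (1 - l) * ln y \<le> ln (l * x + (1 - l) * y)"
  using concave_onD[OF ln_concave assms(3,4), of y x] assms by (simp add: add.commute)

context two_charges
begin

text \<open>At the critical parameter the exterior root is a Moebius function of \<open>w\<close>, and the bound is the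
  weighted inequality between arithmetic and geometric means.\<close>

lemma primitive_s_crit_le:
  assumes "w \<noteq> 0" "w\<^sup>2 + of_real p \<noteq> 0"
  shows "primitive w s_crit \<le> ln (p * (1 + (norm w)\<^sup>2) / norm (w\<^sup>2 + of_real p))"
proof -
  define s S P Q B1 where "s = s_crit" and "S = complex_of_real s" and "P = complex_of_real p"
    and "Q = complex_of_real q" and "B1 = complex_of_real b"
  have b0: "b > 0" using b_gt_1 by simp
  have c2: "(c + 2) * b\<^sup>2 = (b\<^sup>2 + 1)\<^sup>2"
    using b0 by (simp add: c_def p_def q_def field_simps power2_eq_square)
  have s: "0 < s" "s * (c + 2) = 1" using pq(5) by (simp_all add: s_def s_crit_def)
  have sb: "s * (b\<^sup>2 + 1)\<^sup>2 = b\<^sup>2" using s(2) c2 by algebra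
  \<comment> \<open>At \<open>s_crit\<close> the constant part of the discriminant vanishes, and the
    remaining \<open>- 4 * s / w\<^sup>2\<close> is the square of
    \<open>2 * \<i> * s * (b + 1 / b) / w\<close>.\<close>
  have cs: "1 - c * s = 2 * s" using s(2) by (simp add: algebra_simps)
  define \<sigma> where "\<sigma> = csqrt (disc w s)"
  have "\<sigma>\<^sup>2 = - (4 * S / w\<^sup>2)" unfolding \<sigma>_def S_def by (simp add: disc_def cs power_mult_distrib)
  then have sw: "(\<sigma> * w)\<^sup>2 = - 4 * S" using assms(1) by (simp add: power_mult_distrib)
  define y where "y = 2 * \<i> * of_real (s * (b + 1 / b))"
  have "y\<^sup>2 = - 4 * S"
  proof -
    have "(s * (b + 1 / b))\<^sup>2 = s * (s * (b\<^sup>2 + 1)\<^sup>2) / b\<^sup>2"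
      using b0 by (simp add: field_simps power2_eq_square)
    also have "\<dots> = s" unfolding sb using b0 by simp
    finally have "complex_of_real ((s * (b + 1 / b))\<^sup>2) = S" by (simp add: S_def)
    then show ?thesis by (simp add: y_def power_mult_distrib)
  qed
  then have "\<sigma> * w = y \<or> \<sigma> * w = - y" using sw by (metis power2_eq_iff)
  \<comment> \<open>\<open>\<delta>\<close> records which of the two square roots
    \<open>csqrt\<close> selects; the computation is uniform in it.\<close>
  then have "\<exists>\<delta> :: complex. (\<delta> = 1 \<or> \<delta> = - 1) \<and> \<sigma> * w = \<delta> * y" by (metis mult_1 mult_minus1)
  then obtain \<delta> :: complex where \<delta>: "\<delta> = 1 \<or> \<delta> = - 1" and \<sigma>w: "\<sigma> * w = \<delta> * y" by blast
  have \<delta>2: "\<delta> * \<delta> = 1" using \<delta> by auto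
  define u v v' where "u = w + \<i> * \<delta> / B1" and "v = w - \<i> * \<delta> * B1" and "v' = w + \<i> * \<delta> * B1"
  have B1: "B1 \<noteq> 0" "P = B1\<^sup>2" "Q * B1\<^sup>2 = 1" using b0 by (simp_all add: B1_def P_def Q_def p_def q_def)
  define g where "g = B1 + 1 / B1"
  have wT: "w * T w s = S * w + \<i> * \<delta> * S * g"
  proof -
    have "2 * T w s = 2 * S + \<sigma>" unfolding T_def \<sigma>_def cs by (simp add: S_def)
    then have "2 * (w * T w s) = 2 * S * w + \<delta> * y" using \<sigma>w by algebra
    also have "\<delta> * y = 2 * (\<i> * \<delta> * S * g)" by (simp add: y_def S_def B1_def g_def)
    finally show ?thesis by algebra
  qed
  define A B where "A = shift p w s" and "B = shift q w s"
  have nz: "A \<noteq> 0" "B \<noteq> 0" using Re_shift_pos(2)[of s _ w] s(1) pq by (auto simp: A_def B_def s_def)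
  have A: "w * A = S * (1 + P) * u"
  proof -
    have "w * A = S * w + \<i> * \<delta> * S * g + w * P * S"
      using wT unfolding A_def shift_def by (simp add: S_def P_def algebra_simps)
    moreover have "g = (1 + P) * (1 / B1)"
      using B1 by (simp add: g_def field_simps power2_eq_square)
    ultimately show ?thesis unfolding u_def by (simp add: algebra_simps)
  qed
  have Bv: "w * B = S * (1 + Q) * v'"
  proof -
    have "w * B = S * w + \<i> * \<delta> * S * g + w * Q * S"
      using wT unfolding B_def shift_def by (simp add: S_def Q_def algebra_simps)
    moreover have "g = (1 + Q) * B1"
    proof -
      have "1 / B1 = Q * B1" using B1 by (simp add: field_simps power2_eq_square)
      then show ?thesis by (simp add: g_def algebra_simps)
    qed
    ultimately show ?thesis unfolding v'_def by (simp add: algebra_simps)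
  qed
  have vv: "v * v' = w\<^sup>2 + P" unfolding v_def v'_def B1(2) using \<delta>2
    by (simp add: algebra_simps power2_eq_square) 
  have v0: "v \<noteq> 0" "v' \<noteq> 0" using vv assms(2) by (auto simp: P_def)
  have u0: "u \<noteq> 0" using A nz(1) assms(1) by auto
  have S0: "S \<noteq> 0" using s by (simp add: S_def)
  have PQS: "S * ((1 + P) * (1 + Q)) = 1"
  proof -
    have "s * ((1 + p) * (1 + q)) = s * (c + 2)" using pq(1) unfolding c_def by algebra
    then have "complex_of_real (s * ((1 + p) * (1 + q))) = 1" using s(2) by simp
    then show ?thesis by (simp add: S_def P_def Q_def)
  qed
  have "big_root w s * (S * (v * v')) = (w * A) * (w * B)"
    using big_root_eq_shift[OF assms(1), of s] S0 assms(2) unfolding vv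
    by (simp add: A_def B_def S_def P_def power2_eq_square)
  also have "\<dots> = (S * ((1 + P) * (1 + Q))) * S * u * v'" unfolding A Bv by (simp add: mult_ac)
  finally have "big_root w s * v * (S * v') = u * (S * v')" unfolding PQS by (simp add: mult_ac)
  then have "big_root w s * v = u" using S0 v0 by simp
  then have r: "big_root w s = u / v" using v0 by (simp add: field_simps)
  have "norm w * norm A = s * (1 + p) * norm u" "norm w * norm B = s * (1 + q) * norm v'"
  proof -
    have PQ1: "1 + P = of_real (1 + p)" "1 + Q = of_real (1 + q)" by (simp_all add: P_def Q_def)
    have "norm (1 + P) = 1 + p" "norm (1 + Q) = 1 + q"
      unfolding PQ1 norm_of_real using pq(2,3) by simp_all
    then show "norm w * norm A = s * (1 + p) * norm u" "norm w * norm B = s * (1 + q) * norm v'"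
      using arg_cong[OF A, of norm] arg_cong[OF Bv, of norm] s(1) by (simp_all add: norm_mult S_def)
  qed
  then have nAB: "norm A = s * (1 + p) * norm u / norm w" "norm B = s * (1 + q) * norm v' / norm w"
    using assms(1) by (simp_all add: field_simps)
  have p1q: "1 + p = p * (1 + q)" using pq(1) by (simp add: algebra_simps)
  have "ln (norm A) - ln (norm B) = ln p + ln (norm u) - ln (norm v')"
    unfolding nAB p1q using s(1) u0 v0 assms(1) pq by (simp add: ln_mult ln_div)
  then have prim: "primitive w s = d * s * (ln (norm u) - ln (norm v)) + ln p + ln (norm u) - ln (norm v')"
    unfolding primitive_def r using u0 v0 by (simp add: A_def B_def norm_divide ln_div)
  \<comment> \<open>This weight makes
    \<open>l * (norm v)\<^sup>2 + (1 - l) * (norm u)\<^sup>2\<close> equal to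
    \<open>1 + (norm w)\<^sup>2\<close> and also matches the coefficient
    \<open>d * s = 1 - 2 * l\<close>.\<close>
  define l where "l = 1 / (1 + p)"
  have l: "0 < l" "l < 1" using pq(2) by (simp_all add: l_def)
  have ds: "d * s = 1 - 2 * l"
  proof -
    have "d * (s * (c + 2)) * (1 + p) = (p - 1) * (c + 2)"
      unfolding s(2) unfolding d_def c_def using pq(1) by algebra
    then have "d * s * (1 + p) = p - 1" using pq(5) by simp
    then show ?thesis using pq(2) by (simp add: l_def field_simps)
  qed
  have "l * (norm v)\<^sup>2 + (1 - l) * (norm u)\<^sup>2 = 1 + (norm w)\<^sup>2"
  proof -
    obtain \<epsilon> :: real where \<epsilon>: "\<delta> = of_real \<epsilon>" "\<epsilon> * \<epsilon> = 1" using \<delta> by (metis mult_1 mult_minus1 minus_minus of_real_1 of_real_minus)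
    have nv: "(norm v)\<^sup>2 = (Re w)\<^sup>2 + (Im w - \<epsilon> * b)\<^sup>2"
      unfolding v_def \<epsilon>(1) B1_def cmod_power2 by simp
    have "\<i> * \<delta> / B1 = \<i> * of_real (\<epsilon> / b)" by (simp add: \<epsilon>(1) B1_def)
    then have nu: "(norm u)\<^sup>2 = (Re w)\<^sup>2 + (Im w + \<epsilon> / b)\<^sup>2"
      unfolding u_def cmod_power2 by simp
    have "(1 + p) * (l * (norm v)\<^sup>2 + (1 - l) * (norm u)\<^sup>2) = (norm v)\<^sup>2 + p * (norm u)\<^sup>2"
    proof -
      have "l * (1 + p) = 1" using pq(2) by (simp add: l_def)
      then show ?thesis by algebra
    qed
    also have "p * (norm u)\<^sup>2 = p * (Re w)\<^sup>2 + (b * Im w + \<epsilon>)\<^sup>2"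
      unfolding nu p_def using b0 by (simp add: field_simps power2_eq_square)
    also have "(norm v)\<^sup>2 + (p * (Re w)\<^sup>2 + (b * Im w + \<epsilon>)\<^sup>2) = (1 + p) * (1 + (norm w)\<^sup>2)"
      unfolding nv unfolding p_def cmod_power2 using \<epsilon>(2) by algebra
    finally show ?thesis using pq(2) by simp
  qed
  then have "l * ln ((norm v)\<^sup>2) + (1 - l) * ln ((norm u)\<^sup>2) \<le> ln (1 + (norm w)\<^sup>2)"
    using weighted_ln_concave[of "(norm v)\<^sup>2" "(norm u)\<^sup>2" l] l u0 v0 by simp
  then have "2 * l * ln (norm v) + 2 * (1 - l) * ln (norm u) \<le> ln (1 + (norm w)\<^sup>2)"
    using u0 v0 by (simp add: ln_realpow algebra_simps)
  then have "primitive w s \<le> ln p + ln (1 + (norm w)\<^sup>2) - (ln (norm v) + ln (norm v'))"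
    unfolding prim ds by (simp add: algebra_simps)
  also have "ln (norm v) + ln (norm v') = ln (norm (w\<^sup>2 + P))"
    unfolding vv[symmetric] norm_mult using v0 by (simp add: ln_mult)
  also have "ln p + ln (1 + (norm w)\<^sup>2) - ln (norm (w\<^sup>2 + P)) = ln (p * (1 + (norm w)\<^sup>2) / norm (w\<^sup>2 + P))"
  proof -
    have "0 < 1 + (norm w)\<^sup>2" by (intro add_pos_nonneg) auto
    then show ?thesis using pq(2) assms(2) by (simp add: ln_mult ln_div P_def)
  qed
  finally show ?thesis by (simp add: s_def P_def)
qed

lemma has_integral_max_ln_big_root:
  assumes "0 < S" "S < s_crit" "w \<noteq> 0" "w\<^sup>2 + of_real p \<noteq> 0"
  obtains L where "((\<lambda>s. max 0 (ln (norm (big_root w s)))) has_integral L) {0..S}"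
    "d * L \<le> ln (p * (1 + (norm w)\<^sup>2) / norm (w\<^sup>2 + of_real p))"
    "threshold w \<le> S \<Longrightarrow> d * L = ln (p * (1 + (norm w)\<^sup>2) / norm (w\<^sup>2 + of_real p))"
proof -
  \<comment> \<open>The integrand is \<open>ln (norm (big_root w s))\<close> up to the threshold and
    \<open>0\<close> beyond it, so the integral is \<open>primitive w M / d\<close>.\<close>
  define M where "M = min S (threshold w)"
  have M: "0 \<le> M" "M \<le> S" "M \<le> threshold w" "M \<le> s_crit"
    using threshold_nonneg[of w] assms by (auto simp: M_def)
  have "((\<lambda>s. ln (norm (big_root w s))) has_integral primitive w M / d) {0..M}"
    using has_integral_ln_big_root[of 0 M w] M assms by simp
  then have 1: "((\<lambda>s. max 0 (ln (norm (big_root w s)))) has_integral primitive w M / d) {0..M}"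
  proof (rule has_integral_eq[rotated])
    fix s assume s: "s \<in> {0..M}"
    show "ln (norm (big_root w s)) = max 0 (ln (norm (big_root w s)))"
    proof (cases "s = 0")
      case False
      then have "1 \<le> norm (big_root w s)"
        using root_location[of s w] s M assms by (cases "s < threshold w") auto
      then show ?thesis by simp
    qed (simp add: big_root_def)
  qed
  have 2: "((\<lambda>s. max 0 (ln (norm (big_root w s)))) has_integral 0) {M..S}"
  proof (cases "M = S")
    case False
    then have "M = threshold w" by (auto simp: M_def min_def split: if_splits)
    show ?thesis
    proof (rule has_integral_spike_finite[of "{M}" _ _ "\<lambda>_. 0"])
      fix s assume s: "s \<in> {M..S} - {M}"
      then have "norm (big_root w s) < 1"
        using root_location(2)[of s w] M assms \<open>M = threshold w\<close> by auto
      then show "max 0 (ln (norm (big_root w s))) = 0"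
        by (cases "big_root w s = 0") auto
    qed auto
  qed auto
  have 3: "((\<lambda>s. max 0 (ln (norm (big_root w s)))) has_integral primitive w M / d) {0..S}"
    using has_integral_combine[OF M(1,2) 1 2] by simp
  have "primitive w M \<le> ln (p * (1 + (norm w)\<^sup>2) / norm (w\<^sup>2 + of_real p))"
  \<comment> \<open>If the ellipses reach \<open>w\<close> by \<open>s_crit\<close>, monotonicity
    leads to the explicit value at the threshold; otherwise it leads to the bound at
    \<open>s_crit\<close>.\<close>
  proof (cases "threshold w \<le> s_crit")
    case True
    then show ?thesis using primitive_mono[of M "threshold w" w] M assms primitive_threshold[of w] by simp
  next
    case False
    then show ?thesis using primitive_mono[of M s_crit w] M assms primitive_s_crit_le[of w] by simp
  qed
  moreover have "primitive w M = ln (p * (1 + (norm w)\<^sup>2) / norm (w\<^sup>2 + of_real p))" if "threshold w \<le> S"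
  proof -
    have "M = threshold w" using that by (simp add: M_def)
    then show ?thesis using primitive_threshold[of w] that assms by simp
  qed
  ultimately show thesis using that[OF 3] pq(6) by simp
qed

end

subsection \<open>Stereographic coordinates\<close>

definition inv_stereographic :: "complex \<Rightarrow> real ^ 3" where
  "inv_stereographic z = vector [2 * Re z / (1 + (norm z)\<^sup>2), 2 * Im z / (1 + (norm z)\<^sup>2),
     ((norm z)\<^sup>2 - 1) / (1 + (norm z)\<^sup>2)]"

lemma one_plus_norm_sq_pos: "0 < 1 + (norm (z :: complex))\<^sup>2"
  by (intro add_pos_nonneg) auto

text \<open>The chordal distance formula in disguise; that the image lies on the sphere and that the
  map is injective both follow from it.\<close>

lemma inner_inv_stereographic:
  "(1 + inv_stereographic z \<bullet> inv_stereographic w) / 2 =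
     1 - (norm (z - w))\<^sup>2 / ((1 + (norm z)\<^sup>2) * (1 + (norm w)\<^sup>2))"
proof -
  define A B where "A = 1 + (norm z)\<^sup>2" and "B = 1 + (norm w)\<^sup>2"
  have AB: "A \<noteq> 0" "B \<noteq> 0" using one_plus_norm_sq_pos[of z] one_plus_norm_sq_pos[of w] by (auto simp: A_def B_def)
  have "inv_stereographic z \<bullet> inv_stereographic w =
      (4 * Re z * Re w + 4 * Im z * Im w + ((norm z)\<^sup>2 - 1) * ((norm w)\<^sup>2 - 1)) / (A * B)"
    unfolding inv_stereographic_def A_def[symmetric] B_def[symmetric] inner_vec_def sum_3 vector_3 inner_real_def
    using AB by (simp add: field_simps)
  moreover have "A * B + (4 * Re z * Re w + 4 * Im z * Im w + ((norm z)\<^sup>2 - 1) * ((norm w)\<^sup>2 - 1)) =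
      2 * (A * B) - 2 * (norm (z - w))\<^sup>2"
    unfolding A_def B_def cmod_power2 by (simp add: power2_eq_square algebra_simps)
  ultimately show ?thesis
    unfolding A_def[symmetric] B_def[symmetric] using AB by (simp add: field_simps)
qed

lemma inv_stereographic_in_sphere: "inv_stereographic z \<in> S2"
proof -
  have "(1 + inv_stereographic z \<bullet> inv_stereographic z) / 2 = 1" by (simp add: inner_inv_stereographic)
  then show ?thesis by (simp add: norm_eq_1)
qed

lemma norm_inv_stereographic_diff:
  "(norm (inv_stereographic z - inv_stereographic w))\<^sup>2 / 4 =
     (norm (z - w))\<^sup>2 / ((1 + (norm z)\<^sup>2) * (1 + (norm w)\<^sup>2))"
  using half_one_plus_inner_sphere(3)[OF inv_stereographic_in_sphere[of z] inv_stereographic_in_sphere[of w]]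
  by (simp add: inner_inv_stereographic)

lemma inv_stereographic_eq_iff [simp]: "inv_stereographic z = inv_stereographic w \<longleftrightarrow> z = w"
proof
  assume "inv_stereographic z = inv_stereographic w"
  then have "(norm (z - w))\<^sup>2 / ((1 + (norm z)\<^sup>2) * (1 + (norm w)\<^sup>2)) = 0"
    using norm_inv_stereographic_diff[of z w] by simp
  then show "z = w" using one_plus_norm_sq_pos[of z] one_plus_norm_sq_pos[of w] by auto
qed simp

lemma stereographic_inv_stereographic [simp]: "stereographic (inv_stereographic z) = Some z"
proof -
  have A: "1 + (norm z)\<^sup>2 \<noteq> 0" using one_plus_norm_sq_pos[of z] by simp
  have "1 - inv_stereographic z $ 3 = 2 / (1 + (norm z)\<^sup>2)"
    unfolding inv_stereographic_def vector_3 using A by (simp add: field_simps)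
  moreover have "inv_stereographic z $ 3 \<noteq> 1"
    unfolding inv_stereographic_def vector_3 using A by (simp add: field_simps)
  moreover have "inv_stereographic z $ 1 = 2 * Re z / (1 + (norm z)\<^sup>2)"
     "inv_stereographic z $ 2 = 2 * Im z / (1 + (norm z)\<^sup>2)"
    unfolding inv_stereographic_def vector_3 by simp_all
  ultimately show ?thesis
    unfolding stereographic_def using A by (simp add: complex_eq_iff Re_divide_of_real Im_divide_of_real del: of_real_divide)
qed

lemma inv_stereographic_unique:
  fixes x :: "real ^ 3"
  assumes "x \<in> S2" "stereographic x = Some z"
  shows "x = inv_stereographic z"
proof -
  have n: "(x $ 1)\<^sup>2 + (x $ 2)\<^sup>2 + (x $ 3)\<^sup>2 = 1"
    using assms(1) by (simp add: norm_eq_1 inner_vec_def sum_3 power2_eq_square)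
  have x3: "x $ 3 \<noteq> 1" using assms(2) by (auto simp: stereographic_def split: if_splits)
  define k where "k = 1 - x $ 3"
  have k: "k \<noteq> 0" using x3 by (simp add: k_def)
  have z: "z = (of_real (x $ 1) + \<i> * of_real (x $ 2)) / of_real k"
    using assms(2) x3 by (simp add: stereographic_def k_def)
  then have ReIm: "Re z = x $ 1 / k" "Im z = x $ 2 / k"
    by (simp_all add: Re_divide_of_real Im_divide_of_real)
  have "(norm z)\<^sup>2 * k\<^sup>2 = (x $ 1)\<^sup>2 + (x $ 2)\<^sup>2"
    unfolding cmod_power2 ReIm using k by (simp add: field_simps power2_eq_square)
  then have "k * (k * (1 + (norm z)\<^sup>2)) = k * 2" using n by (simp add: k_def power2_eq_square algebra_simps)
  then have k2: "k * (1 + (norm z)\<^sup>2) = 2" using k by simp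
  then have A: "1 + (norm z)\<^sup>2 = 2 / k" using k by (simp add: field_simps)
  then have N: "(norm z)\<^sup>2 - 1 = 2 / k - 2" by simp
  show ?thesis
    unfolding vec_eq_iff forall_3 inv_stereographic_def vector_3 A N ReIm
    using k by (simp add: field_simps k_def)
qed

lemma north_pole_unique:
  fixes x :: "real ^ 3"
  assumes "x \<in> S2" "x $ 3 = 1" shows "x = vector [0, 0, 1]"
proof -
  have "(x $ 1)\<^sup>2 + (x $ 2)\<^sup>2 + (x $ 3)\<^sup>2 = 1"
    using assms(1) by (simp add: norm_eq_1 inner_vec_def sum_3 power2_eq_square)
  then have "(x $ 1)\<^sup>2 + (x $ 2)\<^sup>2 = 0" using assms(2) by simp
  then show ?thesis using assms(2) by (simp add: vec_eq_iff forall_3 sum_power2_eq_zero_iff)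
qed

lemma north_pole_in_sphere: "(vector [0, 0, 1] :: real ^ 3) \<in> S2"
  by (simp add: norm_eq_1 inner_vec_def sum_3)

lemma sphere_cases:
  fixes x :: "real ^ 3"
  assumes "x \<in> S2" "x \<noteq> vector [0, 0, 1]"
  obtains z where "x = inv_stereographic z"
  using assms inv_stereographic_unique[OF assms(1)] north_pole_unique[OF assms(1)]
  by (cases "stereographic x") (auto simp: stereographic_def split: if_splits)

lemma continuous_on_inv_stereographic: "continuous_on A inv_stereographic"
proof -
  have "1 + (norm z)\<^sup>2 \<noteq> 0" for z :: complex using one_plus_norm_sq_pos[of z] by simp
  then have "continuous_on A (\<lambda>z::complex. 2 * Re z / (1 + (norm z)\<^sup>2))"
    "continuous_on A (\<lambda>z::complex. 2 * Im z / (1 + (norm z)\<^sup>2))"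
    "continuous_on A (\<lambda>z::complex. ((norm z)\<^sup>2 - 1) / (1 + (norm z)\<^sup>2))"
    by (auto intro!: continuous_intros)
  moreover have "inv_stereographic z $ 1 = 2 * Re z / (1 + (norm z)\<^sup>2)"
     "inv_stereographic z $ 2 = 2 * Im z / (1 + (norm z)\<^sup>2)"
     "inv_stereographic z $ 3 = ((norm z)\<^sup>2 - 1) / (1 + (norm z)\<^sup>2)" for z
    by (simp_all add: inv_stereographic_def)
  ultimately have "continuous_on A (\<lambda>z. inv_stereographic z $ i)" for i
    using exhaust_3[of i] by auto
  then have "continuous_on A (\<lambda>z. \<chi> i. inv_stereographic z $ i)"
    by (rule continuous_on_vec_lambda)
  then show ?thesis by (simp add: vec_lambda_eta)
qed

lemma pos_kernel_inv_stereographic: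
  assumes "z \<noteq> w"
  shows "pos_kernel (inv_stereographic z) (inv_stereographic w) =
      ennreal ((ln (1 + (norm z)\<^sup>2) + ln (1 + (norm w)\<^sup>2)) / 2 - ln (norm (z - w)))"
    and "0 \<le> (ln (1 + (norm z)\<^sup>2) + ln (1 + (norm w)\<^sup>2)) / 2 - ln (norm (z - w))"
proof -
  have "- ln ((norm (inv_stereographic z - inv_stereographic w))\<^sup>2 / 4) / 2 =
      (ln (1 + (norm z)\<^sup>2) + ln (1 + (norm w)\<^sup>2)) / 2 - ln (norm (z - w))"
    unfolding norm_inv_stereographic_diff
    using assms one_plus_norm_sq_pos[of z] one_plus_norm_sq_pos[of w]
    by (simp add: ln_div ln_mult ln_realpow)
  then show "pos_kernel (inv_stereographic z) (inv_stereographic w) =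
      ennreal ((ln (1 + (norm z)\<^sup>2) + ln (1 + (norm w)\<^sup>2)) / 2 - ln (norm (z - w)))"
    "0 \<le> (ln (1 + (norm z)\<^sup>2) + ln (1 + (norm w)\<^sup>2)) / 2 - ln (norm (z - w))"
    using pos_kernel_eq_ln[OF inv_stereographic_in_sphere[of z] inv_stereographic_in_sphere[of w]] assms by simp_all
qed

subsection \<open>The candidate measure\<close>

lemma has_integral_ln_Icc:
  fixes S :: real
  assumes "0 \<le> S"
  shows "(ln has_integral S * ln S - S) {0..S}"
proof -
  have "(ln has_integral (S * ln S - S) - (0 * ln 0 - 0)) {0..S}"
  proof (rule fundamental_theorem_of_calculus_interior[OF assms])
    show "continuous_on {0..S} (\<lambda>s. s * ln s - s)"
      by (intro continuous_on_diff continuous_on_mult_ln assms continuous_on_id)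
    fix x assume "x \<in> {0<..<S}"
    then have "((\<lambda>s. s * ln s - s) has_real_derivative ln x) (at x)"
      by (auto intro!: derivative_eq_intros)
    then show "((\<lambda>s. s * ln s - s) has_vector_derivative ln x) (at x)"
      by (simp add: has_real_derivative_iff_has_vector_derivative)
  qed
  then show ?thesis by simp
qed

context two_charges
begin

text \<open>In the Lambert equal-area coordinate \<open>w / sqrt (1 + \<bar>w\<bar>\<^sup>2)\<close> the curve \<open>plane_map s\<close> is the ellipse
  \<open>sqrt s * axes \<theta>\<close>, so uniformly distributed \<open>(s, \<theta>)\<close> give the uniform distribution on an ellipse.\<close>

definition axes :: "real \<Rightarrow> complex" where
  "axes \<theta> = Complex ((b + 1 / b) * cos (pi * \<theta>)) ((b - 1 / b) * sin (pi * \<theta>))"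

definition plane_map :: "real \<Rightarrow> real \<Rightarrow> complex" where
  "plane_map s \<theta> = of_real (sqrt s / sqrt (1 - s * (norm (axes \<theta>))\<^sup>2)) * axes \<theta>"

lemma b_axes: "(b + 1 / b)\<^sup>2 = c + 2" "(b - 1 / b)\<^sup>2 = c - 2"
  using b_gt_1 by (simp_all add: c_def p_def q_def power2_eq_square field_simps)

lemma norm_axes: "(norm (axes \<theta>))\<^sup>2 = c + 2 - 4 * (sin (pi * \<theta>))\<^sup>2"
proof -
  have "(norm (axes \<theta>))\<^sup>2 = (c + 2) * (cos (pi * \<theta>))\<^sup>2 + (c - 2) * (sin (pi * \<theta>))\<^sup>2"
    unfolding cmod_power2 axes_def by (simp add: power_mult_distrib b_axes)
  then show ?thesis unfolding cos_squared_eq by (simp add: algebra_simps)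
qed

lemma s_norm_axes_less:
  assumes "0 \<le> s" "s < s_crit" shows "s * (norm (axes \<theta>))\<^sup>2 < 1"
proof -
  have "s * (norm (axes \<theta>))\<^sup>2 \<le> s * (c + 2)"
    using assms by (intro mult_left_mono) (auto simp: norm_axes)
  also have "\<dots> < 1" using assms pq(5) by (simp add: s_crit_def field_simps)
  finally show ?thesis .
qed

lemma axes_shift: "axes (\<theta> + 1) = - axes \<theta>"
  by (simp add: axes_def complex_eq_iff distrib_left)

lemma plane_map_shift: "plane_map s (\<theta> + 1) = - plane_map s \<theta>"
  by (simp add: plane_map_def axes_shift)

lemma plane_map_square:
  assumes "0 \<le> s" "s < s_crit"
  shows "(plane_map s \<theta>)\<^sup>2 = of_real (s / (1 - s * (norm (axes \<theta>))\<^sup>2)) * (axes \<theta>)\<^sup>2"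
    and "1 + (norm (plane_map s \<theta>))\<^sup>2 = 1 / (1 - s * (norm (axes \<theta>))\<^sup>2)"
proof -
  note l = s_norm_axes_less[OF assms, of \<theta>]
  have sq: "(sqrt s / sqrt (1 - s * (norm (axes \<theta>))\<^sup>2))\<^sup>2 = s / (1 - s * (norm (axes \<theta>))\<^sup>2)"
    using l assms by (simp add: power_divide)
  show "(plane_map s \<theta>)\<^sup>2 = of_real (s / (1 - s * (norm (axes \<theta>))\<^sup>2)) * (axes \<theta>)\<^sup>2"
    unfolding plane_map_def power_mult_distrib of_real_power[symmetric] sq ..
  have "(norm (plane_map s \<theta>))\<^sup>2 = s / (1 - s * (norm (axes \<theta>))\<^sup>2) * (norm (axes \<theta>))\<^sup>2"
    unfolding plane_map_def norm_mult norm_of_real power_mult_distrib power2_abs sq ..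
  then show "1 + (norm (plane_map s \<theta>))\<^sup>2 = 1 / (1 - s * (norm (axes \<theta>))\<^sup>2)"
    using l by (simp add: field_simps)
qed

text \<open>With \<open>E = cis (pi * \<theta>)\<close> one has \<open>\<xi> = E\<^sup>2\<close> and
  the Joukowsky form \<open>axes \<theta> = b * E + cnj E / b\<close>. One factor
  \<open>\<xi>\<close> clears the negative powers and leaves quadratics in
  \<open>\<xi>\<close>.\<close>

lemma axes_circle:
  fixes \<theta> :: real
  defines "\<xi> \<equiv> exp (2 * of_real pi * \<i> * of_real \<theta>)"
  shows "\<xi> * (axes \<theta>)\<^sup>2 = of_real p * \<xi>\<^sup>2 + 2 * \<xi> + of_real q"
    and "\<xi> * of_real ((norm (axes \<theta>))\<^sup>2) = \<xi>\<^sup>2 + of_real c * \<xi> + 1"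
    and "\<xi> \<noteq> 0" "norm \<xi> = 1"
proof -
  define E where "E = cis (pi * \<theta>)"
  define B B' where "B = complex_of_real b" and "B' = complex_of_real (1 / b)"
  have EE: "E * cnj E = 1" unfolding E_def by (simp add: complex_norm_square[symmetric])
  have xi: "\<xi> = E\<^sup>2" unfolding \<xi>_def E_def cis_conv_exp exp_double[symmetric] by (simp add: mult_ac)
  have BB: "B * B' = 1" using b_gt_1 by (simp add: B_def B'_def)
  have ax: "axes \<theta> = B * E + B' * cnj E"
    unfolding axes_def E_def B_def B'_def by (simp add: complex_eq_iff algebra_simps)
  have P: "complex_of_real p = B\<^sup>2" "complex_of_real q = B'\<^sup>2" "complex_of_real c = B\<^sup>2 + B'\<^sup>2"
    by (simp_all add: p_def q_def c_def B_def B'_def power_divide)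
  show "\<xi> * (axes \<theta>)\<^sup>2 = of_real p * \<xi>\<^sup>2 + 2 * \<xi> + of_real q"
    unfolding xi ax P using EE BB by algebra
  have "complex_of_real ((norm (axes \<theta>))\<^sup>2) = (B * E + B' * cnj E) * (B * cnj E + B' * E)"
    unfolding complex_norm_square ax by (simp add: B_def B'_def)
  then show "\<xi> * of_real ((norm (axes \<theta>))\<^sup>2) = \<xi>\<^sup>2 + of_real c * \<xi> + 1"
    unfolding xi P using EE BB by algebra
  show "\<xi> \<noteq> 0" by (simp add: \<xi>_def)
  show "norm \<xi> = 1" by (simp add: \<xi>_def norm_exp_eq_Re)
qed

text \<open>Opposite points are taken together because
  \<open>(z - w) * (- z - w) = w\<^sup>2 - z\<^sup>2\<close> depends on \<open>\<theta>\<close> only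
  through \<open>\<xi>\<close>: cleared of denominators it is the polynomial of
  \<open>quadratic_factor\<close>, and the denominator cancels against
  \<open>1 + (norm z)\<^sup>2\<close>. At \<open>s = threshold w\<close> a root lies on the circle,
  hence the exclusion.\<close>

lemma kernel_pair:
  fixes \<theta> s :: real and w :: complex
  assumes "0 < s" "s < s_crit" "w \<noteq> 0" "w\<^sup>2 + of_real p \<noteq> 0" "s \<noteq> threshold w"
  defines "\<xi> \<equiv> exp (2 * of_real pi * \<i> * of_real \<theta>)" and "z \<equiv> plane_map s \<theta>"
    and "R \<equiv> ln (1 + (norm w)\<^sup>2) - ln s -
      ln (norm ((w\<^sup>2 + of_real p) * (exp (2 * of_real pi * \<i> * of_real \<theta>) - big_root w s) *
        (exp (2 * of_real pi * \<i> * of_real \<theta>) - small_root w s)))"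
  shows "pos_kernel (inv_stereographic z) (inv_stereographic w) + pos_kernel (inv_stereographic (- z)) (inv_stereographic w) = ennreal R"
    and "0 \<le> R"
proof -
  define N where "N = norm ((w\<^sup>2 + of_real p) * (\<xi> - big_root w s) * (\<xi> - small_root w s))"
  note ax = axes_circle[of \<theta>, folded \<xi>_def]
  have "norm (big_root w s) \<noteq> 1" "norm (small_root w s) \<noteq> 1"
    using root_location[of s w] assms(1-5) by (cases "s < threshold w"; force)+
  then have "\<xi> \<noteq> big_root w s" "\<xi> \<noteq> small_root w s" using ax(4) by auto
  then have N0: "N > 0" using assms(4) by (simp add: N_def)
  define k where "k = 1 - s * (norm (axes \<theta>))\<^sup>2"
  have k: "0 < k" using s_norm_axes_less[of s \<theta>] assms(1,2) by (simp add: k_def)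
  have z2: "z\<^sup>2 = of_real (s / k) * (axes \<theta>)\<^sup>2" "1 + (norm z)\<^sup>2 = 1 / k"
    using plane_map_square[of s \<theta>] assms(1,2) by (simp_all add: z_def k_def)
  have keq: "\<xi> * of_real k = \<xi> - of_real s * (\<xi> * of_real ((norm (axes \<theta>))\<^sup>2))"
    by (simp add: k_def algebra_simps)
  have "\<xi> * of_real k * (w\<^sup>2 - z\<^sup>2) = w\<^sup>2 * (\<xi> * of_real k) - of_real s * (\<xi> * (axes \<theta>)\<^sup>2)"
    unfolding z2(1) using k by (simp add: algebra_simps)
  also have "\<dots> = w\<^sup>2 * (\<xi> - of_real s * (\<xi> * of_real ((norm (axes \<theta>))\<^sup>2))) - of_real s * (\<xi> * (axes \<theta>)\<^sup>2)"
    unfolding keq ..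
  also have "w\<^sup>2 * (\<xi> - of_real s * (\<xi> * of_real ((norm (axes \<theta>))\<^sup>2))) - of_real s * (\<xi> * (axes \<theta>)\<^sup>2) =
     - of_real s * ((w\<^sup>2 + of_real p) * \<xi>\<^sup>2 - (of_real (1 / s - c) * w\<^sup>2 - 2) * \<xi> + (w\<^sup>2 + of_real q))"
    unfolding ax(1,2) using assms(1) by (simp add: field_simps)
  also have "\<dots> = - of_real s * ((w\<^sup>2 + of_real p) * (\<xi> - big_root w s) * (\<xi> - small_root w s))"
    using quadratic_factor[of w s \<xi>] assms(1-4) by simp
  finally have "norm (\<xi> * of_real k * (w\<^sup>2 - z\<^sup>2)) = norm (- of_real s * ((w\<^sup>2 + of_real p) * (\<xi> - big_root w s) * (\<xi> - small_root w s)))"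
    by (rule arg_cong)
  then have kN: "k * norm (w\<^sup>2 - z\<^sup>2) = s * N"
    using k assms(1) ax(4) by (simp only: norm_mult N_def norm_minus_cancel) simp
  have wz: "w\<^sup>2 - z\<^sup>2 = (z - w) * (- z - w)" by (simp add: power2_eq_square algebra_simps)
  have ne: "z \<noteq> w" "- z \<noteq> w" using kN N0 assms(1) k by (auto simp: wz)
  have "ln k + (ln (norm (z - w)) + ln (norm (- z - w))) = ln (k * norm (w\<^sup>2 - z\<^sup>2))"
    unfolding wz norm_mult using k ne by (simp add: ln_mult)
  also have "\<dots> = ln s + ln N" unfolding kN using assms(1) N0 by (simp add: ln_mult)
  finally have lnk: "ln (norm (z - w)) + ln (norm (- z - w)) = ln s + ln N - ln k" by simp
  have lnz: "ln (1 + (norm z)\<^sup>2) = - ln k" unfolding z2(2) using k by (simp add: ln_div)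
  note K = pos_kernel_inv_stereographic[OF ne(1)] pos_kernel_inv_stereographic[OF ne(2)]
  have sum: "((ln (1 + (norm z)\<^sup>2) + ln (1 + (norm w)\<^sup>2)) / 2 - ln (norm (z - w))) +
     ((ln (1 + (norm (- z))\<^sup>2) + ln (1 + (norm w)\<^sup>2)) / 2 - ln (norm (- z - w))) = ln (1 + (norm w)\<^sup>2) - ln s - ln N"
    using lnk lnz by simp
  show "pos_kernel (inv_stereographic z) (inv_stereographic w) + pos_kernel (inv_stereographic (- z)) (inv_stereographic w) = ennreal R"
    unfolding K(1,3) R_def \<xi>_def[symmetric] N_def[symmetric] sum[symmetric] by (rule ennreal_plus[OF K(2,4), symmetric])
  show "0 \<le> R" unfolding R_def \<xi>_def[symmetric] N_def[symmetric] sum[symmetric] by (rule add_nonneg_nonneg[OF K(2,4)])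
qed

section \<open>The ellipses fill the region below the critical parameter\<close>

lemma threshold_plane_map:
  assumes "0 \<le> s" "s < s_crit"
  shows "threshold (plane_map s \<theta>) = s"
proof -
  define k where "k = 1 - s * (norm (axes \<theta>))\<^sup>2"
  have k: "0 < k" using s_norm_axes_less[of s \<theta>] assms by (simp add: k_def)
  define h where "h = sqrt s / sqrt k"
  define m where "m = s / k"
  have h2: "h\<^sup>2 = m" unfolding h_def m_def using assms k by (simp add: power_divide)
  have ReIm: "Re (plane_map s \<theta>) = h * ((b + 1 / b) * cos (pi * \<theta>))" "Im (plane_map s \<theta>) = h * ((b - 1 / b) * sin (pi * \<theta>))"
    by (simp_all add: plane_map_def axes_def h_def k_def)
  have "d\<^sup>2 * (1 + (norm (plane_map s \<theta>))\<^sup>2) * threshold (plane_map s \<theta>) =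
      m * ((c - 2) * (c + 2)) * ((cos (pi * \<theta>))\<^sup>2 + (sin (pi * \<theta>))\<^sup>2)"
    unfolding threshold_eq ReIm power_mult_distrib b_axes h2 by algebra
  also have "\<dots> = d\<^sup>2 * (1 + (norm (plane_map s \<theta>))\<^sup>2) * s"
    using plane_map_square(2)[OF assms, of \<theta>] by (simp add: pq(7) k_def m_def)
  finally show ?thesis
    using pq(6) one_plus_norm_sq_pos[of "plane_map s \<theta>"] by simp
qed

lemma plane_map_surj:
  assumes "threshold w < s_crit"
  obtains \<theta> where "\<theta> \<in> {0..2}" "w = plane_map (threshold w) \<theta>"
proof (cases "w = 0")
  case True
  then show thesis using that[of 0] by (simp add: plane_map_def threshold_def)
next
  case False
  define s where "s = threshold w"
  have s: "0 < s" "s < s_crit" using threshold_pos[OF False] assms by (simp_all add: s_def)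
  \<comment> \<open>In the Lambert coordinate the scale of the ellipse is \<open>sqrt s\<close>, and
    \<open>w\<close> is its coordinate times \<open>sqrt (1 + (norm w)\<^sup>2)\<close>.\<close>
  define k where "k = sqrt (s * (1 + (norm w)\<^sup>2))"
  have k2: "k\<^sup>2 = s * (1 + (norm w)\<^sup>2)" unfolding k_def using s one_plus_norm_sq_pos[of w] by simp
  have k: "0 < k" unfolding k_def using s one_plus_norm_sq_pos[of w] by simp
  have bb: "b + 1 / b \<noteq> 0" "b - 1 / b \<noteq> 0"
    using b_axes pq(5) by (metis less_numeral_extra(3) pos_add_strict zero_less_numeral zero_power2 add_pos_pos order_less_trans, auto)
  have "(Re w / (k * (b + 1 / b)))\<^sup>2 + (Im w / (k * (b - 1 / b)))\<^sup>2
     = ((c - 2) * (Re w)\<^sup>2 + (c + 2) * (Im w)\<^sup>2) / (k\<^sup>2 * ((c - 2) * (c + 2)))"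
  proof -
    have "X / (K * v) + Y / (K * u) = (u * X + v * Y) / (K * (u * v))"
      if "K \<noteq> 0" "u \<noteq> 0" "v \<noteq> 0" for X Y K u v :: real
      using that by (simp add: divide_simps)
    then show ?thesis unfolding power_divide power_mult_distrib b_axes using k pq(5) by simp
  qed
  also have "(c - 2) * (Re w)\<^sup>2 + (c + 2) * (Im w)\<^sup>2 = k\<^sup>2 * ((c - 2) * (c + 2))"
    unfolding threshold_eq[symmetric] k2 pq(7) by (simp add: s_def mult_ac)
  finally have "(Re w / (k * (b + 1 / b)))\<^sup>2 + (Im w / (k * (b - 1 / b)))\<^sup>2 = 1" using k pq(5) by simp
  then obtain t where t: "0 \<le> t" "t < 2 * pi" "Re w / (k * (b + 1 / b)) = cos t" "Im w / (k * (b - 1 / b)) = sin t"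
    by (rule sincos_total_2pi)
  define \<theta> where "\<theta> = t / pi"
  have \<theta>: "\<theta> \<in> {0..2}" using t(1,2) by (simp add: \<theta>_def field_simps)
  have pt: "pi * \<theta> = t" by (simp add: \<theta>_def)
  have "Re w = k * ((b + 1 / b) * cos t)" "Im w = k * ((b - 1 / b) * sin t)"
  proof -
    have "X = k * (g * v)" if "X / (k * g) = v" "g \<noteq> 0" for X g v :: real
      using that k by auto
    then show "Re w = k * ((b + 1 / b) * cos t)" "Im w = k * ((b - 1 / b) * sin t)"
      using t(3,4) bb by blast+
  qed
  then have wk: "w = of_real k * axes \<theta>" by (simp add: axes_def complex_eq_iff pt)
  then have "(norm w)\<^sup>2 = s * (1 + (norm w)\<^sup>2) * (norm (axes \<theta>))\<^sup>2"
    unfolding k2[symmetric] by (metis abs_of_pos k norm_mult norm_of_real power_mult_distrib)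
  then have "(1 + (norm w)\<^sup>2) * (1 - s * (norm (axes \<theta>))\<^sup>2) = 1" by (simp add: algebra_simps)
  then have "1 + (norm w)\<^sup>2 = 1 / (1 - s * (norm (axes \<theta>))\<^sup>2)"
    by (metis nonzero_eq_divide_eq mult_zero_right zero_neq_one)
  then have "k = sqrt s / sqrt (1 - s * (norm (axes \<theta>))\<^sup>2)" unfolding k_def by (simp add: real_sqrt_divide)
  then have "w = plane_map s \<theta>" using wk by (simp add: plane_map_def)
  with \<theta> show thesis using that by (simp add: s_def)
qed

end

section \<open>The potential of the droplet measure\<close>

locale droplet = two_charges +
  fixes s0 :: real
  assumes s0: "0 < s0" "s0 < s_crit"
begin

definition param_map :: "real \<times> real \<Rightarrow> real ^ 3" where
  "param_map = (\<lambda>(s, \<theta>). inv_stereographic (plane_map s \<theta>))"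

text \<open>The angle runs over \<open>{0..2}\<close> because \<open>axes\<close> turns by
  \<open>pi * \<theta>\<close>; adding \<open>1\<close> to \<open>\<theta>\<close> gives the
  opposite point, which is what the pairing uses.\<close>

definition param_measure :: "(real \<times> real) measure" where
  "param_measure = uniform_measure lborel {0..s0} \<Otimes>\<^sub>M uniform_measure lborel {0..2}"

definition droplet_measure :: "(real ^ 3) measure" where
  "droplet_measure = distr param_measure (restrict_space borel S2) param_map"

lemma prob_space_uniform:
  "prob_space (uniform_measure lborel {0..s0})" "prob_space (uniform_measure lborel {0..2::real})"
  using s0 by (auto intro!: prob_space_uniform_measure)

lemma prob_space_param: "prob_space param_measure"
proof -
  interpret S: prob_space "uniform_measure lborel {0..s0}" by (rule prob_space_uniform)
  interpret A: prob_space "uniform_measure lborel {0..2::real}" by (rule prob_space_uniform)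
  interpret pair_prob_space "uniform_measure lborel {0..s0}" "uniform_measure lborel {0..2::real}" ..
  show ?thesis unfolding param_measure_def by unfold_locales
qed

lemma sets_param_measure [measurable_cong]: "sets param_measure = sets (borel \<Otimes>\<^sub>M borel)"
  unfolding param_measure_def by (intro sets_pair_measure_cong) auto

lemma borel_measurable_param_map [measurable]: "param_map \<in> borel_measurable (borel \<Otimes>\<^sub>M borel)"
proof -
  have "continuous_on UNIV axes" unfolding axes_def Complex_eq by (intro continuous_intros)
  then have [measurable]: "axes \<in> borel_measurable borel" by (rule borel_measurable_continuous_onI)
  have [measurable]: "inv_stereographic \<in> borel_measurable borel"
    by (rule borel_measurable_continuous_onI[OF continuous_on_inv_stereographic])
  show ?thesis unfolding param_map_def plane_map_def by measurable
qed

lemma param_map_in_sphere: "param_map x \<in> S2"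
  by (simp only: param_map_def case_prod_beta inv_stereographic_in_sphere)

lemma measurable_param_map: "param_map \<in> param_measure \<rightarrow>\<^sub>M restrict_space borel S2"
  by (rule measurable_restrict_space2) (use param_map_in_sphere in \<open>auto simp del: mem_sphere_0\<close>)

lemma droplet_measure_in: "droplet_measure \<in> sphere_prob_measures"
  unfolding sphere_prob_measures_def droplet_measure_def
  using prob_space.prob_space_distr[OF prob_space_param measurable_param_map] by simp

lemma nn_integral_halves:
  fixes f :: "real \<Rightarrow> ennreal"
  assumes [measurable]: "f \<in> borel_measurable borel"
  shows "(\<integral>\<^sup>+x. f x * indicator {0..2} x \<partial>lborel) = (\<integral>\<^sup>+x. (f x + f (x + 1)) * indicator {0..1} x \<partial>lborel)"
proof -
  have "(\<integral>\<^sup>+x. f x * indicator {0..2} x \<partial>lborel) =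
      (\<integral>\<^sup>+x. f x * indicator {0..1} x + f x * indicator {1..2} x \<partial>lborel)"
  proof (rule nn_integral_cong_AE)
    have "AE x in lborel. x \<noteq> (1::real)" by (rule AE_lborel_singleton)
    then show "AE x in lborel. f x * indicator {0..2} x = f x * indicator {0..1} x + f x * indicator {1..2} x"
      by eventually_elim (auto simp: indicator_def)
  qed
  also have "\<dots> = (\<integral>\<^sup>+x. f x * indicator {0..1} x \<partial>lborel) + (\<integral>\<^sup>+x. f x * indicator {1..2} x \<partial>lborel)"
    by (rule nn_integral_add) auto
  also have "(\<integral>\<^sup>+x. f x * indicator {1..2} x \<partial>lborel) = (\<integral>\<^sup>+x. f (x + 1) * indicator {0..1} x \<partial>lborel)"
    by (subst nn_integral_real_affine[of _ 1 1])
      (auto simp: add.commute indicator_def intro!: nn_integral_cong)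
  finally show ?thesis by (simp add: nn_integral_add distrib_right)
qed

text \<open>Jensen's formula for the paired kernel: the smaller root is inside the disc and
  contributes nothing. The factor \<open>1 / 2\<close> is the density of the angle on
  \<open>{0..2}\<close>.\<close>

lemma angular_mean:
  assumes "0 < s" "s < s_crit" "w \<noteq> 0" "w\<^sup>2 + of_real p \<noteq> 0" "s \<noteq> threshold w"
  defines "g \<equiv> ln (1 + (norm w)\<^sup>2) - ln s - ln (norm (w\<^sup>2 + of_real p)) - max 0 (ln (norm (big_root w s)))"
  shows "(\<integral>\<^sup>+\<theta>. pos_kernel (param_map (s, \<theta>)) (inv_stereographic w) \<partial>uniform_measure lborel {0..2}) = ennreal (g / 2)"
    and "0 \<le> g"
proof -
  define f where "f \<theta> = pos_kernel (param_map (s, \<theta>)) (inv_stereographic w)" for \<theta>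
  have f[measurable]: "f \<in> borel_measurable borel"
  proof -
    have "(\<lambda>\<theta>. param_map (s, \<theta>)) \<in> borel_measurable borel" by measurable
    from measurable_compose[OF this borel_measurable_potential(2)[OF droplet_measure_in]]
    show ?thesis unfolding f_def[abs_def] .
  qed
  define R where "R \<theta> = ln (1 + (norm w)\<^sup>2) - ln s -
      ln (norm ((w\<^sup>2 + of_real p) * (exp (2 * of_real pi * \<i> * of_real \<theta>) - big_root w s) *
        (exp (2 * of_real pi * \<i> * of_real \<theta>) - small_root w s)))" for \<theta>
  have pair: "f \<theta> + f (\<theta> + 1) = ennreal (R \<theta>)" "0 \<le> R \<theta>" for \<theta>
    using kernel_pair[OF assms(1-5), of \<theta>]
    unfolding f_def R_def param_map_def by (simp_all add: plane_map_shift)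
  have r: "norm (big_root w s) \<noteq> 1" "norm (small_root w s) < 1"
    using root_location(1,2)[OF assms(1) less_imp_le[OF assms(2)] assms(3,4)] assms(5)
    by (cases rule: linorder_cases[of s "threshold w"]; simp)+
  have I: "(R has_integral g) {0..1}"
  proof -
    have "max 0 (ln (norm (small_root w s))) = 0"
      using r(2) by (cases "small_root w s = 0") auto
    then have "((\<lambda>\<theta>. ln (norm ((w\<^sup>2 + of_real p) * (exp (2 * of_real pi * \<i> * of_real \<theta>) - big_root w s) *
        (exp (2 * of_real pi * \<i> * of_real \<theta>) - small_root w s)))) has_integral
        ln (norm (w\<^sup>2 + of_real p)) + max 0 (ln (norm (big_root w s)))) {0..1}"
      using has_integral_ln_norm_quadratic_circle[OF assms(4) r(1), of "small_root w s"] r(2) by simp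
    from has_integral_diff[OF has_integral_const_real[of "ln (1 + (norm w)\<^sup>2) - ln s" 0 1] this]
    show ?thesis unfolding R_def[abs_def] g_def by (simp add: algebra_simps)
  qed
  show "0 \<le> g" by (rule has_integral_nonneg[OF I]) (use pair in auto)
  have "(\<integral>\<^sup>+\<theta>. f \<theta> \<partial>uniform_measure lborel {0..2}) = (\<integral>\<^sup>+\<theta>. f \<theta> * indicator {0..2} \<theta> \<partial>lborel) / 2"
    by (subst nn_integral_uniform_measure) auto
  also have "(\<integral>\<^sup>+\<theta>. f \<theta> * indicator {0..2} \<theta> \<partial>lborel) = (\<integral>\<^sup>+\<theta>. ennreal (R \<theta>) * indicator {0..1} \<theta> \<partial>lborel)"
    unfolding nn_integral_halves[OF f] pair ..
  also have "\<dots> = ennreal g" by (rule nn_integral_has_integral_lebesgue'[OF pair(2) I])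
  also have "ennreal g / 2 = ennreal (g / 2)"
    using \<open>0 \<le> g\<close> by (simp add: divide_ennreal[symmetric])
  finally show "(\<integral>\<^sup>+\<theta>. pos_kernel (param_map (s, \<theta>)) (inv_stereographic w) \<partial>uniform_measure lborel {0..2}) = ennreal (g / 2)"
    unfolding f_def .
qed

text \<open>The average of \<open>angular_mean\<close> over \<open>s\<close>; the terms
  \<open>1 - ln s0\<close> are the mean of \<open>- ln s\<close> on \<open>{0..s0}\<close>.\<close>

lemma droplet_potential:
  assumes "w \<noteq> 0" "w\<^sup>2 + of_real p \<noteq> 0"
    and L: "((\<lambda>s. max 0 (ln (norm (big_root w s)))) has_integral L) {0..s0}"
  defines "U \<equiv> (ln (1 + (norm w)\<^sup>2) - ln (norm (w\<^sup>2 + of_real p)) + 1 - ln s0 - L / s0) / 2"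
  shows "(\<integral>\<^sup>+x. pos_kernel x (inv_stereographic w) \<partial>droplet_measure) = ennreal U" and "0 \<le> U"
proof -
  interpret A: prob_space "uniform_measure lborel {0..2::real}" by (rule prob_space_uniform)
  define G where "G s = (\<integral>\<^sup>+\<theta>. pos_kernel (param_map (s, \<theta>)) (inv_stereographic w) \<partial>uniform_measure lborel {0..2})" for s
  have k: "(\<lambda>x. pos_kernel x (inv_stereographic w)) \<in> borel_measurable borel"
    by (rule borel_measurable_potential(2)[OF droplet_measure_in])
  have k2: "(\<lambda>x. pos_kernel (param_map x) (inv_stereographic w)) \<in> borel_measurable (borel \<Otimes>\<^sub>M borel)"
    by (rule measurable_compose[OF borel_measurable_param_map k])
  have k3: "(\<lambda>x. pos_kernel (param_map x) (inv_stereographic w)) \<in> borel_measurable (borel \<Otimes>\<^sub>M uniform_measure lborel {0..2})"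
    by (subst measurable_cong_sets[OF sets_pair_measure_cong[OF refl] refl, of _ borel]) (auto intro: k2)
  have G[measurable]: "G \<in> borel_measurable borel"
    unfolding G_def[abs_def] by (rule A.borel_measurable_nn_integral) (use k3 in \<open>simp add: case_prod_beta'\<close>)
  define g where "g s = (ln (1 + (norm w)\<^sup>2) - ln s - ln (norm (w\<^sup>2 + of_real p)) - max 0 (ln (norm (big_root w s)))) / 2" for s
  have Gg: "G s = ennreal (g s)" "0 \<le> g s" if "s \<in> {0..s0} - {0, threshold w}" for s
    unfolding G_def g_def using angular_mean[of s w] that s0 assms(1,2) by auto
  have "(g has_integral U * s0) {0..s0}"
  proof -
    have "((\<lambda>s. (ln (1 + (norm w)\<^sup>2) - ln (norm (w\<^sup>2 + of_real p)) - ln s - max 0 (ln (norm (big_root w s)))) / 2) has_integral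
      ((s0 * (ln (1 + (norm w)\<^sup>2) - ln (norm (w\<^sup>2 + of_real p))) - (s0 * ln s0 - s0) - L)) / 2) {0..s0}"
      using has_integral_const_real[of "ln (1 + (norm w)\<^sup>2) - ln (norm (w\<^sup>2 + of_real p))" 0 s0] s0
      by (intro has_integral_divide has_integral_diff L has_integral_ln_Icc) auto
    moreover have "(s0 * (ln (1 + (norm w)\<^sup>2) - ln (norm (w\<^sup>2 + of_real p))) - (s0 * ln s0 - s0) - L) / 2 = U * s0"
      unfolding U_def using s0 by (simp add: field_simps)
    ultimately show ?thesis unfolding g_def[abs_def] by (simp add: algebra_simps)
  qed
  \<comment> \<open>\<open>angular_mean\<close> does not cover \<open>s = 0\<close> and
    \<open>s = threshold w\<close>, so the integral is computed for \<open>enn2real (G s)\<close>,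
    which may differ from \<open>g\<close> at these two points.\<close>
  then have I: "((\<lambda>s. enn2real (G s)) has_integral U * s0) {0..s0}"
    by (rule has_integral_spike_finite[of "{0, threshold w}", rotated 2]) (use Gg in auto)
  have "0 \<le> U * s0" by (rule has_integral_nonneg[OF I]) simp
  then show "0 \<le> U" using s0 by (simp add: zero_le_mult_iff)
  have "(\<integral>\<^sup>+x. pos_kernel x (inv_stereographic w) \<partial>droplet_measure) =
      (\<integral>\<^sup>+x. pos_kernel (param_map x) (inv_stereographic w) \<partial>param_measure)"
    unfolding droplet_measure_def
    by (rule nn_integral_distr[OF measurable_param_map]) (simp add: measurable_restrict_space1[OF k])
  also have "\<dots> = (\<integral>\<^sup>+s. G s \<partial>uniform_measure lborel {0..s0})"
    unfolding param_measure_def G_def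
    by (rule A.nn_integral_fst[symmetric])
      (use k2 sets_param_measure in \<open>simp add: param_measure_def cong: measurable_cong_sets\<close>)
  also have "\<dots> = (\<integral>\<^sup>+s. G s * indicator {0..s0} s \<partial>lborel) / ennreal s0"
    using s0 by (subst nn_integral_uniform_measure) auto
  also have "(\<integral>\<^sup>+s. G s * indicator {0..s0} s \<partial>lborel) = (\<integral>\<^sup>+s. ennreal (enn2real (G s)) * indicator {0..s0} s \<partial>lborel)"
  proof (rule nn_integral_cong_AE)
    have "AE s in lborel. s \<noteq> (0::real)" "AE s in lborel. s \<noteq> threshold w" by (rule AE_lborel_singleton)+
    then show "AE s in lborel. G s * indicator {0..s0} s = ennreal (enn2real (G s)) * indicator {0..s0} s"
      by eventually_elim (use Gg in \<open>auto simp: indicator_def\<close>)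
  qed
  also have "\<dots> = ennreal (U * s0)" by (rule nn_integral_has_integral_lebesgue'[OF _ I]) auto
  also have "ennreal (U * s0) / ennreal s0 = ennreal U"
    using s0 \<open>0 \<le> U\<close> by (simp add: divide_ennreal)
  finally show "(\<integral>\<^sup>+x. pos_kernel x (inv_stereographic w) \<partial>droplet_measure) = ennreal U" .
qed

end

section \<open>The support of the droplet measure\<close>

lemma emeasure_uniform_Icc_ball:
  fixes l s r :: real
  assumes "0 < l" "s \<in> {0..l}" "0 < r"
  shows "0 < emeasure (uniform_measure lborel {0..l}) ({0..l} \<inter> ball s r)"
proof -
  define u v where "u = max 0 (s - r / 2)" and "v = min l (s + r / 2)"
  have uv: "u < v" using assms by (auto simp: u_def v_def)
  have sub: "{u..v} \<subseteq> {0..l} \<inter> ball s r" using assms by (auto simp: u_def v_def dist_real_def)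
  have "0 < emeasure lborel {u..v}" using uv by simp
  also have "\<dots> \<le> emeasure lborel ({0..l} \<inter> ({0..l} \<inter> ball s r))"
    by (rule emeasure_mono) (use sub in auto)
  finally show ?thesis
    using assms(1) by (simp add: emeasure_uniform_measure ennreal_zero_less_divide)
qed

context droplet
begin

lemma AE_param: "AE x in param_measure. x \<in> {0<..s0} \<times> {0..2}"
proof -
  interpret S: prob_space "uniform_measure lborel {0..s0}" by (rule prob_space_uniform)
  interpret A: prob_space "uniform_measure lborel {0..2::real}" by (rule prob_space_uniform)
  interpret SA: pair_prob_space "uniform_measure lborel {0..s0}" "uniform_measure lborel {0..2::real}" ..
  have "AE s in uniform_measure lborel {0..s0}. s \<in> {0<..s0}"
  proof (rule AE_uniform_measureI)
    have "AE s in lborel. s \<noteq> (0::real)" by (rule AE_lborel_singleton)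
    then show "AE s in lborel. s \<in> {0..s0} \<longrightarrow> s \<in> {0<..s0}" by eventually_elim auto
  qed auto
  then have "AE s in uniform_measure lborel {0..s0}. AE \<theta> in uniform_measure lborel {0..2::real}. (s, \<theta>) \<in> {0<..s0} \<times> {0..2}"
  proof eventually_elim
    case (elim s)
    have "AE \<theta> in uniform_measure lborel {0..2::real}. \<theta> \<in> {0..2}"
      by (rule AE_uniform_measureI) auto
    then show ?case by eventually_elim (use elim in auto)
  qed
  then show ?thesis unfolding param_measure_def
    by (intro SA.AE_pair_measure) (simp_all add: space_pair_measure pair_measureI)
qed

lemma continuous_on_param_map: "continuous_on ({0..s0} \<times> {0..2}) param_map"
proof -
  have ax: "continuous_on UNIV axes" unfolding axes_def Complex_eq by (intro continuous_intros)
  have ax2: "continuous_on A (\<lambda>x. axes (snd x))" for A :: "(real \<times> real) set"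
    by (intro continuous_on_compose2[OF ax] continuous_intros) auto
  have "sqrt (1 - fst x * (norm (axes (snd x)))\<^sup>2) \<noteq> 0" if "x \<in> {0..s0} \<times> {0..2}" for x
    using s_norm_axes_less[of "fst x" "snd x"] s0 that by auto
  then have "continuous_on ({0..s0} \<times> {0..2}) (\<lambda>x. plane_map (fst x) (snd x))"
    unfolding plane_map_def by (intro continuous_intros ax2) auto
  from continuous_on_compose2[OF continuous_on_inv_stereographic[of UNIV] this]
  show ?thesis by (simp add: param_map_def case_prod_beta')
qed

lemma param_map_image: "param_map ` ({0..s0} \<times> {0..2}) = inv_stereographic ` {w. threshold w \<le> s0}"
proof (intro equalityI subsetI)
  fix x assume "x \<in> param_map ` ({0..s0} \<times> {0..2})"
  then obtain s \<theta> where "s \<in> {0..s0}" "x = inv_stereographic (plane_map s \<theta>)"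
    by (auto simp: param_map_def)
  then show "x \<in> inv_stereographic ` {w. threshold w \<le> s0}"
    using threshold_plane_map[of s \<theta>] s0 by auto
next
  fix x assume "x \<in> inv_stereographic ` {w. threshold w \<le> s0}"
  then obtain w where w: "threshold w \<le> s0" "x = inv_stereographic w" by auto
  then obtain \<theta> where "\<theta> \<in> {0..2}" "w = plane_map (threshold w) \<theta>"
    using plane_map_surj[of w] s0 by force
  then have "x = param_map (threshold w, \<theta>)" "(threshold w, \<theta>) \<in> {0..s0} \<times> {0..2}"
    using w threshold_nonneg[of w] by (simp_all add: param_map_def)
  then show "x \<in> param_map ` ({0..s0} \<times> {0..2})" by blast
qed

text \<open>All mass lies on the compact image of the parameter rectangle. Conversely, by continuity
  on the rectangle, a neighbourhood of an image point pulls back to a relatively open set, which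
  contains a box of positive measure.\<close>

lemma measure_support_droplet:
  "measure_support droplet_measure = inv_stereographic ` {w. threshold w \<le> s0}" (is "_ = ?K")
proof -
  have sp: "space droplet_measure = S2" by (simp add: droplet_measure_def)
  have em: "emeasure droplet_measure (U \<inter> S2) = emeasure param_measure (param_map -` U \<inter> space param_measure)"
    if "open U" for U
  proof -
    have "U \<inter> S2 \<in> sets (restrict_space borel S2)"
      using that by (auto simp: sets_restrict_space Int_commute)
    then have "emeasure droplet_measure (U \<inter> S2) = emeasure param_measure (param_map -` (U \<inter> S2) \<inter> space param_measure)"
      unfolding droplet_measure_def by (rule emeasure_distr[OF measurable_param_map])
    also have "param_map -` (U \<inter> S2) = param_map -` U" using param_map_in_sphere by blast
    finally show ?thesis .
  qed
  have "compact ?K"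
    unfolding param_map_image[symmetric]
    by (intro compact_continuous_image continuous_on_param_map compact_Times compact_Icc)
  show ?thesis
  proof (intro equalityI subsetI)
    fix x assume x: "x \<in> measure_support droplet_measure"
    show "x \<in> ?K"
    proof (rule ccontr)
      assume "x \<notin> ?K"
      have op: "open (- ?K)" using \<open>compact ?K\<close> by (simp add: compact_imp_closed open_Compl)
      then have pos: "emeasure droplet_measure (- ?K \<inter> S2) > 0"
        using x \<open>x \<notin> ?K\<close> unfolding measure_support_def sp by blast
      have "AE y in param_measure. y \<notin> param_map -` (- ?K)"
        using AE_param
      proof eventually_elim
        case (elim y)
        then have "y \<in> {0..s0} \<times> {0..2}" by auto
        then show ?case unfolding param_map_image[symmetric] by blast
      qed
      moreover have "param_map -` (- ?K) \<inter> space param_measure \<in> sets param_measure"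
        using measurable_sets[OF _ borel_open[OF op], of param_map param_measure] by simp
      ultimately have "emeasure param_measure (param_map -` (- ?K) \<inter> space param_measure) = 0"
        by (subst emeasure_eq_0_AE[symmetric]) (auto simp: Int_def conj_commute elim!: AE_mp intro!: emeasure_eq_0_AE)
      then show False using pos em[OF op] by simp
    qed
  next
    fix x assume "x \<in> ?K"
    then obtain s \<theta> where st: "s \<in> {0..s0}" "\<theta> \<in> {0..2}" and x: "x = param_map (s, \<theta>)"
      unfolding param_map_image[symmetric] by auto
    show "x \<in> measure_support droplet_measure"
      unfolding measure_support_def sp
    proof (intro CollectI conjI allI impI)
      show "x \<in> S2" unfolding x by (rule param_map_in_sphere)
      fix U assume U: "open U" "x \<in> U"
      obtain V where V: "open V" "V \<inter> ({0..s0} \<times> {0..2}) = param_map -` U \<inter> ({0..s0} \<times> {0..2})"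
        using continuous_on_param_map U(1) unfolding continuous_on_open_invariant by blast
      have "(s, \<theta>) \<in> V" using V(2) st U(2) x by blast
      then obtain A B where AB: "open A" "open B" "(s, \<theta>) \<in> A \<times> B" "A \<times> B \<subseteq> V"
        by (rule open_prod_elim[OF V(1)])
      then have "s \<in> A" "\<theta> \<in> B" by auto
      obtain r1 r2 where r: "0 < r1" "ball s r1 \<subseteq> A" "0 < r2" "ball \<theta> r2 \<subseteq> B"
        using AB(1,2) \<open>s \<in> A\<close> \<open>\<theta> \<in> B\<close> by (meson openE)
      interpret A: prob_space "uniform_measure lborel {0..2::real}" by (rule prob_space_uniform)
      define R where "R = ({0..s0} \<inter> ball s r1) \<times> ({0..2} \<inter> ball \<theta> r2)"
      have "emeasure param_measure R = emeasure (uniform_measure lborel {0..s0}) ({0..s0} \<inter> ball s r1) *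
          emeasure (uniform_measure lborel {0..2}) ({0..2} \<inter> ball \<theta> r2)"
        unfolding param_measure_def R_def by (rule A.emeasure_pair_measure_Times) auto
      then have "0 < emeasure param_measure R"
        using emeasure_uniform_Icc_ball[OF s0(1) st(1) r(1)] emeasure_uniform_Icc_ball[of 2, OF _ st(2) r(3)]
        by (simp add: ennreal_zero_less_mult_iff)
      also have "\<dots> \<le> emeasure param_measure (param_map -` U \<inter> space param_measure)"
      proof (rule emeasure_mono)
        have "R \<subseteq> V \<inter> ({0..s0} \<times> {0..2})" using r AB by (auto simp: R_def)
        then show "R \<subseteq> param_map -` U \<inter> space param_measure"
          unfolding V(2) by (auto simp: param_measure_def space_pair_measure)
        show "param_map -` U \<inter> space param_measure \<in> sets param_measure"
          using measurable_sets[OF _ borel_open[OF U(1)], of param_map param_measure] by simp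
      qed
      finally show "0 < emeasure droplet_measure (U \<inter> S2)" unfolding em[OF U(1)] .
    qed
  qed
qed

text \<open>Keeps the charges off the droplet, so that the formulas containing
  \<open>ln (norm (w\<^sup>2 + of_real p))\<close> apply on it.\<close>

lemma threshold_charge:
  assumes "w\<^sup>2 + of_real p = 0" shows "s_crit < threshold w"
proof -
  have "w\<^sup>2 = of_real (- p)" using assms by (simp add: eq_neg_iff_add_eq_0)
  then have "(Re w)\<^sup>2 - (Im w)\<^sup>2 = - p" "Re w = 0 \<or> Im w = 0"
    by (auto simp: complex_eq_iff power2_eq_square)
  moreover have "(Re w)\<^sup>2 \<noteq> - p" using pq(2) zero_le_power2[of "Re w"] by linarith
  ultimately have "Re w = 0" "(Im w)\<^sup>2 = p" by auto
  then have e: "d\<^sup>2 * (1 + p) * threshold w = (c + 2) * p" using threshold_eq[of w] by (simp add: cmod_power2)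
  have "(c - 2) * (1 + p) < (c + 2) * p"
    using pq by (simp add: c_def algebra_simps)
  moreover have "d\<^sup>2 * (1 + p) * s_crit = (c - 2) * (1 + p)"
    unfolding pq(7) s_crit_def using pq(5) by simp
  ultimately have "d\<^sup>2 * (1 + p) * s_crit < d\<^sup>2 * (1 + p) * threshold w" by (simp only: e)
  then show ?thesis by (rule mult_left_less_imp_less) (use pq in auto)
qed

lemma charge_potential:
  assumes "w\<^sup>2 + of_real p \<noteq> 0"
  defines "P \<equiv> ln (1 + (norm w)\<^sup>2) + ln (1 + p) - ln (norm (w\<^sup>2 + of_real p))"
  shows "pos_kernel (inv_stereographic w) (inv_stereographic (\<i> * of_real b)) +
      pos_kernel (inv_stereographic w) (inv_stereographic (- \<i> * of_real b)) = ennreal P"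
    and "0 \<le> P"
proof -
  have f: "w\<^sup>2 + of_real p = (w - \<i> * of_real b) * (w - - \<i> * of_real b)"
    by (simp add: p_def power2_eq_square algebra_simps)
  have ne: "w \<noteq> \<i> * of_real b" "w \<noteq> - \<i> * of_real b" using assms(1) f by auto
  have n: "(norm (\<i> * complex_of_real b))\<^sup>2 = p" "(norm (- \<i> * complex_of_real b))\<^sup>2 = p"
    by (simp_all add: norm_mult p_def)
  note K = pos_kernel_inv_stereographic[OF ne(1)] pos_kernel_inv_stereographic[OF ne(2)]
  have sum: "((ln (1 + (norm w)\<^sup>2) + ln (1 + (norm (\<i> * complex_of_real b))\<^sup>2)) / 2 - ln (norm (w - \<i> * of_real b))) +
     ((ln (1 + (norm w)\<^sup>2) + ln (1 + (norm (- \<i> * complex_of_real b))\<^sup>2)) / 2 - ln (norm (w - - \<i> * of_real b))) = P"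
    unfolding P_def n f norm_mult using ne by (simp add: ln_mult norm_mult p_def del: diff_minus_eq_add)
  show "pos_kernel (inv_stereographic w) (inv_stereographic (\<i> * of_real b)) +
      pos_kernel (inv_stereographic w) (inv_stereographic (- \<i> * of_real b)) = ennreal P"
    unfolding K(1,3) sum[symmetric] by (rule ennreal_plus[OF K(2,4), symmetric])
  show "0 \<le> P" unfolding sum[symmetric] by (rule add_nonneg_nonneg[OF K(2,4)])
qed

text \<open>The relation for \<open>s0\<close> turns \<open>L / s0\<close> into
  \<open>(1 + 2 * a) * (d * L)\<close>. The total potential minus \<open>F\<close> is then
  \<open>1 / 2 + a\<close> times the gap in \<open>has_integral_max_ln_big_root\<close>, which is
  nonnegative everywhere and zero on the droplet.\<close>

lemma equilibrium_measure_droplet: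
  fixes a :: real
  assumes a: "0 < a" "s0 * (d * (1 + 2 * a)) = 1" and l: "0 \<le> l"
    and Q: "\<And>x. x \<in> S2 \<Longrightarrow> Q x = enn2ereal (ennreal a * (pos_kernel x (inv_stereographic (\<i> * of_real b)) +
      pos_kernel x (inv_stereographic (- \<i> * of_real b)))) - ereal l"
  shows "equilibrium_measure Q = droplet_measure"
proof -
  define q' where "q' x = ennreal a * (pos_kernel x (inv_stereographic (\<i> * of_real b)) +
      pos_kernel x (inv_stereographic (- \<i> * of_real b)))" for x
  \<comment> \<open>Found by inserting \<open>d * L = ln p + X\<close> into the formula for
    \<open>V\<close>, where \<open>X\<close> cancels.\<close>
  define F where "F = (1 - ln s0) / 2 + a * ln (1 + p) - (1 / 2 + a) * ln p"
  have total: "F \<le> V \<and> (threshold w \<le> s0 \<longrightarrow> V = F)"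
    if w: "w \<noteq> 0" "w\<^sup>2 + of_real p \<noteq> 0"
      and V: "(\<integral>\<^sup>+x. pos_kernel x (inv_stereographic w) \<partial>droplet_measure) + q' (inv_stereographic w) = ennreal V" "0 \<le> V"
    for w V
  proof -
    obtain L where L: "((\<lambda>s. max 0 (ln (norm (big_root w s)))) has_integral L) {0..s0}"
      "d * L \<le> ln (p * (1 + (norm w)\<^sup>2) / norm (w\<^sup>2 + of_real p))"
      "threshold w \<le> s0 \<Longrightarrow> d * L = ln (p * (1 + (norm w)\<^sup>2) / norm (w\<^sup>2 + of_real p))"
      using has_integral_max_ln_big_root[OF s0 w] by blast
    define X where "X = ln (1 + (norm w)\<^sup>2) - ln (norm (w\<^sup>2 + of_real p))"
    have lnX: "ln (p * (1 + (norm w)\<^sup>2) / norm (w\<^sup>2 + of_real p)) = ln p + X"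
      unfolding X_def using pq(2) w(2) one_plus_norm_sq_pos[of w] by (simp add: ln_mult ln_div)
    have cX: "ln (1 + (norm w)\<^sup>2) + ln (1 + p) - ln (norm (w\<^sup>2 + of_real p)) = X + ln (1 + p)"
      by (simp add: X_def)
    note dp = droplet_potential[OF w L(1), folded X_def] and cp = charge_potential[OF w(2), unfolded cX]
    have 1: "0 \<le> (X + 1 - ln s0 - L / s0) / 2" and 2: "0 \<le> X + ln (1 + p)"
      using dp(2) cp(2) by simp_all
    have "ennreal V = ennreal ((X + 1 - ln s0 - L / s0) / 2) + ennreal a * ennreal (X + ln (1 + p))"
      unfolding V(1)[symmetric] q'_def dp(1) cp(1) ..
    also have "\<dots> = ennreal ((X + 1 - ln s0 - L / s0) / 2 + a * (X + ln (1 + p)))"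
      using 1 2 a(1) by (simp add: ennreal_mult)
    finally have V': "V = (X + 1 - ln s0 - L / s0) / 2 + a * (X + ln (1 + p))"
      using V(2) 1 2 a(1) by (subst (asm) ennreal_inj) auto
    have Ls: "L / s0 = (1 + 2 * a) * (d * L)"
      using a(2) s0(1) by (simp add: field_simps) algebra
    have "V - F = (1 / 2 + a) * (ln p + X - d * L)"
      unfolding V' F_def Ls by (simp add: algebra_simps add_divide_distrib diff_divide_distrib)
    moreover have "0 \<le> (1 / 2 + a) * (ln p + X - d * L)" using L(2) lnX a(1) by simp
    moreover have "threshold w \<le> s0 \<Longrightarrow> (1 / 2 + a) * (ln p + X - d * L) = 0" using L(3) lnX by simp
    ultimately show ?thesis by auto
  qed
  have real: "\<exists>V. (\<integral>\<^sup>+x. pos_kernel x (inv_stereographic w) \<partial>droplet_measure) + q' (inv_stereographic w) = ennreal V \<and> 0 \<le> V"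
    if w: "w \<noteq> 0" "w\<^sup>2 + of_real p \<noteq> 0" for w
  proof -
    obtain L where L: "((\<lambda>s. max 0 (ln (norm (big_root w s)))) has_integral L) {0..s0}"
      using has_integral_max_ln_big_root[OF s0 w] by blast
    have "\<exists>V. ennreal x + ennreal a * ennreal y = ennreal V \<and> 0 \<le> V" if "0 \<le> x" "0 \<le> y" for x y :: real
      using that a(1) by (intro exI[of _ "x + a * y"]) (simp add: ennreal_mult)
    then show ?thesis
      unfolding q'_def droplet_potential(1)[OF w L] charge_potential(1)[OF w(2)]
      using droplet_potential(2)[OF w L] charge_potential(2)[OF w(2)] by blast
  qed
  \<comment> \<open>The points that the potential formulas leave out: the north pole,
    \<open>w = 0\<close> and the two charges.\<close>
  define Z where "Z = {vector [0, 0, 1], inv_stereographic 0, inv_stereographic (\<i> * of_real b), inv_stereographic (- \<i> * of_real b)}"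
  have outZ: "\<exists>w. y = inv_stereographic w \<and> w \<noteq> 0 \<and> w\<^sup>2 + of_real p \<noteq> 0" if "y \<in> S2" "y \<notin> Z" for y
  proof -
    have "y \<noteq> vector [0, 0, 1]" using that(2) by (simp add: Z_def)
    with that(1) obtain w where w: "y = inv_stereographic w" by (rule sphere_cases)
    have "w\<^sup>2 + of_real p = (w - \<i> * of_real b) * (w + \<i> * of_real b)"
      by (simp add: p_def power2_eq_square algebra_simps)
    moreover have "w \<noteq> \<i> * of_real b" "w \<noteq> - \<i> * of_real b" "w \<noteq> 0" using that(2) w by (auto simp: Z_def)
    ultimately show ?thesis using w by (auto simp: add_eq_0_iff)
  qed
  have ae: "AE y in droplet_measure. (\<integral>\<^sup>+x. pos_kernel x y \<partial>droplet_measure) + q' y = ennreal F"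
  proof -
    have "AE x in param_measure. (\<integral>\<^sup>+y. pos_kernel y (param_map x) \<partial>droplet_measure) + q' (param_map x) = ennreal F"
      using AE_param
    proof eventually_elim
      case (elim x)
      then obtain s \<theta> where x: "x = (s, \<theta>)" "0 < s" "s \<le> s0" by auto
      define w where "w = plane_map s \<theta>"
      have t: "threshold w = s" unfolding w_def using threshold_plane_map[of s \<theta>] x s0 by simp
      then have "w \<noteq> 0" using x(2) by (auto simp: threshold_def)
      moreover have "w\<^sup>2 + of_real p \<noteq> 0" using threshold_charge[of w] t x(3) s0 by auto
      ultimately show ?case
        using real[of w] total[of w] t x by (auto simp: param_map_def w_def)
    qed
    moreover define h where "h y = (\<integral>\<^sup>+x. pos_kernel x y \<partial>droplet_measure) + q' y" for y
    have "h \<in> borel_measurable borel"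
      unfolding h_def[abs_def] q'_def using borel_measurable_potential[OF droplet_measure_in] by simp
    then have [measurable]: "h \<in> borel_measurable (restrict_space borel S2)"
      by (rule measurable_restrict_space1)
    have "{y \<in> space (restrict_space borel S2). h y = ennreal F} \<in> sets (restrict_space borel S2)"
      by measurable
    note AE_distr_iff[OF measurable_param_map this, folded droplet_measure_def]
    ultimately show ?thesis unfolding h_def by simp
  qed
  show ?thesis
  proof (rule equilibrium_measure_eqI[OF droplet_measure_in, where q = q' and c = l and F = "ennreal F" and Z = Z])
    show "q' \<in> borel_measurable borel" unfolding q'_def
      using borel_measurable_potential(2)[OF droplet_measure_in] by simp
    show "Q x = enn2ereal (q' x) - ereal l" if "x \<in> S2" for x unfolding q'_def by (rule Q[OF that])
    show "Z \<subseteq> S2" unfolding Z_def using north_pole_in_sphere inv_stereographic_in_sphere by blast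
    show "ennreal F \<le> (\<integral>\<^sup>+x. pos_kernel x y \<partial>droplet_measure) + q' y" if y: "y \<in> S2" "y \<notin> Z" for y
    proof -
      obtain w where w: "y = inv_stereographic w" "w \<noteq> 0" "w\<^sup>2 + of_real p \<noteq> 0" using outZ[OF y] by blast
      then obtain V where V: "(\<integral>\<^sup>+x. pos_kernel x y \<partial>droplet_measure) + q' y = ennreal V" "0 \<le> V"
        using real[of w] by auto
      have "F \<le> V" using total[OF w(2,3), of V] V w(1) by simp
      then show ?thesis unfolding V(1) by (rule ennreal_leI)
    qed
  qed (use l ae in \<open>auto simp: Z_def\<close>)
qed

end

text \<open>The filled ellipse is bounded, closed and convex with frontier \<open>E\<close>, and the
  \<open>inside\<close> of such a frontier is the interior.\<close>

lemma ellipse_Un_inside: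
  fixes A B :: real
  assumes "0 < A" "0 < B"
  defines "E \<equiv> {z. A * (Re z)\<^sup>2 + B * (Im z)\<^sup>2 = 1}"
  shows "E \<union> inside E = {z. A * (Re z)\<^sup>2 + B * (Im z)\<^sup>2 \<le> 1}"
    and "compact {z. A * (Re z)\<^sup>2 + B * (Im z)\<^sup>2 \<le> 1}"
proof -
  define f where "f z = A * (Re z)\<^sup>2 + B * (Im z)\<^sup>2" for z
  have fs: "f (of_real r * z) = r\<^sup>2 * f z" for r z
    by (simp add: f_def power_mult_distrib algebra_simps)
  define S where "S = {z. f z \<le> 1}"
  have cf: "continuous_on UNIV f" unfolding f_def by (intro continuous_intros)
  have "closed S" unfolding S_def by (rule closed_Collect_le[OF cf continuous_on_const])
  have "bounded S"
    unfolding bounded_iff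
  proof (intro exI ballI)
    fix z assume "z \<in> S"
    then have "A * (Re z)\<^sup>2 \<le> 1" "B * (Im z)\<^sup>2 \<le> 1"
      using assms(1,2) by (auto simp: S_def f_def intro: order_trans[rotated])
    then have "(Re z)\<^sup>2 \<le> 1 / A" "(Im z)\<^sup>2 \<le> 1 / B" using assms(1,2) by (simp_all add: field_simps)
    then show "norm z \<le> sqrt (1 / A + 1 / B)" unfolding cmod_def by (intro real_sqrt_le_mono) simp
  qed
  have "convex S"
  proof -
    define g where "g z = Complex (sqrt A * Re z) (sqrt B * Im z)" for z
    have "linear g" by (rule linearI) (simp_all add: g_def complex_eq_iff algebra_simps)
    have "(norm (g z))\<^sup>2 = f z" for z
      using assms(1,2) by (simp add: g_def f_def cmod_power2 power_mult_distrib)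
    then have "S = g -` cball 0 1"
      unfolding S_def using abs_square_le_1[of "norm (g z)" for z] by (auto simp: abs_square_le_1[of "norm (g _)", simplified, symmetric])
    then show ?thesis using convex_linear_vimage[OF \<open>linear g\<close> convex_cball] by simp
  qed
  have fr: "frontier S = E"
  proof -
    have "interior S = {z. f z < 1}"
    proof
      have "open {z. f z < 1}" by (rule open_Collect_less[OF cf continuous_on_const])
      then show "{z. f z < 1} \<subseteq> interior S" by (intro interior_maximal) (auto simp: S_def)
      show "interior S \<subseteq> {z. f z < 1}"
      proof
        fix z assume z: "z \<in> interior S"
        then obtain e where e: "0 < e" "ball z e \<subseteq> S" by (meson mem_interior)
        \<comment> \<open>Stretching \<open>z\<close> by \<open>1 + t\<close> moves it by
          \<open>t * norm z < e\<close>, so it stays in \<open>S\<close> and \<open>f z\<close> must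
          be below \<open>1\<close>; the \<open>+ 1\<close> in the denominator covers
          \<open>z = 0\<close>.\<close>
        define t where "t = e / (2 * (norm z + 1))"
        have t: "0 < t" unfolding t_def using e(1) by (intro divide_pos_pos mult_pos_pos add_nonneg_pos) auto
        have "t * norm z < e"
        proof -
          have "t * norm z \<le> t * (norm z + 1)" using t by simp
          also have "\<dots> = e / 2" unfolding t_def using norm_ge_zero[of z] by (simp add: field_simps add_nonneg_eq_0_iff)
          finally show ?thesis using e(1) by simp
        qed
        moreover have "dist z (of_real (1 + t) * z) = t * norm z"
        proof -
          have "z - of_real (1 + t) * z = of_real (- t) * z" by (simp add: algebra_simps)
          then show ?thesis unfolding dist_norm using t by (simp only: norm_mult norm_of_real)
        qed
        ultimately have "of_real (1 + t) * z \<in> S" using e(2) by auto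
        then have le: "(1 + t)\<^sup>2 * f z \<le> 1" by (simp only: S_def fs mem_Collect_eq)
        show "z \<in> {z. f z < 1}"
        proof (rule ccontr)
          assume "z \<notin> {z. f z < 1}"
          then have "1 \<le> f z" by simp
          moreover have "1 < (1 + t)\<^sup>2" using t by simp
          ultimately have "1 < (1 + t)\<^sup>2 * f z" using mult_left_mono[of 1 "f z" "(1 + t)\<^sup>2"] by simp
          then show False using le by simp
        qed
      qed
    qed
    then show ?thesis using \<open>closed S\<close> by (auto simp: frontier_def closure_closed S_def E_def f_def)
  qed
  have "inside E = interior S" using inside_frontier_eq_interior[OF \<open>bounded S\<close> \<open>convex S\<close>] fr by simp
  moreover have "frontier S \<union> interior S = S"
    using \<open>closed S\<close> interior_subset[of S] by (auto simp: frontier_def closure_closed)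
  ultimately show "E \<union> inside E = {z. A * (Re z)\<^sup>2 + B * (Im z)\<^sup>2 \<le> 1}" using fr by (simp add: S_def f_def)
  show "compact {z. A * (Re z)\<^sup>2 + B * (Im z)\<^sup>2 \<le> 1}"
    using \<open>bounded S\<close> \<open>closed S\<close> unfolding S_def f_def by (simp add: compact_eq_bounded_closed)
qed

text \<open>Clearing the denominator \<open>1 + (norm w)\<^sup>2\<close> of \<open>threshold\<close>
  moves the term \<open>(Re w)\<^sup>2 + (Im w)\<^sup>2\<close> to the left side, which is the
  source of both \<open>- 1\<close>.\<close>

lemma (in two_charges) threshold_le_iff:
  assumes "0 < s"
  shows "threshold w \<le> s \<longleftrightarrow>
    (1 / ((c + 2) * s) - 1) * (Re w)\<^sup>2 + (1 / ((c - 2) * s) - 1) * (Im w)\<^sup>2 \<le> 1"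
proof -
  define k where "k = d\<^sup>2 * s"
  have k: "0 < k" "k = (c - 2) * (c + 2) * s"
    unfolding k_def using assms pq(6) by (simp, simp add: pq(7))
  have pos: "0 < d\<^sup>2 * (1 + (norm w)\<^sup>2)" using pq(6) one_plus_norm_sq_pos[of w] by simp
  have "threshold w \<le> s \<longleftrightarrow> d\<^sup>2 * (1 + (norm w)\<^sup>2) * threshold w \<le> d\<^sup>2 * (1 + (norm w)\<^sup>2) * s"
    using pos by (simp only: mult_le_cancel_left_pos)
  also have "\<dots> \<longleftrightarrow> ((c - 2) - k) * (Re w)\<^sup>2 + ((c + 2) - k) * (Im w)\<^sup>2 \<le> k * 1"
    unfolding threshold_eq unfolding cmod_power2 k_def by (simp add: algebra_simps)
  also have "((c - 2) - k) * (Re w)\<^sup>2 + ((c + 2) - k) * (Im w)\<^sup>2 =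
      k * ((1 / ((c + 2) * s) - 1) * (Re w)\<^sup>2 + (1 / ((c - 2) * s) - 1) * (Im w)\<^sup>2)"
  proof -
    have "k * (1 / ((c + 2) * s) - 1) = (c - 2) - k" "k * (1 / ((c - 2) * s) - 1) = (c + 2) - k"
      unfolding right_diff_distrib using assms pq(5) by (simp_all add: k(2))
    then show ?thesis by algebra
  qed
  finally show ?thesis using k(1) by (simp only: mult_le_cancel_left_pos)
qed

lemma ereal_charges:
  fixes A B :: ennreal and a l :: real
  assumes "0 < a"
  shows "ereal a * (enn2ereal A - ereal l) + ereal a * (enn2ereal B - ereal l) =
    enn2ereal (ennreal a * (A + B)) - ereal (2 * a * l)"
proof (cases "A = top \<or> B = top")
  case True
  then have "ennreal a * (A + B) = top" using assms by (auto simp: ennreal_mult_top)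
  then show ?thesis using True assms
    by (cases A; cases B) (auto simp: ennreal.rep_eq)
next
  case False
  then obtain x y where xy: "0 \<le> x" "A = ennreal x" "0 \<le> y" "B = ennreal y" by (cases A; cases B) auto
  then have "ennreal a * (A + B) = ennreal (a * (x + y))" using assms by (simp add: ennreal_mult)
  then have "enn2ereal (ennreal a * (A + B)) = ereal (a * (x + y))" using xy assms by (simp add: enn2ereal_ennreal)
  then show ?thesis using xy by (simp add: algebra_simps)
qed

theorem theorem1p1:
  fixes a b :: real and p1 p2 :: "real ^ 3" and Q :: "real ^ 3 \<Rightarrow> ereal"
    and D :: "(real ^ 3) set" and \<Omega> :: "complex option set" and E :: "complex set"
  assumes "b \<ge> 1"
    and "p1 \<in> S2" and "stereographic p1 = Some (\<i> * complex_of_real b)"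
    and "p2 \<in> S2" and "stereographic p2 = Some (- \<i> * complex_of_real b)"
    and "a > 0" and "ereal a > a_cr b"
    and "Q = (\<lambda>x. ereal a * log_kernel x p1 + ereal a * log_kernel x p2)"
    and "D = measure_support (equilibrium_measure Q)"
    and "\<Omega> = stereographic ` D"
    and "E = {z. 2 * (b\<^sup>2 * a - a - 1) / (b\<^sup>2 + 1) * (Re z)\<^sup>2
                + 2 * (b\<^sup>2 * a + a + 1) / (b\<^sup>2 - 1) * (Im z)\<^sup>2 = 1}"
  shows "compact (E \<union> inside E) \<and> \<Omega> = Some ` (E \<union> inside E)"
proof -
  have "b \<noteq> 1" using assms(7) by (auto simp: a_cr_def)
  then have b: "1 < b" using assms(1) by simp
  then have b2: "1 < b\<^sup>2" by simp
  have acr: "1 < a * (b\<^sup>2 - 1)"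
    using assms(7) b b2 by (simp add: a_cr_def field_simps)
  interpret two_charges b by unfold_locales (rule b)
  define s0 where "s0 = 1 / (d * (1 + 2 * a))"
  have da: "0 < d * (1 + 2 * a)" using pq(6) assms(6) by simp
  have db: "d * b\<^sup>2 = (b\<^sup>2 - 1) * (b\<^sup>2 + 1)" "(c + 2) * b\<^sup>2 = (b\<^sup>2 + 1)\<^sup>2" "(c - 2) * b\<^sup>2 = (b\<^sup>2 - 1)\<^sup>2"
    unfolding c_def d_def p_def[symmetric] using pq(1) by algebra+
  have dc: "d * (b\<^sup>2 + 1) = (c + 2) * (b\<^sup>2 - 1)" "d * (b\<^sup>2 - 1) = (c - 2) * (b\<^sup>2 + 1)"
  proof -
    have "b\<^sup>2 * (d * (b\<^sup>2 + 1)) = b\<^sup>2 * ((c + 2) * (b\<^sup>2 - 1))" "b\<^sup>2 * (d * (b\<^sup>2 - 1)) = b\<^sup>2 * ((c - 2) * (b\<^sup>2 + 1))"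
      using db by algebra+
    then show "d * (b\<^sup>2 + 1) = (c + 2) * (b\<^sup>2 - 1)" "d * (b\<^sup>2 - 1) = (c - 2) * (b\<^sup>2 + 1)" using b by simp_all
  qed
  \<comment> \<open>By \<open>dc\<close> the claim reduces to
    \<open>b\<^sup>2 + 1 < (b\<^sup>2 - 1) * (1 + 2 * a)\<close>, which is
    \<open>1 < a * (b\<^sup>2 - 1)\<close>.\<close>
  have "s0 < s_crit"
  proof -
    have "(c + 2) * (b\<^sup>2 + 1) < (c + 2) * ((b\<^sup>2 - 1) * (1 + 2 * a))"
      using acr pq(5) by (intro mult_strict_left_mono) (simp_all add: algebra_simps)
    also have "\<dots> = d * (1 + 2 * a) * (b\<^sup>2 + 1)" using dc(1) by algebra
    finally have "c + 2 < d * (1 + 2 * a)" by (rule mult_right_less_imp_less) simp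
    then show ?thesis unfolding s0_def s_crit_def 
      by (rule divide_strict_left_mono[OF _ _ mult_pos_pos]) (use pq(5) da in auto)
  qed
  then interpret droplet b s0 by unfold_locales (use da in \<open>simp_all add: s0_def\<close>)
  have p12: "p1 = inv_stereographic (\<i> * of_real b)" "p2 = inv_stereographic (- \<i> * of_real b)"
    using inv_stereographic_unique assms(2-5) by blast+
  have eq: "equilibrium_measure Q = droplet_measure"
  \<comment> \<open>Each of the two kernels in \<open>Q\<close> is \<open>pos_kernel\<close> minus
    \<open>ln 2\<close>, weighted by \<open>a\<close>; this gives the value of
    \<open>l\<close>.\<close>
  proof (rule equilibrium_measure_droplet[where a = a and l = "2 * a * ln 2"])
    show "s0 * (d * (1 + 2 * a)) = 1" unfolding s0_def using less_imp_neq[OF da] by simp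
    fix x assume x: "x \<in> S2"
    show "Q x = enn2ereal (ennreal a * (pos_kernel x (inv_stereographic (\<i> * of_real b)) +
        pos_kernel x (inv_stereographic (- \<i> * of_real b)))) - ereal (2 * a * ln 2)"
      unfolding assms(8) p12 log_kernel_eq_pos_kernel[OF x inv_stereographic_in_sphere]
      by (rule ereal_charges[OF assms(6)])
  qed (use assms(6) in simp_all)
  define A B where "A = 2 * (b\<^sup>2 * a - a - 1) / (b\<^sup>2 + 1)" and "B = 2 * (b\<^sup>2 * a + a + 1) / (b\<^sup>2 - 1)"
  have AB: "0 < A" "0 < B"
    unfolding A_def B_def using acr b2 assms(6)
    by (auto intro!: divide_pos_pos mult_pos_pos add_pos_pos simp: algebra_simps add_pos_nonneg)
  have "1 / ((c + 2) * s0) - 1 = A"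
  proof -
    have "1 / ((c + 2) * s0) = d * (1 + 2 * a) / (c + 2)" using da by (simp add: s0_def)
    also have "\<dots> = (b\<^sup>2 - 1) * (1 + 2 * a) / (b\<^sup>2 + 1)"
      using dc(1) pq(5) b2 by (simp add: divide_simps)
    finally show ?thesis unfolding A_def using b2 by (simp add: field_simps)
  qed
  moreover have "1 / ((c - 2) * s0) - 1 = B"
  proof -
    have "1 / ((c - 2) * s0) = d * (1 + 2 * a) / (c - 2)" using da by (simp add: s0_def)
    also have "\<dots> = (b\<^sup>2 + 1) * (1 + 2 * a) / (b\<^sup>2 - 1)"
      using dc(2) pq(5) b2 by (simp add: divide_simps)
    finally show ?thesis unfolding B_def using b2 by (simp add: field_simps)
  qed
  ultimately have set: "{w. threshold w \<le> s0} = {z. A * (Re z)\<^sup>2 + B * (Im z)\<^sup>2 \<le> 1}"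
    using threshold_le_iff[OF s0(1)] by simp
  have E: "E = {z. A * (Re z)\<^sup>2 + B * (Im z)\<^sup>2 = 1}" unfolding assms(11) A_def B_def ..
  have "\<Omega> = stereographic ` inv_stereographic ` {w. threshold w \<le> s0}"
    unfolding assms(9,10) eq measure_support_droplet ..
  also have "\<dots> = Some ` {w. threshold w \<le> s0}" by (simp add: image_image)
  finally have "\<Omega> = Some ` (E \<union> inside E)"
    unfolding set E ellipse_Un_inside(1)[OF AB] .
  moreover have "compact (E \<union> inside E)"
    unfolding E ellipse_Un_inside(1)[OF AB] by (rule ellipse_Un_inside(2)[OF AB])
  ultimately show ?thesis by simp
qed

end
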